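(* Let $\mathcal G$ be a connected metric graph with finitely many edges which is either compact, or noncompact with non-empty compact core $\mathcal K$ (if $\mathcal G$ is compact, $\mathcal K=\mathcal G$). Let $p>2$, and let $A:\mathcal G\to\mathbb R$, $V:\mathcal G\to[1,+\infty)$ satisfy $A\in L^2_{\rm loc}(\mathcal G,\mathbb R)$, $V\in L^1_{\rm loc}(\mathcal G,\mathbb R)$. Assume that at least one of the following holds: (G) the infimum $\lambda_1=\inf_{u\in H^1_A(\mathcal G,\mathbb C)\setminus\{0\}}\|u\|^2/\|u\|_2^2$ is achieved by some $\varphi_1$ with $\varphi_1|_{\mathcal K}\not\equiv 0$; (G$_m$) there exist $m\ge 1$ (possibly $m=+\infty$) distinct eigenvalues of $D_A^2+V(x)$ below $\inf\sigma_{\rm ess}(D_A^2+V(x))$, i.e. $D_A^2+V(x)$ has an increasing sequence of $m$ eigenvalues $1\le\lambda_1<\lambda_2<\dots<\lambda_j<\dots$ with $\lambda_j<\inf\sigma_{\rm ess}(D_A^2+V(x))$ for every $j$. Then, for any $\mu>0$, one of the following two alternatives occurs: (i) either $E(\cdot,\mathcal G)$ has a critical point $u\in H^1_A(\mathcal G,\mathbb C)$ constrained on $H_\mu(\mathcal G)$ with Lagrange multiplier $\lambda\in(-\infty,\lambda_1]$ (and $\lambda\in(-\infty,\lambda_1)$ if (G) holds); (ii) or, for every $\lambda\in(-\infty,\lambda_1)$, $E(\cdot,\mathcal G)$ has a critical point $u\in H^1_A(\mathcal G,\mathbb C)$ constrained on $H_\nu(\mathcal G)$ for some $0<\nu<\mu$,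 and the corresponding Lagrange multiplier is $\lambda$.
   Context: Metric graphs: each bounded edge $e$ of $\mathcal G=(\mathrm V,\mathrm E)$ is identified with $I_e=[0,\ell_e]$, $\ell_e>0$, each unbounded edge with $I_e=[0,+\infty)$. The compact core $\mathcal K$ is the metric subgraph consisting of all bounded edges. A function $u:\mathcal G\to\mathbb C$ is identified with the family $(u_e)_{e\in\mathrm E}$, $u_e:I_e\to\mathbb C$; $L^p(\mathcal G,\mathbb C)=\bigoplus_e L^p(I_e,\mathbb C)$ with norm $\|\cdot\|_p$. $A\in L^2_{\rm loc}$, $V\in L^1_{\rm loc}$ mean $A\in L^2(B)$, $V\in L^1(B)$ for every bounded $B\subset\mathcal G$. Magnetic Sobolev space: $D_A=\frac1i\frac{d}{dx}-A(x)$ (edgewise, weak derivative), $H^1_A(\mathcal G,\mathbb C)=\{u\in C(\mathcal G,\mathbb C): D_Au\in L^2(\mathcal G,\mathbb C),\ \int_{\mathcal G}V|u|^2dx<+\infty\}$, with $\|u\|^2=\int_{\mathcal G}(|D_Au|^2+V|u|^2)dx$ and real inner products $(u,v)=\operatorname{Re}\int_{\mathcal G}(D_Au\overline{D_Av}+Vu\bar v)dx$, $(u,v)_2=\operatorname{Re}\int_{\mathcal G}u\bar v\,dx$. Operator: $D_A^2+V(x)$ denotes the unique self-adjoint operator $T$ in the complex Hilbert space $L^2(\mathcal G,\mathbb C)$ with $\operatorname{dom}(T)\subset H^1_A(\mathcal G,\mathbb C)$ and $\int_{\mathcal G}(D_Au\overline{D_Av}+Vu\bar v)dx=\int_{\mathcal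 G}(Tu)\bar v\,dx$ for all $u\in\operatorname{dom}(T)$, $v\in H^1_A(\mathcal G,\mathbb C)$. $\sigma_{\rm ess}$ is its essential spectrum, with $\inf\emptyset=+\infty$. The symbol $\lambda_1$ always denotes $\inf_{u\neq0}\|u\|^2/\|u\|_2^2$ (under (G$_m$) it is the first eigenvalue). Energy: $E(u,\mathcal G)=\frac12\|u\|^2-\frac1p\int_{\mathcal K}|u|^pdx$ on $H^1_A(\mathcal G,\mathbb C)$ (with $\mathcal K=\mathcal G$ if $\mathcal G$ is compact). For $\mu>0$, $H_\mu(\mathcal G)=\{u\in H^1_A(\mathcal G,\mathbb C):\int_{\mathcal G}|u|^2dx=\mu\}$. $u\in H_\mu(\mathcal G)$ is a critical point of $E(\cdot,\mathcal G)$ constrained on $H_\mu(\mathcal G)$ with Lagrange multiplier $\lambda\in\mathbb R$ if $(u,v)-\operatorname{Re}\int_{\mathcal K}|u|^{p-2}u\bar v\,dx=\lambda(u,v)_2$ for all $v\in H^1_A(\mathcal G,\mathbb C)$. *)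

theory Defs
  imports "HOL-Analysis.Analysis"
begin

section \<open>Metric graphs\<close>

text \<open>
  Multi-edges and self-loops are allowed. An edge \<open>e\<close> with \<open>len G e < \<infinity>\<close> runs from \<open>src G e\<close>
  (coordinate 0) to \<open>tgt G e\<close> (coordinate \<open>len G e\<close>). An edge of infinite length is a half-line
  attached at \<open>src G e\<close>; its \<open>tgt\<close> carries no meaning and is never used.
\<close>

record ('v, 'e) metric_graph =
  verts :: "'v set"
  edges :: "'e set"
  src :: "'e \<Rightarrow> 'v"
  tgt :: "'e \<Rightarrow> 'v"
  len :: "'e \<Rightarrow> ereal"

definition bounded_edges :: "('v, 'e) metric_graph \<Rightarrow> 'e set" where
  "bounded_edges G = {e \<in> edges G. len G e < \<infinity>}"

definition finite_metric_graph :: "('v, 'e) metric_graph \<Rightarrow> bool" where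
  "finite_metric_graph G \<longleftrightarrow>
     finite (edges G) \<and>
     (\<forall>e\<in>edges G. 0 < len G e \<and> src G e \<in> verts G) \<and>
     (\<forall>e\<in>bounded_edges G. tgt G e \<in> verts G)"

definition adjacency :: "('v, 'e) metric_graph \<Rightarrow> 'v rel" where
  "adjacency G = {(src G e, tgt G e) | e. e \<in> bounded_edges G}"

definition connected_graph :: "('v, 'e) metric_graph \<Rightarrow> bool" where
  "connected_graph G \<longleftrightarrow>
     (\<forall>v\<in>verts G. \<forall>w\<in>verts G. (v, w) \<in> (adjacency G \<union> (adjacency G)\<inverse>)\<^sup>*)"

definition compact_graph :: "('v, 'e) metric_graph \<Rightarrow> bool" where
  "compact_graph G \<longleftrightarrow> (\<forall>e\<in>edges G. len G e < \<infinity>)"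

text \<open>The compact core is represented by its set of edges, \<open>bounded_edges G\<close>. If the graph is
  compact this is the set of all edges, so that the core is then the whole graph.\<close>

definition edge_dom :: "('v, 'e) metric_graph \<Rightarrow> 'e \<Rightarrow> real set" where
  "edge_dom G e = {x. 0 \<le> x \<and> ereal x \<le> len G e}"


section \<open>Functions on a metric graph\<close>

text \<open>A function on \<open>G\<close> is a family of functions indexed by edges. Only the values \<open>u e x\<close> with
  \<open>e \<in> edges G\<close> and \<open>x \<in> edge_dom G e\<close> matter. Elements of \<open>L\<^sup>2\<close> are represented by functions, with
  \<open>ae_eq\<close> in the role of equality.\<close>

definition zero_on :: "('v, 'e) metric_graph \<Rightarrow> 'e set \<Rightarrow> ('e \<Rightarrow> real \<Rightarrow> complex) \<Rightarrow> bool" where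
  "zero_on G F u \<longleftrightarrow> (\<forall>e\<in>F. \<forall>x\<in>edge_dom G e. u e x = 0)"

definition ae_eq ::
  "('v, 'e) metric_graph \<Rightarrow> ('e \<Rightarrow> real \<Rightarrow> complex) \<Rightarrow> ('e \<Rightarrow> real \<Rightarrow> complex) \<Rightarrow> bool" where
  "ae_eq G u v \<longleftrightarrow> (\<forall>e\<in>edges G. AE x in lebesgue. x \<in> edge_dom G e \<longrightarrow> u e x = v e x)"

definition graph_integrable :: "('v, 'e) metric_graph \<Rightarrow> 'e set \<Rightarrow>
    ('e \<Rightarrow> real \<Rightarrow> 'b::{banach, second_countable_topology}) \<Rightarrow> bool" where
  "graph_integrable G F f \<longleftrightarrow> (\<forall>e\<in>F. set_integrable lebesgue (edge_dom G e) (f e))"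

definition graph_integral :: "('v, 'e) metric_graph \<Rightarrow> 'e set \<Rightarrow>
    ('e \<Rightarrow> real \<Rightarrow> 'b::{banach, second_countable_topology}) \<Rightarrow> 'b" where
  "graph_integral G F f = (\<Sum>e\<in>F. LINT x:edge_dom G e|lebesgue. f e x)"

definition L2_on :: "real set \<Rightarrow> (real \<Rightarrow> 'b::{banach, second_countable_topology}) \<Rightarrow> bool" where
  "L2_on S f \<longleftrightarrow>
     set_borel_measurable lebesgue S f \<and> set_integrable lebesgue S (\<lambda>x. (norm (f x))\<^sup>2)"

definition L2 :: "('v, 'e) metric_graph \<Rightarrow> ('e \<Rightarrow> real \<Rightarrow> complex) set" where
  "L2 G = {u. \<forall>e\<in>edges G. L2_on (edge_dom G e) (u e)}"

text \<open>As there are finitely many edges, a subset of the graph is bounded iff its trace on each edge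
  is bounded.\<close>

definition L2_loc :: "('v, 'e) metric_graph \<Rightarrow> ('e \<Rightarrow> real \<Rightarrow> real) \<Rightarrow> bool" where
  "L2_loc G f \<longleftrightarrow>
     (\<forall>e\<in>edges G. \<forall>B\<in>sets lebesgue. B \<subseteq> edge_dom G e \<and> bounded B \<longrightarrow> L2_on B (f e))"

definition L1_loc :: "('v, 'e) metric_graph \<Rightarrow> ('e \<Rightarrow> real \<Rightarrow> real) \<Rightarrow> bool" where
  "L1_loc G f \<longleftrightarrow>
     (\<forall>e\<in>edges G. \<forall>B\<in>sets lebesgue. B \<subseteq> edge_dom G e \<and> bounded B \<longrightarrow>
        set_integrable lebesgue B (f e))"

definition l2_inner ::
  "('v, 'e) metric_graph \<Rightarrow> ('e \<Rightarrow> real \<Rightarrow> complex) \<Rightarrow> ('e \<Rightarrow> real \<Rightarrow> complex) \<Rightarrow> complex" where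
  "l2_inner G u v = graph_integral G (edges G) (\<lambda>e x. u e x * cnj (v e x))"

definition l2_normsq :: "('v, 'e) metric_graph \<Rightarrow> ('e \<Rightarrow> real \<Rightarrow> complex) \<Rightarrow> real" where
  "l2_normsq G u = graph_integral G (edges G) (\<lambda>e x. (cmod (u e x))\<^sup>2)"

text \<open>\<open>w\<close> below collects the values at the vertices.\<close>

definition graph_continuous :: "('v, 'e) metric_graph \<Rightarrow> ('e \<Rightarrow> real \<Rightarrow> complex) \<Rightarrow> bool" where
  "graph_continuous G u \<longleftrightarrow>
     (\<forall>e\<in>edges G. continuous_on (edge_dom G e) (u e)) \<and>
     (\<exists>w :: 'v \<Rightarrow> complex.
        (\<forall>e\<in>edges G. u e 0 = w (src G e)) \<and>
        (\<forall>e\<in>bounded_edges G. u e (real_of_ereal (len G e)) = w (tgt G e)))"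


section \<open>The magnetic Sobolev space\<close>

definition test_functions :: "real set \<Rightarrow> (real \<Rightarrow> real) set" where
  "test_functions S =
     {\<phi>. (\<forall>n x. ((deriv ^^ n) \<phi>) differentiable (at x)) \<and>
         (\<exists>K. compact K \<and> K \<subseteq> S \<and> (\<forall>x. x \<notin> K \<longrightarrow> \<phi> x = 0))}"

definition weak_deriv_on :: "real set \<Rightarrow> (real \<Rightarrow> complex) \<Rightarrow> (real \<Rightarrow> complex) \<Rightarrow> bool" where
  "weak_deriv_on S u w \<longleftrightarrow>
     (\<forall>K. compact K \<and> K \<subseteq> S \<longrightarrow> set_integrable lebesgue K u \<and> set_integrable lebesgue K w) \<and>
     (\<forall>\<phi>\<in>test_functions S.
        (LINT x:S|lebesgue. u x * of_real (deriv \<phi> x)) =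
        - (LINT x:S|lebesgue. w x * of_real (\<phi> x)))"

definition has_weak_deriv ::
  "('v, 'e) metric_graph \<Rightarrow> ('e \<Rightarrow> real \<Rightarrow> complex) \<Rightarrow> ('e \<Rightarrow> real \<Rightarrow> complex) \<Rightarrow> bool" where
  "has_weak_deriv G u w \<longleftrightarrow> (\<forall>e\<in>edges G. weak_deriv_on (interior (edge_dom G e)) (u e) (w e))"

text \<open>Weak derivatives are unique only up to \<open>ae_eq\<close>; an arbitrary representative is chosen. It is
  only ever used under integrals or up to null sets.\<close>

definition weak_deriv ::
  "('v, 'e) metric_graph \<Rightarrow> ('e \<Rightarrow> real \<Rightarrow> complex) \<Rightarrow> ('e \<Rightarrow> real \<Rightarrow> complex)" where
  "weak_deriv G u = (SOME w. has_weak_deriv G u w)"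

definition mag_deriv :: "('v, 'e) metric_graph \<Rightarrow> ('e \<Rightarrow> real \<Rightarrow> real) \<Rightarrow>
    ('e \<Rightarrow> real \<Rightarrow> complex) \<Rightarrow> ('e \<Rightarrow> real \<Rightarrow> complex)" where
  "mag_deriv G A u = (\<lambda>e x. (1 / \<i>) * weak_deriv G u e x - of_real (A e x) * u e x)"

text \<open>The existence clause is needed since otherwise \<open>weak_deriv G u\<close> would be meaningless.\<close>

definition H1A :: "('v, 'e) metric_graph \<Rightarrow> ('e \<Rightarrow> real \<Rightarrow> real) \<Rightarrow> ('e \<Rightarrow> real \<Rightarrow> real) \<Rightarrow>
    ('e \<Rightarrow> real \<Rightarrow> complex) set" where
  "H1A G A V =
     {u. graph_continuous G u \<and> (\<exists>w. has_weak_deriv G u w) \<and> mag_deriv G A u \<in> L2 G \<and>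
         graph_integrable G (edges G) (\<lambda>e x. V e x * (cmod (u e x))\<^sup>2)}"

definition mag_form :: "('v, 'e) metric_graph \<Rightarrow> ('e \<Rightarrow> real \<Rightarrow> real) \<Rightarrow> ('e \<Rightarrow> real \<Rightarrow> real) \<Rightarrow>
    ('e \<Rightarrow> real \<Rightarrow> complex) \<Rightarrow> ('e \<Rightarrow> real \<Rightarrow> complex) \<Rightarrow> complex" where
  "mag_form G A V u v =
     graph_integral G (edges G)
       (\<lambda>e x. mag_deriv G A u e x * cnj (mag_deriv G A v e x) + of_real (V e x) * u e x * cnj (v e x))"

definition mag_normsq :: "('v, 'e) metric_graph \<Rightarrow> ('e \<Rightarrow> real \<Rightarrow> real) \<Rightarrow> ('e \<Rightarrow> real \<Rightarrow> real) \<Rightarrow>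
    ('e \<Rightarrow> real \<Rightarrow> complex) \<Rightarrow> real" where
  "mag_normsq G A V u =
     graph_integral G (edges G)
       (\<lambda>e x. (cmod (mag_deriv G A u e x))\<^sup>2 + V e x * (cmod (u e x))\<^sup>2)"

definition lambda1 ::
  "('v, 'e) metric_graph \<Rightarrow> ('e \<Rightarrow> real \<Rightarrow> real) \<Rightarrow> ('e \<Rightarrow> real \<Rightarrow> real) \<Rightarrow> real" where
  "lambda1 G A V =
     Inf {mag_normsq G A V u / l2_normsq G u | u. u \<in> H1A G A V \<and> \<not> zero_on G (edges G) u}"


section \<open>Operators in \<open>L\<^sup>2\<close> and their spectra\<close>

text \<open>
  An operator in \<open>L\<^sup>2\<close> is given by its graph, the set of all pairs of representatives \<open>(u, f)\<close> such
  that (the class of) \<open>u\<close> lies in the domain and is mapped to (the class of) \<open>f\<close>.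
\<close>

type_synonym 'e l2_op = "(('e \<Rightarrow> real \<Rightarrow> complex) \<times> ('e \<Rightarrow> real \<Rightarrow> complex)) set"

definition linear_operator :: "('v, 'e) metric_graph \<Rightarrow> 'e l2_op \<Rightarrow> bool" where
  "linear_operator G T \<longleftrightarrow>
     T \<subseteq> L2 G \<times> L2 G \<and>
     ((\<lambda>e x. 0), (\<lambda>e x. 0)) \<in> T \<and>
     (\<forall>u f v g c. (u, f) \<in> T \<and> (v, g) \<in> T \<longrightarrow>
        ((\<lambda>e x. u e x + c * v e x), (\<lambda>e x. f e x + c * g e x)) \<in> T) \<and>
     (\<forall>u f v g. (u, f) \<in> T \<and> v \<in> L2 G \<and> g \<in> L2 G \<and> ae_eq G u v \<and> ae_eq G f g \<longrightarrow> (v, g) \<in> T) \<and>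
     (\<forall>u f g. (u, f) \<in> T \<and> (u, g) \<in> T \<longrightarrow> ae_eq G f g)"

definition densely_defined :: "('v, 'e) metric_graph \<Rightarrow> 'e l2_op \<Rightarrow> bool" where
  "densely_defined G T \<longleftrightarrow>
     (\<forall>f\<in>L2 G. \<forall>\<epsilon>>0. \<exists>(u, h)\<in>T. l2_normsq G (\<lambda>e x. f e x - u e x) < \<epsilon>)"

definition adjoint_operator :: "('v, 'e) metric_graph \<Rightarrow> 'e l2_op \<Rightarrow> 'e l2_op" where
  "adjoint_operator G T =
     {(v, w). v \<in> L2 G \<and> w \<in> L2 G \<and> (\<forall>(u, f)\<in>T. l2_inner G f v = l2_inner G u w)}"

definition self_adjoint :: "('v, 'e) metric_graph \<Rightarrow> 'e l2_op \<Rightarrow> bool" where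
  "self_adjoint G T \<longleftrightarrow> linear_operator G T \<and> densely_defined G T \<and> T = adjoint_operator G T"

definition eigenspace :: "'e l2_op \<Rightarrow> complex \<Rightarrow> ('e \<Rightarrow> real \<Rightarrow> complex) set" where
  "eigenspace T z = {u. (u, \<lambda>e x. z * u e x) \<in> T}"

definition eigenvalue :: "('v, 'e) metric_graph \<Rightarrow> 'e l2_op \<Rightarrow> complex \<Rightarrow> bool" where
  "eigenvalue G T z \<longleftrightarrow> (\<exists>u\<in>eigenspace T z. \<not> ae_eq G u (\<lambda>e x. 0))"

definition finite_multiplicity :: "('v, 'e) metric_graph \<Rightarrow> 'e l2_op \<Rightarrow> complex \<Rightarrow> bool" where
  "finite_multiplicity G T z \<longleftrightarrow>
     (\<exists>B. finite B \<and> (\<forall>u\<in>eigenspace T z. \<exists>c. ae_eq G u (\<lambda>e x. \<Sum>b\<in>B. c b * b e x)))"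

text \<open>\<open>T - z\<close> maps its domain onto \<open>L\<^sup>2\<close> and has a bounded inverse; injectivity is implied by the
  estimate.\<close>

definition resolvent_set :: "('v, 'e) metric_graph \<Rightarrow> 'e l2_op \<Rightarrow> complex set" where
  "resolvent_set G T =
     {z. (\<forall>f\<in>L2 G. \<exists>(u, h)\<in>T. ae_eq G (\<lambda>e x. h e x - z * u e x) f) \<and>
         (\<exists>C. \<forall>(u, h)\<in>T. l2_normsq G u \<le> C * l2_normsq G (\<lambda>e x. h e x - z * u e x))}"

definition spectrum :: "('v, 'e) metric_graph \<Rightarrow> 'e l2_op \<Rightarrow> complex set" where
  "spectrum G T = - resolvent_set G T"

text \<open>The essential spectrum of a self-adjoint operator: all of the spectrum except the isolated
  eigenvalues of finite multiplicity.\<close>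

definition discrete_spectrum :: "('v, 'e) metric_graph \<Rightarrow> 'e l2_op \<Rightarrow> complex set" where
  "discrete_spectrum G T =
     {z. z isolated_in spectrum G T \<and> eigenvalue G T z \<and> finite_multiplicity G T z}"

definition essential_spectrum :: "('v, 'e) metric_graph \<Rightarrow> 'e l2_op \<Rightarrow> complex set" where
  "essential_spectrum G T = spectrum G T - discrete_spectrum G T"

text \<open>The spectrum of a self-adjoint operator is real, so taking real parts loses nothing. In
  \<open>ereal\<close> the infimum of the empty set is \<open>\<infinity>\<close>.\<close>

definition inf_ess :: "('v, 'e) metric_graph \<Rightarrow> 'e l2_op \<Rightarrow> ereal" where
  "inf_ess G T = (INF z\<in>essential_spectrum G T. ereal (Re z))"

text \<open>\<open>T\<close> is the operator \<open>D\<^sub>A\<^sup>2 + V\<close>. The function \<open>u'\<close> is the continuous representative of the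
  class of \<open>u\<close>; its existence expresses that the domain is contained in \<open>H1A G A V\<close>.\<close>

definition is_mag_schroedinger :: "('v, 'e) metric_graph \<Rightarrow> ('e \<Rightarrow> real \<Rightarrow> real) \<Rightarrow>
    ('e \<Rightarrow> real \<Rightarrow> real) \<Rightarrow> 'e l2_op \<Rightarrow> bool" where
  "is_mag_schroedinger G A V T \<longleftrightarrow>
     self_adjoint G T \<and>
     (\<forall>(u, f)\<in>T. \<exists>u'\<in>H1A G A V. ae_eq G u u' \<and>
        (\<forall>v\<in>H1A G A V. mag_form G A V u' v = l2_inner G f v))"


section \<open>The two hypotheses and constrained critical points\<close>

definition hyp_G ::
  "('v, 'e) metric_graph \<Rightarrow> ('e \<Rightarrow> real \<Rightarrow> real) \<Rightarrow> ('e \<Rightarrow> real \<Rightarrow> real) \<Rightarrow> bool" where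
  "hyp_G G A V \<longleftrightarrow>
     (\<exists>\<phi>\<in>H1A G A V. \<not> zero_on G (edges G) \<phi> \<and>
        mag_normsq G A V \<phi> / l2_normsq G \<phi> = lambda1 G A V \<and>
        \<not> zero_on G (bounded_edges G) \<phi>)"

text \<open>There is exactly one \<open>T\<close> with \<open>is_mag_schroedinger G A V T\<close>, so the existential quantifier
  over \<open>T\<close> just names this operator. The sequence is indexed from 1.\<close>

definition hyp_Gm ::
  "('v, 'e) metric_graph \<Rightarrow> ('e \<Rightarrow> real \<Rightarrow> real) \<Rightarrow> ('e \<Rightarrow> real \<Rightarrow> real) \<Rightarrow> enat \<Rightarrow> bool" where
  "hyp_Gm G A V m \<longleftrightarrow>
     (\<exists>T. is_mag_schroedinger G A V T \<and>
        (\<exists>ev :: nat \<Rightarrow> real.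
           1 \<le> ev 1 \<and>
           (\<forall>i j. 1 \<le> i \<and> i < j \<and> enat j \<le> m \<longrightarrow> ev i < ev j) \<and>
           (\<forall>j. 1 \<le> j \<and> enat j \<le> m \<longrightarrow>
              eigenvalue G T (of_real (ev j)) \<and> ereal (ev j) < inf_ess G T)))"

definition mass_constraint :: "('v, 'e) metric_graph \<Rightarrow> ('e \<Rightarrow> real \<Rightarrow> real) \<Rightarrow>
    ('e \<Rightarrow> real \<Rightarrow> real) \<Rightarrow> real \<Rightarrow> ('e \<Rightarrow> real \<Rightarrow> complex) set" where
  "mass_constraint G A V \<mu> = {u \<in> H1A G A V. l2_normsq G u = \<mu>}"

text \<open>\<open>u\<close> is a critical point, constrained on \<open>mass_constraint G A V \<mu>\<close> and with Lagrange multiplier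
  \<open>lam\<close>, of the energy \<open>E(u) = \<parallel>u\<parallel>\<^sup>2 / 2 - (\<integral>\<^sub>K |u|\<^sup>p dx) / p\<close>, where \<open>\<parallel>u\<parallel>\<^sup>2\<close> is \<open>mag_normsq G A V u\<close>.\<close>

definition constrained_critical_point :: "('v, 'e) metric_graph \<Rightarrow> ('e \<Rightarrow> real \<Rightarrow> real) \<Rightarrow>
    ('e \<Rightarrow> real \<Rightarrow> real) \<Rightarrow> real \<Rightarrow> real \<Rightarrow> ('e \<Rightarrow> real \<Rightarrow> complex) \<Rightarrow> real \<Rightarrow> bool" where
  "constrained_critical_point G A V p \<mu> u lam \<longleftrightarrow>
     u \<in> mass_constraint G A V \<mu> \<and>
     (\<forall>v\<in>H1A G A V.
        Re (mag_form G A V u v)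
        - Re (graph_integral G (bounded_edges G)
            (\<lambda>e x. of_real (cmod (u e x) powr (p - 2)) * u e x * cnj (v e x)))
        = lam * Re (l2_inner G u v))"

end

theory Submission
  imports Defs "HOL-Complex_Analysis.Great_Picard" "HOL-Library.Function_Algebras"
begin

text \<open>
  The argument is variational. Write \<open>B\<close> for the magnetic energy form, \<open>b\<close> for the mass form,
  \<open>P(u) = \<integral>\<^sub>K |u|\<^sup>p\<close>, and fix \<open>\<kappa> < \<lambda>\<^sub>1\<close>, so that \<open>Q = B - \<kappa> b\<close> is comparable with \<open>B\<close>.

  Suppose first that \<open>\<lambda>\<^sub>1\<close> is attained by some \<open>\<phi>\<close> that does not vanish on the core. Since the embedding
  of the magnetic Sobolev space into the continuous functions on the core is compact, \<open>P\<close> attains its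
  maximum on \<open>Q \<le> 1\<close>. A multiple \<open>w\<close> of the maximiser is a ground state (\<open>ground_state\<close>): a critical
  point with multiplier \<open>\<kappa>\<close>, with \<open>Q(w) = P(w) = R\<close> and \<open>P(u) \<le> R (Q(u) / R)\<^bsup>p/2\<^esup>\<close> for all \<open>u\<close>. If
  its mass is less than \<open>\<mu>\<close>, it is the critical point of the second alternative, and if its mass is
  \<open>\<mu>\<close>, it is one of the first. If its mass is larger than \<open>\<mu>\<close>, consider
  \<open>F = (B - \<lambda>\<^sub>1 b) / 2 - P / p\<close> on the bounded closed convex set given by \<open>Q \<le> R\<close> and \<open>b \<le> \<mu>\<close>. The
  minimum of \<open>F\<close> is negative, because \<open>F(t \<phi>) = - t\<^sup>p P(\<phi>) / p\<close>. The minimum is also below all values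
  of \<open>F\<close> at points with \<open>Q = R\<close>, because \<open>w\<close> scaled down to mass \<open>\<mu>\<close> lies strictly below them. So the
  minimiser has \<open>Q < R\<close>, and being at a negative level it has mass exactly \<open>\<mu>\<close>, since otherwise a
  slightly larger multiple of it would lower \<open>F\<close> further (\<open>interior_minimiser\<close>). It is then a local
  minimiser at fixed mass, hence a critical point of mass \<open>\<mu>\<close>, and \<open>F < 0\<close> forces its multiplier to be
  below \<open>\<lambda>\<^sub>1\<close> (\<open>normalized_or_prescribed_multiplier\<close>).

  Suppose next that there is an eigenvalue below the essential spectrum. Then \<open>\<lambda>\<^sub>1\<close> is in the spectrum
  (\<open>lambda1_in_spectrum\<close>) and below the essential spectrum, so it is an eigenvalue. If an eigenfunction
  does not vanish on the core, the previous case applies. If it does vanish there, the nonlinear term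
  is zero at it, and its multiple of mass \<open>\<mu>\<close> is a critical point with multiplier \<open>\<lambda>\<^sub>1\<close>.

  The existence of minimisers needs no weak topology: almost minimal elements of the convex hulls of
  the tails of a bounded sequence form a Cauchy sequence, by the parallelogram identity
  (\<open>cauchy_convex_combinations\<close>). What remains is the analysis on the graph: weak derivatives satisfy
  the fundamental theorem of calculus (\<open>weak_deriv_FTC\<close>), which gives local bounds and equicontinuity
  (\<open>edge_increment\<close>), hence compactness on the core (\<open>core_compactness\<close>) and completeness
  (\<open>H_complete\<close>).
\<close>

section \<open>Quadratic forms and almost minimal convex combinations\<close>

text \<open>\<open>B\<close> and \<open>b\<close> stand for the real parts of the energy form and of the mass form.\<close>


locale form_space =
  fixes H :: "'a::real_vector set" and B b :: "'a \<Rightarrow> 'a \<Rightarrow> real"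
  assumes subspace_H: "subspace H"
    and B_sym: "\<And>u v. u \<in> H \<Longrightarrow> v \<in> H \<Longrightarrow> B u v = B v u"
    and B_lin: "\<And>u v w c. u \<in> H \<Longrightarrow> v \<in> H \<Longrightarrow> w \<in> H \<Longrightarrow> B (u + c *\<^sub>R v) w = B u w + c * B v w"
    and b_sym: "\<And>u v. u \<in> H \<Longrightarrow> v \<in> H \<Longrightarrow> b u v = b v u"
    and b_lin: "\<And>u v w c. u \<in> H \<Longrightarrow> v \<in> H \<Longrightarrow> w \<in> H \<Longrightarrow> b (u + c *\<^sub>R v) w = b u w + c * b v w"
    and b_nonneg: "\<And>u. u \<in> H \<Longrightarrow> 0 \<le> b u u"
    and b_le_B: "\<And>u. u \<in> H \<Longrightarrow> b u u \<le> B u u"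
begin

lemma H_zero [simp]: "0 \<in> H"
  and H_add [simp]: "u \<in> H \<Longrightarrow> v \<in> H \<Longrightarrow> u + v \<in> H"
  and H_diff [simp]: "u \<in> H \<Longrightarrow> v \<in> H \<Longrightarrow> u - v \<in> H"
  and H_scale [simp]: "u \<in> H \<Longrightarrow> c *\<^sub>R u \<in> H"
  using subspace_H by (auto simp: subspace_0 subspace_add subspace_diff subspace_scale)

lemma B_nonneg: "u \<in> H \<Longrightarrow> 0 \<le> B u u"
  using b_nonneg b_le_B by (meson order_trans)

text \<open>The combinations \<open>\<alpha> B + \<beta> b\<close> cover the energy, the mass and the shifted energies \<open>B - \<kappa> b\<close>, so that
  lower semicontinuity has to be shown only once.\<close>

definition form :: "real \<Rightarrow> real \<Rightarrow> 'a \<Rightarrow> 'a \<Rightarrow> real" where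
  "form \<alpha> \<beta> u v = \<alpha> * B u v + \<beta> * b u v"

lemma form_sym: "u \<in> H \<Longrightarrow> v \<in> H \<Longrightarrow> form \<alpha> \<beta> u v = form \<alpha> \<beta> v u"
  by (simp add: form_def B_sym b_sym)

lemma form_lin: "u \<in> H \<Longrightarrow> v \<in> H \<Longrightarrow> w \<in> H \<Longrightarrow>
    form \<alpha> \<beta> (u + c *\<^sub>R v) w = form \<alpha> \<beta> u w + c * form \<alpha> \<beta> v w"
  by (simp add: form_def B_lin b_lin algebra_simps)

lemma form_zero: "w \<in> H \<Longrightarrow> form \<alpha> \<beta> 0 w = 0"
  using form_lin[of 0 0 w \<alpha> \<beta> 1] by simp

lemma form_scale: "u \<in> H \<Longrightarrow> w \<in> H \<Longrightarrow> form \<alpha> \<beta> (c *\<^sub>R u) w = c * form \<alpha> \<beta> u w"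
  using form_lin[of 0 u w \<alpha> \<beta> c] by (simp add: form_zero)

lemma form_scale2: "u \<in> H \<Longrightarrow> form \<alpha> \<beta> (c *\<^sub>R u) (c *\<^sub>R u) = c\<^sup>2 * form \<alpha> \<beta> u u"
  by (metis H_scale form_scale form_sym mult.assoc power2_eq_square)

lemma form_expand:
  assumes "u \<in> H" "v \<in> H"
  shows "form \<alpha> \<beta> (u + t *\<^sub>R v) (u + t *\<^sub>R v)
    = form \<alpha> \<beta> u u + 2 * t * form \<alpha> \<beta> u v + t\<^sup>2 * form \<alpha> \<beta> v v"
proof -
  have "form \<alpha> \<beta> (u + t *\<^sub>R v) (u + t *\<^sub>R v)
      = form \<alpha> \<beta> u (u + t *\<^sub>R v) + t * form \<alpha> \<beta> v (u + t *\<^sub>R v)"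
    using assms by (intro form_lin) auto
  moreover have "form \<alpha> \<beta> u (u + t *\<^sub>R v) = form \<alpha> \<beta> u u + t * form \<alpha> \<beta> v u"
    using assms by (subst form_sym) (auto simp: form_lin)
  moreover have "form \<alpha> \<beta> v (u + t *\<^sub>R v) = form \<alpha> \<beta> u v + t * form \<alpha> \<beta> v v"
    using assms by (subst form_sym) (auto simp: form_lin)
  moreover have "form \<alpha> \<beta> v u = form \<alpha> \<beta> u v"
    using assms by (rule form_sym[rotated])
  ultimately show ?thesis by (simp add: algebra_simps power2_eq_square)
qed

lemma form_diff_sym: 
  assumes "u \<in> H" "v \<in> H"
  shows "form \<alpha> \<beta> (u - v) (u - v) = form \<alpha> \<beta> (v - u) (v - u)"
  using form_scale2[of "u - v" \<alpha> \<beta> "-1"] assms by simp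

lemma B_form: "B u v = form 1 0 u v" and b_form: "b u v = form 0 1 u v"
  by (simp_all add: form_def)

text \<open>Expanding \<open>s x + t y\<close> gives the convex combination of the values minus \<open>s t\<close> times the form
  at \<open>x - y\<close>.\<close>

lemma convex_sublevel:
  assumes nonneg: "\<And>h. h \<in> H \<Longrightarrow> 0 \<le> form \<alpha> \<beta> h h"
  shows "convex {h \<in> H. form \<alpha> \<beta> h h \<le> c}"
proof (rule convexI, goal_cases)
  case (1 x y s t)
  have xy: "x \<in> H" "y \<in> H" "form \<alpha> \<beta> x x \<le> c" "form \<alpha> \<beta> y y \<le> c" using 1 by auto
  have eq: "s *\<^sub>R x + t *\<^sub>R y = x + t *\<^sub>R (y - x)"
  proof -
    have s: "s = 1 - t" using \<open>s + t = 1\<close> by simp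
    show ?thesis unfolding s by (simp add: scaleR_left_diff_distrib scaleR_right_diff_distrib)
  qed
  have "form \<alpha> \<beta> (x + t *\<^sub>R (y - x)) (x + t *\<^sub>R (y - x))
      = form \<alpha> \<beta> x x + 2 * t * form \<alpha> \<beta> x (y - x) + t\<^sup>2 * form \<alpha> \<beta> (y - x) (y - x)"
    using xy by (intro form_expand) auto
  moreover have "form \<alpha> \<beta> y y
      = form \<alpha> \<beta> x x + 2 * form \<alpha> \<beta> x (y - x) + form \<alpha> \<beta> (y - x) (y - x)"
    using form_expand[of x "y - x" \<alpha> \<beta> 1] xy by simp
  ultimately have e: "form \<alpha> \<beta> (x + t *\<^sub>R (y - x)) (x + t *\<^sub>R (y - x))
      = s * form \<alpha> \<beta> x x + t * form \<alpha> \<beta> y y - s * t * form \<alpha> \<beta> (y - x) (y - x)"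
  proof -
    have s: "s = 1 - t" using \<open>s + t = 1\<close> by simp
    assume a: "form \<alpha> \<beta> (x + t *\<^sub>R (y - x)) (x + t *\<^sub>R (y - x))
      = form \<alpha> \<beta> x x + 2 * t * form \<alpha> \<beta> x (y - x) + t\<^sup>2 * form \<alpha> \<beta> (y - x) (y - x)"
      "form \<alpha> \<beta> y y
      = form \<alpha> \<beta> x x + 2 * form \<alpha> \<beta> x (y - x) + form \<alpha> \<beta> (y - x) (y - x)"
    show ?thesis unfolding s a by (simp add: algebra_simps power2_eq_square)
  qed
  have "0 \<le> s * t * form \<alpha> \<beta> (y - x) (y - x)" using 1 xy nonneg by simp
  moreover have "s * form \<alpha> \<beta> x x + t * form \<alpha> \<beta> y y \<le> s * c + t * c"
    using 1 xy by (intro add_mono mult_left_mono) auto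
  moreover have "s * c + t * c = c" using \<open>s + t = 1\<close> by (metis distrib_right mult_1)
  ultimately have "form \<alpha> \<beta> (x + t *\<^sub>R (y - x)) (x + t *\<^sub>R (y - x)) \<le> c" using e by linarith
  then show ?case using xy eq by auto
qed

text \<open>A nonnegative form \<open>q\<close> satisfies \<open>q (z + w) \<le> (1 + \<eta>) q z + (1 + 1 / \<eta>) q w\<close>; here \<open>w = v - z\<^sub>n\<close>
  tends to zero.\<close>

lemma sublevel_limit:
  assumes nonneg: "\<And>h. h \<in> H \<Longrightarrow> 0 \<le> form \<alpha> \<beta> h h"
    and z: "\<And>n. z n \<in> H" and v: "v \<in> H"
    and lim: "(\<lambda>n. B (z n - v) (z n - v)) \<longlonglongrightarrow> 0"
    and le: "eventually (\<lambda>n. form \<alpha> \<beta> (z n) (z n) \<le> c) sequentially"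
  shows "form \<alpha> \<beta> v v \<le> c"
proof (rule field_le_epsilon)
  fix e :: real assume e: "e > 0"
  have c0: "0 \<le> c"
    using eventually_happens[OF le] nonneg z by (meson order_trans sequentially_bot)
  define \<eta> where "\<eta> = e / (2 * (c + 1))"
  have \<eta>: "\<eta> > 0" using e c0 by (simp add: \<eta>_def)
  have "\<eta> * c \<le> e / 2" using e c0 by (simp add: \<eta>_def field_simps)
  define K where "K = (1 + 1 / \<eta>) * (\<bar>\<alpha>\<bar> + \<bar>\<beta>\<bar>)"
  have "(\<lambda>n. K * B (z n - v) (z n - v)) \<longlonglongrightarrow> K * 0"
    using lim by (intro tendsto_mult_left)
  then have "eventually (\<lambda>n. K * B (z n - v) (z n - v) < e / 2) sequentially"
    using e by (intro order_tendstoD) auto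
  then obtain n where n: "K * B (z n - v) (z n - v) < e / 2" "form \<alpha> \<beta> (z n) (z n) \<le> c"
    using eventually_happens[OF eventually_conj[OF _ le]] by fastforce
  define w where "w = v - z n"
  have w: "w \<in> H" "v = z n + 1 *\<^sub>R w" using v z by (auto simp: w_def)
  have "0 \<le> form \<alpha> \<beta> (z n + (- 1 / \<eta>) *\<^sub>R w) (z n + (- 1 / \<eta>) *\<^sub>R w)"
    using w z by (intro nonneg) auto
  then have "0 \<le> \<eta> * (form \<alpha> \<beta> (z n) (z n) + 2 * (- 1 / \<eta>) * form \<alpha> \<beta> (z n) w + (- 1 / \<eta>)\<^sup>2 * form \<alpha> \<beta> w w)"
    unfolding form_expand[OF z[of n] w(1), of \<alpha> \<beta> "- 1 / \<eta>"] using \<eta>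
    by (intro mult_nonneg_nonneg) auto
  then have am: "2 * form \<alpha> \<beta> (z n) w \<le> \<eta> * form \<alpha> \<beta> (z n) (z n) + form \<alpha> \<beta> w w / \<eta>"
    using \<eta> by (simp add: algebra_simps power2_eq_square)
  have "form \<alpha> \<beta> v v = form \<alpha> \<beta> (z n) (z n) + 2 * form \<alpha> \<beta> (z n) w + form \<alpha> \<beta> w w"
    using form_expand[OF z[of n] w(1), of \<alpha> \<beta> 1] w(2) by simp
  also have "\<dots> \<le> (1 + \<eta>) * form \<alpha> \<beta> (z n) (z n) + (1 + 1 / \<eta>) * form \<alpha> \<beta> w w"
    using am by (simp add: algebra_simps)
  also have "\<dots> \<le> (1 + \<eta>) * c + K * B w w"
  proof (intro add_mono mult_left_mono)
    have "\<alpha> * B w w \<le> \<bar>\<alpha>\<bar> * B w w" "\<beta> * b w w \<le> \<bar>\<beta>\<bar> * b w w" "\<bar>\<beta>\<bar> * b w w \<le> \<bar>\<beta>\<bar> * B w w"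
      using B_nonneg[OF w(1)] b_nonneg[OF w(1)] b_le_B[OF w(1)]
      by (auto intro: mult_right_mono mult_left_mono)
    then have "form \<alpha> \<beta> w w \<le> (\<bar>\<alpha>\<bar> + \<bar>\<beta>\<bar>) * B w w"
      by (simp add: form_def algebra_simps)
    then show "(1 + 1 / \<eta>) * form \<alpha> \<beta> w w \<le> K * B w w"
      unfolding K_def mult.assoc using \<eta> by (intro mult_left_mono) auto
  qed (use n \<eta> in auto)
  also have "B w w = B (z n - v) (z n - v)"
    using form_diff_sym[OF v z, of 1 0 n] by (simp add: w_def form_def)
  finally have "form \<alpha> \<beta> v v \<le> (1 + \<eta>) * c + K * B (z n - v) (z n - v)" .
  moreover have "(1 + \<eta>) * c = c + \<eta> * c" by (simp add: ring_distribs)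
  ultimately show "form \<alpha> \<beta> v v \<le> c + e" using n(1) \<open>\<eta> * c \<le> e / 2\<close> by linarith
qed

text \<open>Points of almost minimal norm in a decreasing sequence of convex sets form a Cauchy sequence,
  by the parallelogram identity. Applied to the convex hulls of the tails of a sequence, this plays
  the role of weak compactness followed by Mazur's lemma.\<close>

lemma cauchy_convex_combinations:
  assumes x: "\<And>n. x n \<in> H" and bd: "\<And>n. B (x n) (x n) \<le> K"
  obtains z where "\<And>n. z n \<in> convex hull (x ` {n..})"
    "\<And>n. B (z (Suc n) - z n) (z (Suc n) - z n) \<le> (1/4) ^ n"
proof -
  define T where "T n = convex hull (x ` {n..})" for n
  have TH: "T n \<subseteq> {h \<in> H. form 1 0 h h \<le> K}" for n
    unfolding T_def using x bd B_nonneg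
    by (intro hull_minimal convex_sublevel) (auto simp flip: B_form)
  have Tmono: "T m \<subseteq> T n" if "n \<le> m" for m n
    unfolding T_def using that by (intro hull_mono) auto
  have Tx: "x n \<in> T n" for n
    unfolding T_def by (rule hull_inc) auto
  define d where "d n = Inf ((\<lambda>h. B h h) ` T n)" for n
  have bdd: "bdd_below ((\<lambda>h. B h h) ` T n)" for n
    using TH B_nonneg by (intro bdd_belowI[of _ 0]) auto
  have dle: "d n \<le> B h h" if "h \<in> T n" for n h
    unfolding d_def using that bdd by (intro cInf_lower) auto
  have dmono: "d n \<le> d m" if "n \<le> m" for n m
    unfolding d_def using Tmono[OF that] Tx[of m] bdd by (intro cInf_superset_mono) auto
  have dK: "d n \<le> K" for n
    using dle[OF Tx] bd[of n] by (meson order_trans)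
  have "bdd_above (range d)" using dK by (intro bdd_aboveI[of _ K]) auto
  then have dlim: "d \<longlonglongrightarrow> (SUP n. d n)"
    by (intro LIMSEQ_incseq_SUP) (auto simp: incseq_def dmono)
  define D where "D = (SUP n. d n)"
  have dD: "d n \<le> D" for n
    unfolding D_def using \<open>bdd_above (range d)\<close> by (intro cSUP_upper) auto
  have "\<exists>y\<in>T n. B y y < d n + 1 / real (Suc n)" for n
  proof -
    have "(\<lambda>h. B h h) ` T n \<noteq> {}" using Tx by auto
    then have "\<exists>y\<in>(\<lambda>h. B h h) ` T n. y < d n + 1 / real (Suc n)"
      unfolding d_def by (intro cInf_lessD) auto
    then show ?thesis by auto
  qed
  then obtain y where y: "\<And>n. y n \<in> T n" "\<And>n. B (y n) (y n) < d n + 1 / real (Suc n)" by metis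
  have yH: "y n \<in> H" for n using y TH by blast
  \<comment> \<open>the midpoint of \<open>y n\<close> and \<open>y m\<close> lies in the larger hull, so its energy is at least \<open>d n\<close>\<close>
  define \<eta> where "\<eta> n = 2 * (D - d n) + 4 * (1 / real (Suc n))" for n
  have close: "B (y m - y n) (y m - y n) \<le> \<eta> n" if "n \<le> m" for m n
  proof -
    let ?M = "y n + (1/2) *\<^sub>R (y m - y n)"
    have eq: "?M = (1/2) *\<^sub>R y n + (1/2) *\<^sub>R y m"
      by (simp add: algebra_simps flip: scaleR_add_left)
    have "?M \<in> T n" unfolding eq
    proof (rule convexD)
      show "convex (T n)" unfolding T_def by (rule convex_convex_hull)
      show "y m \<in> T n" using y(1)[of m] Tmono[OF that] by blast
    qed (use y in auto)
    then have "d n \<le> form 1 0 ?M ?M" using dle B_form by metis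
    also have "\<dots> = form 1 0 (y n) (y n) + form 1 0 (y n) (y m - y n) + (1/4) * form 1 0 (y m - y n) (y m - y n)"
      using form_expand[of "y n" "y m - y n" 1 0 "1/2"] yH by (simp add: power2_eq_square)
    finally have 1: "d n \<le> form 1 0 (y n) (y n) + form 1 0 (y n) (y m - y n) + (1/4) * form 1 0 (y m - y n) (y m - y n)" .
    have 2: "form 1 0 (y m) (y m) = form 1 0 (y n) (y n) + 2 * form 1 0 (y n) (y m - y n) + form 1 0 (y m - y n) (y m - y n)"
      using form_expand[of "y n" "y m - y n" 1 0 1] yH by simp
    have 3: "form 1 0 (y n) (y n) < d n + 1 / real (Suc n)" "form 1 0 (y m) (y m) < d m + 1 / real (Suc m)"
      using y(2) by (simp_all flip: B_form)
    have 4: "1 / real (Suc m) \<le> 1 / real (Suc n)" using that by (simp add: frac_le)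
    have "form 1 0 (y m - y n) (y m - y n) \<le> \<eta> n"
    proof -
      have gen: "\<delta> \<le> 2 * (D' - dn) + 4 * en"
        if "dn \<le> a + c + 1/4 * \<delta>" "b = a + 2 * c + \<delta>" "a < dn + en" "b < dm + em" "em \<le> en" "dm \<le> D'"
        for \<delta> D' dn dm en em a b c :: real
        using that by (simp add: field_simps)
      show ?thesis unfolding \<eta>_def by (rule gen[OF 1 2 3 4 dD])
    qed
    then show ?thesis by (simp only: B_form)
  qed
  have "(\<lambda>n. 2 * (D - d n) + 4 * (1 / real (Suc n))) \<longlonglongrightarrow> 2 * (D - D) + 4 * 0"
    using dlim LIMSEQ_inverse_real_of_nat unfolding D_def[symmetric] inverse_eq_divide
    by (intro tendsto_intros)
  then have \<eta>0: "\<eta> \<longlonglongrightarrow> 0"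
    unfolding \<eta>_def[abs_def] by (simp only: diff_self mult_zero_right add_0_left)
  have "\<exists>f. \<forall>j\<ge>f. \<eta> j < (1/4) ^ n" for n :: nat
    using order_tendstoD(2)[OF \<eta>0, of "(1/4)^n"] by (simp add: eventually_sequentially)
  then obtain f where f: "\<And>n j. j \<ge> f n \<Longrightarrow> \<eta> j < (1/4) ^ n" by metis
  \<comment> \<open>the sum makes \<open>k\<close> monotone\<close>
  define k where "k n = n + (\<Sum>i\<le>n. f i)" for n
  have k: "k n \<ge> n" "k n \<ge> f n" "k n \<le> k (Suc n)" for n
    unfolding k_def using member_le_sum[of n "{..n}" f] by auto
  show thesis
  proof
    show "y (k n) \<in> convex hull (x ` {n..})" for n
      using y(1)[of "k n"] Tmono[OF k(1)[of n]] by (auto simp: T_def)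
    show "B (y (k (Suc n)) - y (k n)) (y (k (Suc n)) - y (k n)) \<le> (1/4) ^ n" for n
      using close[OF k(3)[of n]] f[OF k(2)[of n]] by linarith
  qed
qed

end

section \<open>Ground states and minimisers of prescribed mass\<close>

text \<open>On a metric graph, \<open>S\<close> is the supremum over the core, \<open>P\<close> the \<open>p\<close>-th power of the norm in \<open>L\<^sup>p\<close> of the
  core, and \<open>N\<close> the pairing with \<open>|u|\<^bsup>p-2\<^esup> u\<close>. Bounded sequences are compact only with respect to \<open>S\<close>:
  mass may escape along the half-lines.\<close>

locale variational_problem = form_space H B b
  for H :: "'a::real_vector set" and B b +
  fixes S P :: "'a \<Rightarrow> real" and N :: "'a \<Rightarrow> 'a \<Rightarrow> real" and p :: real
  assumes S_triangle: "\<And>u v. u \<in> H \<Longrightarrow> v \<in> H \<Longrightarrow> S (u + v) \<le> S u + S v"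
    and S_scale: "\<And>u c. u \<in> H \<Longrightarrow> S (c *\<^sub>R u) = \<bar>c\<bar> * S u"
    and S_bound: "\<exists>C. \<forall>u\<in>H. B u u \<le> 1 \<longrightarrow> S u \<le> C"
    and compact: "\<And>u K. (\<And>n. u n \<in> H) \<Longrightarrow> (\<And>n. B (u n) (u n) \<le> K) \<Longrightarrow>
      \<exists>r :: nat \<Rightarrow> nat. strict_mono r \<and> (\<forall>e>0. \<exists>M. \<forall>m\<ge>M. \<forall>n\<ge>M. S (u (r m) - u (r n)) \<le> e)"
    and complete: "\<And>u. (\<And>n. u n \<in> H) \<Longrightarrow> (\<And>n. B (u (Suc n) - u n) (u (Suc n) - u n) \<le> (1/4) ^ n) \<Longrightarrow>
      \<exists>v\<in>H. (\<lambda>n. B (u n - v) (u n - v)) \<longlonglongrightarrow> 0"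
    and P_cont: "\<And>u v. (\<And>n. u n \<in> H) \<Longrightarrow> v \<in> H \<Longrightarrow> (\<lambda>n. S (u n - v)) \<longlonglongrightarrow> 0 \<Longrightarrow>
      (\<lambda>n. P (u n)) \<longlonglongrightarrow> P v"
    and P_scale: "\<And>u c. u \<in> H \<Longrightarrow> P (c *\<^sub>R u) = \<bar>c\<bar> powr p * P u"
    and P_nonneg: "\<And>u. u \<in> H \<Longrightarrow> 0 \<le> P u"
    and P_null: "\<And>u. u \<in> H \<Longrightarrow> b u u = 0 \<Longrightarrow> P u = 0"
    and P_deriv: "\<And>u h. u \<in> H \<Longrightarrow> h \<in> H \<Longrightarrow>
      ((\<lambda>t. P (u + t *\<^sub>R h)) has_real_derivative p * N u h) (at 0)"
    and p_gt_2: "p > 2"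
begin

lemma S_nonneg:
  assumes "u \<in> H" shows "0 \<le> S u"
proof -
  have "S (u + (-1) *\<^sub>R u) \<le> S u + S ((-1) *\<^sub>R u)"
    using assms by (intro S_triangle H_scale)
  moreover have "S ((-1) *\<^sub>R u) = S u" using S_scale[OF assms, of "-1"] by simp
  moreover have "S (u + (-1) *\<^sub>R u) = 0" using S_scale[OF assms, of 0] by simp
  ultimately show ?thesis by linarith
qed

text \<open>By homogeneity. If the energy of \<open>u\<close> vanishes, the bound on the unit ball applies to all multiples.\<close>

lemma S_le_B:
  obtains C where "\<And>u. u \<in> H \<Longrightarrow> (S u)\<^sup>2 \<le> C * B u u"
proof -
  obtain C where C: "\<And>u. u \<in> H \<Longrightarrow> B u u \<le> 1 \<Longrightarrow> S u \<le> C" using S_bound by blast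
  have "(S u)\<^sup>2 \<le> C\<^sup>2 * B u u" if u: "u \<in> H" for u
  proof (cases "B u u = 0")
    case True
    have "S u = 0"
    proof (rule ccontr)
      assume "S u \<noteq> 0"
      then have Su: "S u > 0" using S_nonneg[OF u] by simp
      define t where "t = (\<bar>C\<bar> + 1) / S u"
      have "B (t *\<^sub>R u) (t *\<^sub>R u) \<le> 1"
        using form_scale2[OF u, of 1 0 t] True by (simp flip: B_form)
      then have "\<bar>t\<bar> * S u \<le> C" using C[of "t *\<^sub>R u"] S_scale[OF u] u by simp
      moreover have "\<bar>t\<bar> * S u = \<bar>C\<bar> + 1" using Su by (simp add: t_def)
      ultimately show False by linarith
    qed
    then show ?thesis using True by simp
  next
    case False
    then have pos: "B u u > 0" using B_nonneg[OF u] by simp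
    define t where "t = 1 / sqrt (B u u)"
    have "B (t *\<^sub>R u) (t *\<^sub>R u) = 1"
      using form_scale2[OF u, of 1 0 t] pos by (simp add: t_def power_divide flip: B_form)
    then have "\<bar>t\<bar> * S u \<le> C" using C[of "t *\<^sub>R u"] S_scale[OF u] u by simp
    then have "S u \<le> C * sqrt (B u u)" using pos by (simp add: t_def field_simps)
    then have "(S u)\<^sup>2 \<le> (C * sqrt (B u u))\<^sup>2" using S_nonneg[OF u] by (intro power_mono) auto
    then show ?thesis using pos by (simp add: power_mult_distrib)
  qed
  then show thesis using that by blast
qed

lemma convex_S_ball:
  assumes a: "a \<in> H" shows "convex {h \<in> H. S (h - a) \<le> e}"
proof (rule convexI, goal_cases)
  case (1 x y s t)
  then have xy: "x \<in> H" "y \<in> H" "S (x - a) \<le> e" "S (y - a) \<le> e" by auto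
  have s: "s = 1 - t" using \<open>s + t = 1\<close> by simp
  have "s *\<^sub>R x + t *\<^sub>R y - a = s *\<^sub>R (x - a) + t *\<^sub>R (y - a)"
    unfolding s by (simp add: scaleR_left_diff_distrib scaleR_right_diff_distrib)
  then have "S (s *\<^sub>R x + t *\<^sub>R y - a) \<le> s * S (x - a) + t * S (y - a)"
    using S_triangle[of "s *\<^sub>R (x - a)" "t *\<^sub>R (y - a)"] S_scale[of "x - a" s] S_scale[of "y - a" t] xy a 1
    by simp
  also have "\<dots> \<le> s * e + t * e" using 1 xy by (intro add_mono mult_left_mono) auto
  also have "\<dots> = e" unfolding s by (simp add: algebra_simps)
  finally show ?case using xy by auto
qed

text \<open>The limit is that of convex combinations \<open>z\<close> of the tails. Convex conditions that hold eventually
  along the sequence pass to \<open>z\<close> and to its limit. On the core the limits of the sequence and of \<open>z\<close>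
  agree, because balls of the seminorm \<open>S\<close> are convex.\<close>

lemma direct_method:
  assumes u: "\<And>n. u n \<in> H" and bd: "\<And>n. B (u n) (u n) \<le> K"
  obtains r :: "nat \<Rightarrow> nat" and v where "strict_mono r" "v \<in> H" "(\<lambda>n. P (u (r n))) \<longlonglongrightarrow> P v"
    "\<And>\<alpha> \<beta> c. (\<And>h. h \<in> H \<Longrightarrow> 0 \<le> form \<alpha> \<beta> h h) \<Longrightarrow>
       eventually (\<lambda>n. form \<alpha> \<beta> (u (r n)) (u (r n)) \<le> c) sequentially \<Longrightarrow> form \<alpha> \<beta> v v \<le> c"
proof -
  obtain r where r: "strict_mono (r :: nat \<Rightarrow> nat)"
    and cau: "\<And>e. e > 0 \<Longrightarrow> \<exists>M. \<forall>m\<ge>M. \<forall>n\<ge>M. S (u (r m) - u (r n)) \<le> e"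
    using compact[of u K] u bd by blast
  define x where "x n = u (r n)" for n
  have x: "x n \<in> H" "B (x n) (x n) \<le> K" for n using u bd by (auto simp: x_def)
  obtain z where z: "\<And>n. z n \<in> convex hull (x ` {n..})"
    and fast: "\<And>n. B (z (Suc n) - z n) (z (Suc n) - z n) \<le> (1/4) ^ n"
    using cauchy_convex_combinations[of x K] x by metis
  have zH: "z n \<in> H" for n
    using z[of n] hull_minimal[of "x ` {n..}" H convex] x(1) subspace_imp_convex[OF subspace_H] by auto
  obtain v where v: "v \<in> H" and lim: "(\<lambda>n. B (z n - v) (z n - v)) \<longlonglongrightarrow> 0"
    using complete[of z] zH fast by blast
  obtain C where C: "\<And>u. u \<in> H \<Longrightarrow> (S u)\<^sup>2 \<le> C * B u u" using S_le_B by blast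
  have "(\<lambda>n. C * B (z n - v) (z n - v)) \<longlonglongrightarrow> C * 0" using lim by (intro tendsto_mult_left)
  then have "(\<lambda>n. C * B (z n - v) (z n - v)) \<longlonglongrightarrow> 0" by (simp only: mult_zero_right)
  then have "(\<lambda>n. (S (z n - v))\<^sup>2) \<longlonglongrightarrow> 0"
    by (rule tendsto_sandwich[OF _ _ tendsto_const[of 0], rotated 2])
      (auto intro!: always_eventually C[OF H_diff[OF zH v]])
  then have "(\<lambda>n. sqrt ((S (z n - v))\<^sup>2)) \<longlonglongrightarrow> sqrt 0" by (intro tendsto_real_sqrt)
  then have Sz: "(\<lambda>n. S (z n - v)) \<longlonglongrightarrow> 0" using zH v S_nonneg by simp
  have "(\<lambda>n. S (z n - x n)) \<longlonglongrightarrow> 0"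
  proof (rule LIMSEQ_I)
    fix e :: real assume e: "e > 0"
    then obtain M where M: "\<And>m n. m \<ge> M \<Longrightarrow> n \<ge> M \<Longrightarrow> S (x m - x n) \<le> e / 2"
      using cau[of "e/2"] by (auto simp: x_def)
    have "norm (S (z n - x n) - 0) < e" if n: "n \<ge> M" for n
    proof -
      have "convex hull (x ` {n..}) \<subseteq> {h \<in> H. S (h - x n) \<le> e / 2}"
        using x(1) M n by (intro hull_minimal convex_S_ball) auto
      then have "S (z n - x n) \<le> e / 2" using z[of n] by auto
      then show ?thesis using e S_nonneg[of "z n - x n"] zH x(1) by simp
    qed
    then show "\<exists>no. \<forall>n\<ge>no. norm (S (z n - x n) - 0) < e" by blast
  qed
  from tendsto_add[OF this Sz] have sum0: "(\<lambda>n. S (z n - x n) + S (z n - v)) \<longlonglongrightarrow> 0" by simp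
  have tri: "S (x n - v) \<le> S (z n - x n) + S (z n - v)" for n
    using S_triangle[of "(-1) *\<^sub>R (z n - x n)" "z n - v"] S_scale[of "z n - x n" "-1"] zH x(1) v by simp
  have "(\<lambda>n. S (x n - v)) \<longlonglongrightarrow> 0"
    by (rule tendsto_sandwich[OF _ _ tendsto_const[of 0] sum0])
      (auto intro!: always_eventually tri S_nonneg simp: x(1) v)
  then have Plim: "(\<lambda>n. P (u (r n))) \<longlonglongrightarrow> P v"
    using P_cont[of x v] x(1) v by (simp add: x_def)
  show thesis
  proof (rule that[OF r v Plim])
    fix \<alpha> \<beta> c
    assume nn: "\<And>h. h \<in> H \<Longrightarrow> 0 \<le> form \<alpha> \<beta> h h"
      and ev: "eventually (\<lambda>n. form \<alpha> \<beta> (u (r n)) (u (r n)) \<le> c) sequentially"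
    from ev obtain M where M: "\<And>n. n \<ge> M \<Longrightarrow> form \<alpha> \<beta> (x n) (x n) \<le> c"
      by (auto simp: eventually_sequentially x_def)
    have "form \<alpha> \<beta> (z n) (z n) \<le> c" if "n \<ge> M" for n
    proof -
      have "convex hull (x ` {n..}) \<subseteq> {h \<in> H. form \<alpha> \<beta> h h \<le> c}"
        using x(1) M that nn by (intro hull_minimal convex_sublevel) auto
      then show ?thesis using z[of n] by auto
    qed
    then show "form \<alpha> \<beta> v v \<le> c"
      using nn zH v lim by (intro sublevel_limit[of \<alpha> \<beta> z]) (auto simp: eventually_sequentially)
  qed
qed

text \<open>Otherwise \<open>P\<close> would be unbounded along a sequence to which the direct method applies.\<close>

lemma P_bounded:
  obtains M where "\<And>u. u \<in> H \<Longrightarrow> B u u \<le> K \<Longrightarrow> P u \<le> M"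
proof -
  have "\<exists>M. \<forall>u\<in>H. B u u \<le> K \<longrightarrow> P u \<le> M"
  proof (rule ccontr)
    assume "\<not> ?thesis"
    then have "\<forall>n. \<exists>u\<in>H. B u u \<le> K \<and> P u > real n" by (metis linorder_not_le)
    then obtain u where u: "\<And>n. u n \<in> H" "\<And>n. B (u n) (u n) \<le> K" "\<And>n. P (u n) > real n" by metis
    obtain r v where r: "strict_mono r" and lim: "(\<lambda>n. P (u (r n))) \<longlonglongrightarrow> P v"
      using direct_method[of u K] u by metis
    have "eventually (\<lambda>n. P (u (r n)) < P v + 1) sequentially"
      using lim by (intro order_tendstoD) auto
    then obtain M where M: "\<And>n. n \<ge> M \<Longrightarrow> P (u (r n)) < P v + 1"
      by (auto simp: eventually_sequentially)
    define n where "n = max M (nat \<lceil>P v + 1\<rceil>)"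
    have "real n \<ge> P v + 1" unfolding n_def by linarith
    moreover have "real (r n) \<ge> real n" using strict_mono_imp_increasing[OF r, of n] by simp
    moreover have "P (u (r n)) < P v + 1" by (rule M) (simp add: n_def)
    ultimately show False using u(3)[of "r n"] by linarith
  qed
  then show thesis using that by blast
qed

end

context variational_problem
begin

text \<open>With \<open>s\<close> the maximum of \<open>P\<close> over \<open>Q \<le> 1\<close>, homogeneity gives \<open>P \<le> s Q\<^bsup>p/2\<^esup>\<close> with equality at all
  multiples of the maximiser, so \<open>s Q\<^bsup>p/2\<^esup> - P\<close> is minimal there and its derivative vanishes. The
  multiple is chosen such that the two terms of this derivative carry the same factor, which means
  \<open>s R\<^bsup>p/2-1\<^esup> = 1\<close>.\<close>

lemma ground_state:
  assumes coercive: "c > 0" "\<And>u. u \<in> H \<Longrightarrow> c * B u u \<le> form 1 (-\<kappa>) u u"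
    and \<phi>: "\<phi> \<in> H" "P \<phi> > 0"
  obtains R w where "R > 0" "w \<in> H" "form 1 (-\<kappa>) w w = R" "P w = R"
    "\<And>h. h \<in> H \<Longrightarrow> form 1 (-\<kappa>) w h = N w h"
    "\<And>u. u \<in> H \<Longrightarrow> P u \<le> R * (form 1 (-\<kappa>) u u / R) powr (p / 2)"
proof -
  define Q where "Q u v = form 1 (-\<kappa>) u v" for u v
  have Qc: "c * B u u \<le> Q u u" if "u \<in> H" for u using coercive(2)[OF that] by (simp add: Q_def)
  have Q0: "0 \<le> Q u u" if "u \<in> H" for u
    using Qc[OF that] B_nonneg[OF that] coercive(1) by (meson mult_nonneg_nonneg less_imp_le order_trans)
  have Qscale: "Q (t *\<^sub>R u) (t *\<^sub>R u) = t\<^sup>2 * Q u u" if "u \<in> H" for t u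
    unfolding Q_def using that by (rule form_scale2)
  have BQ: "B u u \<le> 1 / c" if "u \<in> H" "Q u u \<le> 1" for u
    using Qc[OF that(1)] that(2) coercive(1) by (simp add: field_simps)
  have Qnull: "P u = 0" if "u \<in> H" "Q u u = 0" for u
  proof -
    have "B u u \<le> 0" using Qc[OF that(1)] that(2) coercive(1) by (simp add: mult_le_0_iff)
    then have "b u u = 0" using b_le_B b_nonneg that(1) by (meson order_antisym order_trans)
    then show ?thesis using P_null that(1) by blast
  qed
  obtain M where M: "\<And>u. u \<in> H \<Longrightarrow> B u u \<le> 1 / c \<Longrightarrow> P u \<le> M" using P_bounded by blast
  define X where "X = P ` {u \<in> H. Q u u \<le> 1}"
  have bdd: "bdd_above X" unfolding X_def using M BQ by (intro bdd_aboveI[of _ M]) auto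
  define s where "s = Sup X"
  have sge: "P u \<le> s" if "u \<in> H" "Q u u \<le> 1" for u
    unfolding s_def using that bdd by (intro cSup_upper) (auto simp: X_def)
  have "X \<noteq> {}"
    using form_zero[of 0 1 "-\<kappa>"] unfolding X_def Q_def by (auto intro!: exI[of _ 0])
  have "\<exists>u\<in>H. Q u u \<le> 1 \<and> P u > s - 1 / real (Suc n)" for n
  proof -
    have "\<exists>y\<in>X. s - 1 / real (Suc n) < y"
      unfolding s_def using \<open>X \<noteq> {}\<close> bdd by (intro less_cSupD) auto
    then show ?thesis by (auto simp: X_def)
  qed
  then obtain u where u: "\<And>n. u n \<in> H" "\<And>n. Q (u n) (u n) \<le> 1" "\<And>n. P (u n) > s - 1 / real (Suc n)"
    by metis
  obtain r v where r: "strict_mono r" and v: "v \<in> H" and Plim: "(\<lambda>n. P (u (r n))) \<longlonglongrightarrow> P v"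
    and lsc: "\<And>\<alpha> \<beta> c. (\<And>h. h \<in> H \<Longrightarrow> 0 \<le> form \<alpha> \<beta> h h) \<Longrightarrow>
       eventually (\<lambda>n. form \<alpha> \<beta> (u (r n)) (u (r n)) \<le> c) sequentially \<Longrightarrow> form \<alpha> \<beta> v v \<le> c"
    by (rule direct_method[of u "1 / c"]) (use u BQ in blast)+
  have Qv: "Q v v \<le> 1" unfolding Q_def
    using Q0 u(2) unfolding Q_def by (intro lsc always_eventually) auto
  have "((\<lambda>n. P (u n)) \<circ> r) \<longlonglongrightarrow> s"
  proof (rule LIMSEQ_subseq_LIMSEQ[OF _ r])
    have "(\<lambda>n. s - 1 / real (Suc n)) \<longlonglongrightarrow> s - 0"
      using LIMSEQ_inverse_real_of_nat unfolding inverse_eq_divide by (intro tendsto_intros)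
    then have "(\<lambda>n. s - 1 / real (Suc n)) \<longlonglongrightarrow> s" by (simp only: diff_0_right)
    then show "(\<lambda>n. P (u n)) \<longlonglongrightarrow> s"
      by (rule tendsto_sandwich[OF _ _ _ tendsto_const[of s], rotated 2])
        (use u sge in \<open>auto intro!: always_eventually less_imp_le\<close>)
  qed
  then have Pv: "P v = s" using Plim LIMSEQ_unique by (auto simp: o_def)
  have Q\<phi>: "Q \<phi> \<phi> > 0" using Q0[OF \<phi>(1)] Qnull[OF \<phi>(1)] \<phi>(2) by (cases "Q \<phi> \<phi> = 0") auto
  have bound: "P u \<le> s * Q u u powr (p / 2)" if u: "u \<in> H" for u
  proof (cases "Q u u = 0")
    case True
    then show ?thesis using Qnull[OF u] by simp
  next
    case False
    then have pos: "Q u u > 0" using Q0[OF u] by simp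
    define t where "t = 1 / sqrt (Q u u)"
    have "P (t *\<^sub>R u) \<le> s"
      using u pos by (intro sge) (auto simp: Qscale t_def power_divide)
    then have "t powr p * P u \<le> s" using P_scale[OF u, of t] pos by (simp add: t_def)
    moreover have "t powr p = 1 / Q u u powr (p / 2)"
      using pos by (simp add: t_def powr_divide powr_half_sqrt[symmetric] powr_powr)
    ultimately show ?thesis using pos by (simp add: field_simps)
  qed
  have s: "s > 0" using bound[OF \<phi>(1)] \<phi>(2) Q\<phi> by (smt (verit) mult_nonpos_nonneg powr_ge_zero)
  have Qv1: "Q v v = 1"
  proof (rule ccontr)
    assume "Q v v \<noteq> 1"
    then have "Q v v < 1" using Qv by simp
    then have "Q v v powr (p / 2) < 1 powr (p / 2)" using Q0[OF v] p_gt_2 by (intro powr_less_mono2) auto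
    then have "s * Q v v powr (p / 2) < s * 1" using s by simp
    then show False using bound[OF v] Pv by simp
  qed
  define R where "R = s powr (- 2 / (p - 2))"
  have R: "R > 0" using s by (simp add: R_def)
  have sR: "s * R powr (p / 2) = R"
  proof -
    have "s * R powr (p / 2) = s powr 1 * s powr (- 2 / (p - 2) * (p / 2))"
      using s by (simp add: R_def powr_powr)
    also have "\<dots> = s powr (1 + (- 2 / (p - 2) * (p / 2)))" by (simp only: powr_add)
    also have "1 + (- 2 / (p - 2) * (p / 2)) = - 2 / (p - 2)" using p_gt_2 by (simp add: field_simps)
    finally show ?thesis by (simp add: R_def)
  qed
  define w where "w = sqrt R *\<^sub>R v"
  have w: "w \<in> H" using v by (simp add: w_def)
  have Qw: "Q w w = R" using v R Qv1 by (simp add: w_def Qscale)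
  have "P w = sqrt R powr p * s" using v R Pv by (simp add: w_def P_scale)
  also have "sqrt R powr p = R powr (p / 2)" using R by (simp add: powr_half_sqrt[symmetric] powr_powr)
  finally have Pw: "P w = R" using sR by (simp add: mult.commute)
  have EL: "Q w h = N w h" if h: "h \<in> H" for h
  proof -
    define f where "f t = s * Q (w + t *\<^sub>R h) (w + t *\<^sub>R h) powr (p / 2) - P (w + t *\<^sub>R h)" for t
    have Qt: "Q (w + t *\<^sub>R h) (w + t *\<^sub>R h) = Q w w + 2 * t * Q w h + t\<^sup>2 * Q h h" for t
      unfolding Q_def using w h by (rule form_expand)
    have "((\<lambda>t. Q w w + 2 * t * Q w h + t\<^sup>2 * Q h h) has_real_derivative 2 * Q w h) (at 0)"
      by (auto intro!: derivative_eq_intros)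
    then have "((\<lambda>t. (Q w w + 2 * t * Q w h + t\<^sup>2 * Q h h) powr (p / 2)) has_real_derivative
        p / 2 * R powr (p / 2 - 1) * (2 * Q w h)) (at 0)"
      using R Qw by (auto intro!: derivative_eq_intros)
    then have "(f has_real_derivative s * (p / 2 * R powr (p / 2 - 1) * (2 * Q w h)) - p * N w h) (at 0)"
      unfolding f_def[abs_def] Qt using P_deriv[OF w h] by (intro DERIV_diff DERIV_cmult)
    moreover have "f 0 \<le> f t" for t
      using bound[of "w + t *\<^sub>R h"] w h sR Qw Pw by (simp add: f_def)
    ultimately have "s * (p / 2 * R powr (p / 2 - 1) * (2 * Q w h)) - p * N w h = 0"
      by (intro DERIV_local_min[of f _ 0 1]) auto
    moreover have "s * R powr (p / 2 - 1) = 1"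
    proof -
      have "R powr (p / 2 - 1 + 1) = R powr (p / 2 - 1) * R powr 1" by (rule powr_add)
      then have "R * (s * R powr (p / 2 - 1)) = R * 1" using sR R by (simp add: mult_ac)
      then show ?thesis using R by (metis less_irrefl mult_cancel_left)
    qed
    then have "s * (p / 2 * R powr (p / 2 - 1) * (2 * Q w h)) = p * Q w h"
      by (metis (no_types, opaque_lifting) mult.assoc mult.commute mult_1 nonzero_mult_div_cancel_left
          times_divide_eq_left zero_neq_numeral)
    ultimately show ?thesis using p_gt_2 by simp
  qed
  have "P u \<le> R * (Q u u / R) powr (p / 2)" if "u \<in> H" for u
  proof -
    have "R * (Q u u / R) powr (p / 2) = R * Q u u powr (p / 2) / R powr (p / 2)"
      using R Q0[OF that] by (simp add: powr_divide)
    also have "R / R powr (p / 2) = s" using sR R by (simp add: field_simps)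
    then have "R * Q u u powr (p / 2) / R powr (p / 2) = s * Q u u powr (p / 2)" 
      by (metis times_divide_eq_left)
    finally show ?thesis using bound[OF that] by simp
  qed
  then show thesis using that[OF R w] Qw Pw EL by (simp add: Q_def)
qed

text \<open>Minimises \<open>F = (B - \<Lambda> b) / 2 - P / p\<close> over \<open>Q \<le> R\<close>, \<open>b \<le> \<mu>\<close>, where \<open>Q = B - \<kappa> b\<close>. For \<open>Q = R\<close> the bound on
  \<open>P\<close> gives \<open>F \<ge> (1/2 - 1/p) R - (\<Lambda> - \<kappa>) \<mu> / 2\<close>. The minimum is smaller than this, so it is not
  attained on that part of the boundary, and it is negative, so it is attained at mass \<open>\<mu>\<close>.\<close>

lemma interior_minimiser:
  assumes coercive: "c > 0" "\<And>u. u \<in> H \<Longrightarrow> c * B u u \<le> form 1 (-\<kappa>) u u"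
    and \<Lambda>: "\<And>u. u \<in> H \<Longrightarrow> 0 \<le> form 1 (-\<Lambda>) u u" and \<kappa>: "\<kappa> < \<Lambda>"
    and \<phi>: "\<phi> \<in> H" "form 1 (-\<Lambda>) \<phi> \<phi> = 0" "P \<phi> > 0"
    and R: "R > 0" and w: "w \<in> H" "form 1 (-\<kappa>) w w = R" "P w = R"
    and bound: "\<And>u. u \<in> H \<Longrightarrow> P u \<le> R * (form 1 (-\<kappa>) u u / R) powr (p / 2)"
    and \<mu>: "0 < \<mu>" "\<mu> < b w w"
  obtains v where "v \<in> H" "b v v = \<mu>" "form 1 (-\<kappa>) v v < R"
    "form 1 (-\<Lambda>) v v / 2 - P v / p < 0"
    "\<And>u. u \<in> H \<Longrightarrow> b u u \<le> \<mu> \<Longrightarrow> form 1 (-\<kappa>) u u \<le> R \<Longrightarrow>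
       form 1 (-\<Lambda>) v v / 2 - P v / p \<le> form 1 (-\<Lambda>) u u / 2 - P u / p"
proof -
  define Q where "Q u = form 1 (-\<kappa>) u u" for u
  define Q1 where "Q1 u = form 1 (-\<Lambda>) u u" for u
  define F where "F u = Q1 u / 2 - P u / p" for u
  have Q_Q1: "Q u = Q1 u + (\<Lambda> - \<kappa>) * b u u" for u
    by (simp add: Q_def Q1_def form_def algebra_simps)
  have Qc: "c * B u u \<le> Q u" if "u \<in> H" for u using coercive(2)[OF that] by (simp add: Q_def)
  have Q0: "0 \<le> Q u" if "u \<in> H" for u
    using Qc[OF that] B_nonneg[OF that] coercive(1) by (meson mult_nonneg_nonneg less_imp_le order_trans)
  have scale: "Q (t *\<^sub>R u) = t\<^sup>2 * Q u" "Q1 (t *\<^sub>R u) = t\<^sup>2 * Q1 u" "b (t *\<^sub>R u) (t *\<^sub>R u) = t\<^sup>2 * b u u"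
    if "u \<in> H" for t u
    unfolding Q_def Q1_def using form_scale2[OF that, of 0 1 t]
    by (simp_all only: form_scale2[OF that] b_form)
  have BQ: "B u u \<le> R / c" if "u \<in> H" "Q u \<le> R" for u
    using Qc[OF that(1)] that(2) coercive(1) by (simp add: field_simps)
  have F_scale: "F (t *\<^sub>R u) \<le> t\<^sup>2 * F u" if u: "u \<in> H" and t: "t \<ge> 1" for t u
  proof -
    have "t powr 2 \<le> t powr p" using t p_gt_2 by (intro powr_mono) auto
    then have "t\<^sup>2 \<le> t powr p" using t by simp
    then have "t\<^sup>2 * P u / p \<le> t powr p * P u / p"
      using P_nonneg[OF u] p_gt_2 by (intro divide_right_mono mult_right_mono) auto
    moreover have "F (t *\<^sub>R u) = t\<^sup>2 * Q1 u / 2 - t powr p * P u / p"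
      using t u by (simp add: F_def scale P_scale)
    moreover have "t\<^sup>2 * F u = t\<^sup>2 * Q1 u / 2 - t\<^sup>2 * P u / p"
      by (simp add: F_def right_diff_distrib)
    ultimately show ?thesis by linarith
  qed
  define D where "D = {u \<in> H. b u u \<le> \<mu> \<and> Q u \<le> R}"
  obtain M where M: "\<And>u. u \<in> H \<Longrightarrow> B u u \<le> R / c \<Longrightarrow> P u \<le> M" using P_bounded by blast
  have Flow: "- M / p \<le> F u" if "u \<in> D" for u
  proof -
    have "P u / p \<le> M / p" using M BQ that p_gt_2 unfolding D_def by (intro divide_right_mono) auto
    then show ?thesis using \<Lambda>[of u] that unfolding D_def F_def Q1_def by simp
  qed
  have bdd: "bdd_below (F ` D)" using Flow by (intro bdd_belowI[of _ "- M / p"]) auto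
  define m where "m = Inf (F ` D)"
  have mle: "m \<le> F u" if "u \<in> D" for u
    unfolding m_def using that bdd by (intro cInf_lower) auto
  \<comment> \<open>small multiples of \<open>\<phi>\<close> have negative energy\<close>
  have m_neg: "m < 0"
  proof -
    define a where "a = b \<phi> \<phi> + Q \<phi> + 1"
    have a: "a > 0" using b_nonneg[OF \<phi>(1)] Q0[OF \<phi>(1)] by (simp add: a_def)
    define t where "t = sqrt (min \<mu> R / a)"
    have t: "t > 0" "t\<^sup>2 = min \<mu> R / a" using a \<mu> R by (auto simp: t_def)
    have "t\<^sup>2 * b \<phi> \<phi> \<le> t\<^sup>2 * a" "t\<^sup>2 * Q \<phi> \<le> t\<^sup>2 * a"
      using b_nonneg[OF \<phi>(1)] Q0[OF \<phi>(1)] by (intro mult_left_mono; simp add: a_def)+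
    moreover have "t\<^sup>2 * a = min \<mu> R" using t a by simp
    ultimately have "t *\<^sub>R \<phi> \<in> D" using \<phi>(1) by (simp add: D_def scale)
    then have "m \<le> F (t *\<^sub>R \<phi>)" by (rule mle)
    also have "F (t *\<^sub>R \<phi>) = - (t powr p * P \<phi> / p)"
      using \<phi>(1) \<phi>(2)[folded Q1_def] t by (simp add: F_def scale P_scale)
    also have "\<dots> < 0" using t \<phi> p_gt_2 by simp
    finally show ?thesis .
  qed
  \<comment> \<open>the ground state, scaled down to mass \<open>\<mu>\<close>, has energy below that of the boundary \<open>Q = R\<close>\<close>
  have m_lt: "m < (1/2 - 1/p) * R - (\<Lambda> - \<kappa>) * \<mu> / 2"
  proof -
    define t where "t = sqrt (\<mu> / b w w)"
    have t: "0 < t" "t < 1" "t\<^sup>2 = \<mu> / b w w" using \<mu> by (auto simp: t_def)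
    have t2: "t\<^sup>2 < 1" using t \<mu> by simp
    have bt: "b (t *\<^sub>R w) (t *\<^sub>R w) = \<mu>" using w \<mu> t by (simp add: scale)
    have Qt: "Q (t *\<^sub>R w) = t\<^sup>2 * R" using w by (simp add: scale) (simp add: Q_def)
    have "t *\<^sub>R w \<in> D" using w bt Qt R t2 by (simp add: D_def)
    then have "m \<le> F (t *\<^sub>R w)" by (rule mle)
    also have "F (t *\<^sub>R w) = (t\<^sup>2 * R - (\<Lambda> - \<kappa>) * \<mu>) / 2 - t powr p * R / p"
      using Q_Q1[of "t *\<^sub>R w"] Qt bt w t by (simp add: F_def P_scale)
    also have "\<dots> = (t\<^sup>2 / 2 - t powr p / p) * R - (\<Lambda> - \<kappa>) * \<mu> / 2"
      by (simp add: left_diff_distrib diff_divide_distrib)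
    finally have le: "m \<le> (t\<^sup>2 / 2 - t powr p / p) * R - (\<Lambda> - \<kappa>) * \<mu> / 2" .
    \<comment> \<open>\<open>x\<^sup>2 / 2 - x\<^sup>p / p\<close> is increasing on \<open>[0, 1]\<close> since \<open>p > 2\<close>\<close>
    have "t\<^sup>2 / 2 - t powr p / p < 1/2 - 1/p"
    proof -
      define g where "g x = x\<^sup>2 / 2 - x powr p / p" for x :: real
      have "g t < g 1"
      proof (rule DERIV_pos_imp_increasing_open[OF t(2)])
        fix x assume x: "t < x" "x < 1"
        then have x0: "x > 0" using t by simp
        have "(g has_real_derivative x - x powr (p - 1)) (at x)"
          unfolding g_def using x0 p_gt_2 by (auto intro!: derivative_eq_intros)
        moreover have "x powr (p - 1) < x powr 1"
          using x x0 p_gt_2 by (intro powr_less_mono') auto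
        ultimately show "\<exists>y. (g has_real_derivative y) (at x) \<and> 0 < y"
          using x0 by (intro exI[of _ "x - x powr (p - 1)"] conjI) auto
      next
        show "continuous_on {t..1} g" unfolding g_def using t p_gt_2 by (intro continuous_intros) auto
      qed
      then show ?thesis by (simp add: g_def)
    qed
    then have "(t\<^sup>2 / 2 - t powr p / p) * R < (1/2 - 1/p) * R" using R by simp
    then show ?thesis using le by linarith
  qed
  have "0 \<in> D" using \<mu> R form_zero[of 0] by (simp add: D_def b_form Q_def)
  have "\<exists>u\<in>D. F u < m + 1 / real (Suc n)" for n
  proof -
    have "\<exists>y\<in>F ` D. y < m + 1 / real (Suc n)"
      unfolding m_def using \<open>0 \<in> D\<close> by (intro cInf_lessD) auto
    then show ?thesis by auto
  qed
  then obtain u where u: "\<And>n. u n \<in> D" "\<And>n. F (u n) < m + 1 / real (Suc n)" by metis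
  have uH: "\<And>n. u n \<in> H" and uB: "\<And>n. B (u n) (u n) \<le> R / c" using u(1) BQ by (auto simp: D_def)
  obtain r v where r: "strict_mono r" and v: "v \<in> H" and Plim: "(\<lambda>n. P (u (r n))) \<longlonglongrightarrow> P v"
    and lsc: "\<And>\<alpha> \<beta> c. (\<And>h. h \<in> H \<Longrightarrow> 0 \<le> form \<alpha> \<beta> h h) \<Longrightarrow>
       eventually (\<lambda>n. form \<alpha> \<beta> (u (r n)) (u (r n)) \<le> c) sequentially \<Longrightarrow> form \<alpha> \<beta> v v \<le> c"
    by (rule direct_method[of u "R / c"]) (use uH uB in blast)+
  have "Q v \<le> R" unfolding Q_def
    using Q0 u(1) unfolding Q_def D_def by (intro lsc always_eventually) auto
  moreover have "form 0 1 v v \<le> \<mu>"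
    by (rule lsc) (use b_nonneg u(1) in \<open>auto simp: form_def D_def\<close>)
  then have "b v v \<le> \<mu>" by (simp add: form_def)
  ultimately have vD: "v \<in> D" using v by (simp add: D_def)
  have Fm: "F v = m"
  proof (rule antisym[OF field_le_epsilon mle[OF vD]])
    fix e :: real assume e: "e > 0"
    have "(\<lambda>n. m + 1 / real (Suc n)) \<longlonglongrightarrow> m + 0"
      using LIMSEQ_inverse_real_of_nat unfolding inverse_eq_divide by (intro tendsto_intros)
    then have "((\<lambda>n. m + 1 / real (Suc n)) \<circ> r) \<longlonglongrightarrow> m + 0" using r by (rule LIMSEQ_subseq_LIMSEQ)
    then have "(\<lambda>n. 2 * ((m + 1 / real (Suc (r n))) + P (u (r n)) / p)) \<longlonglongrightarrow> 2 * ((m + 0) + P v / p)"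
      using p_gt_2 unfolding o_def
      by (intro tendsto_mult[OF tendsto_const] tendsto_add[of "\<lambda>n. m + 1 / real (Suc (r n))"]
          tendsto_divide[OF Plim tendsto_const]) auto
    then have "eventually (\<lambda>n. 2 * ((m + 1 / real (Suc (r n))) + P (u (r n)) / p) < 2 * (m + P v / p) + 2 * e) sequentially"
      using e by (intro order_tendstoD(2)) auto
    then have "eventually (\<lambda>n. Q1 (u (r n)) \<le> 2 * (m + P v / p) + 2 * e) sequentially"
    proof eventually_elim
      case (elim n)
      have "Q1 (u (r n)) \<le> 2 * ((m + 1 / real (Suc (r n))) + P (u (r n)) / p)"
        using u(2)[of "r n"] unfolding F_def by argo
      then show ?case using elim by linarith
    qed
    then have "Q1 v \<le> 2 * (m + P v / p) + 2 * e" unfolding Q1_def using \<Lambda> by (intro lsc)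
    then show "F v \<le> m + e" unfolding F_def by argo
  qed
  have Qlt: "Q v < R"
  proof (rule ccontr)
    assume "\<not> Q v < R"
    then have QR: "Q v = R" using vD by (simp add: D_def)
    have "P v \<le> R" using bound[OF v] QR R by (simp add: Q_def)
    then have "P v / p \<le> R / p" using p_gt_2 by (intro divide_right_mono) auto
    moreover have "(\<Lambda> - \<kappa>) * b v v \<le> (\<Lambda> - \<kappa>) * \<mu>" using vD \<kappa> by (intro mult_left_mono) (auto simp: D_def)
    moreover have "Q1 v = R - (\<Lambda> - \<kappa>) * b v v" using Q_Q1[of v] QR by simp
    ultimately have "(R - (\<Lambda> - \<kappa>) * \<mu>) / 2 - R / p \<le> F v" unfolding F_def by argo
    moreover have "(R - (\<Lambda> - \<kappa>) * \<mu>) / 2 - R / p = (1/2 - 1/p) * R - (\<Lambda> - \<kappa>) * \<mu> / 2"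
      by (simp add: left_diff_distrib diff_divide_distrib)
    ultimately show False using m_lt Fm by linarith
  qed
  \<comment> \<open>a slightly larger multiple of \<open>v\<close> would be admissible and lower the negative value \<open>m\<close>\<close>
  have mass: "b v v = \<mu>"
  proof (rule ccontr)
    assume "b v v \<noteq> \<mu>"
    then have lt: "b v v < \<mu>" using vD by (simp add: D_def)
    have "((\<lambda>t. t\<^sup>2 * b v v) \<longlongrightarrow> 1\<^sup>2 * b v v) (at_right 1)" "((\<lambda>t. t\<^sup>2 * Q v) \<longlongrightarrow> 1\<^sup>2 * Q v) (at_right (1::real))"
      by (intro tendsto_intros)+
    then have "eventually (\<lambda>t. t\<^sup>2 * b v v < \<mu>) (at_right 1)" "eventually (\<lambda>t. t\<^sup>2 * Q v < R) (at_right (1::real))"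
      using lt Qlt by (auto intro: order_tendstoD(2))
    moreover have "eventually (\<lambda>t. t > 1) (at_right (1::real))" by (simp add: eventually_at_right_less)
    ultimately have "eventually (\<lambda>t. t\<^sup>2 * b v v < \<mu> \<and> t\<^sup>2 * Q v < R \<and> t > 1) (at_right (1::real))"
      by eventually_elim auto
    then obtain t :: real where t: "t\<^sup>2 * b v v < \<mu>" "t\<^sup>2 * Q v < R" "t > 1"
      using eventually_happens[of _ "at_right (1::real)"] by (auto simp: trivial_limit_at_right_real)
    have "t *\<^sub>R v \<in> D" using t v by (simp add: D_def scale)
    then have "m \<le> F (t *\<^sub>R v)" by (rule mle)
    also have "\<dots> \<le> t\<^sup>2 * m" using F_scale[OF v, of t] t Fm by simp
    finally have "1 * m \<le> t\<^sup>2 * m" by simp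
    moreover have "t\<^sup>2 > 1" using t(3) by (simp add: one_less_power)
    ultimately show False using m_neg by (metis mult_less_cancel_right linorder_not_le)
  qed
  show thesis
  proof (rule that[OF v mass])
    show "form 1 (-\<kappa>) v v < R" using Qlt by (simp add: Q_def)
    show "form 1 (-\<Lambda>) v v / 2 - P v / p < 0" using m_neg Fm by (simp add: F_def Q1_def)
    show "form 1 (-\<Lambda>) v v / 2 - P v / p \<le> form 1 (-\<Lambda>) u u / 2 - P u / p"
      if "u \<in> H" "b u u \<le> \<mu>" "form 1 (-\<kappa>) u u \<le> R" for u
      using mle[of u] that Fm by (simp add: F_def Q1_def Q_def D_def)
  qed
qed

text \<open>Varying \<open>v\<close> along the curves \<open>\<surd>(\<mu> / b (v + t h)) (v + t h)\<close>, which stay on the mass constraint.\<close>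

lemma interior_minimiser_critical:
  assumes v: "v \<in> H" "b v v = \<mu>" "form 1 (-\<kappa>) v v < R" and \<mu>: "\<mu> > 0"
    and min: "\<And>u. u \<in> H \<Longrightarrow> b u u \<le> \<mu> \<Longrightarrow> form 1 (-\<kappa>) u u \<le> R \<Longrightarrow>
       form 1 (-\<Lambda>) v v / 2 - P v / p \<le> form 1 (-\<Lambda>) u u / 2 - P u / p"
    and h: "h \<in> H"
  shows "form 1 (-\<Lambda>) v h - N v h = (form 1 (-\<Lambda>) v v - P v) / \<mu> * b v h"
proof -
  define bt where "bt t = b v v + 2 * t * b v h + t\<^sup>2 * b h h" for t
  define Qt where "Qt t = form 1 (-\<kappa>) v v + 2 * t * form 1 (-\<kappa>) v h + t\<^sup>2 * form 1 (-\<kappa>) h h" for t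
  define Q1t where "Q1t t = form 1 (-\<Lambda>) v v + 2 * t * form 1 (-\<Lambda>) v h + t\<^sup>2 * form 1 (-\<Lambda>) h h" for t
  have ex: "b (v + t *\<^sub>R h) (v + t *\<^sub>R h) = bt t" "form 1 (-\<kappa>) (v + t *\<^sub>R h) (v + t *\<^sub>R h) = Qt t"
    "form 1 (-\<Lambda>) (v + t *\<^sub>R h) (v + t *\<^sub>R h) = Q1t t" for t
    unfolding bt_def Qt_def Q1t_def by (simp_all only: form_expand[OF v(1) h] b_form)
  define g where "g t = (\<mu> / bt t) * Q1t t / 2 - (\<mu> / bt t) powr (p / 2) * P (v + t *\<^sub>R h) / p" for t
  have at0: "bt 0 = \<mu>" "Q1t 0 = form 1 (-\<Lambda>) v v" "Qt 0 = form 1 (-\<kappa>) v v"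
    by (simp_all add: bt_def Q1t_def Qt_def v)
  have dbt: "(bt has_real_derivative 2 * b v h) (at 0)"
    unfolding bt_def[abs_def] by (auto intro!: derivative_eq_intros)
  have dQ1: "(Q1t has_real_derivative 2 * form 1 (-\<Lambda>) v h) (at 0)"
    unfolding Q1t_def[abs_def] by (auto intro!: derivative_eq_intros)
  have dr: "((\<lambda>t. \<mu> / bt t) has_real_derivative - 2 * b v h / \<mu>) (at 0)"
    using dbt \<mu> at0 by (auto intro!: derivative_eq_intros simp: power2_eq_square)
  have drp: "((\<lambda>t. (\<mu> / bt t) powr (p / 2)) has_real_derivative - p * b v h / \<mu>) (at 0)"
    using DERIV_fun_powr[OF dr, of "p / 2"] \<mu> at0(1) by simp
  have dg: "(g has_real_derivative
      ((- 2 * b v h / \<mu>) * Q1t 0 + 2 * form 1 (-\<Lambda>) v h * (\<mu> / bt 0)) / 2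
      - ((- p * b v h / \<mu>) * P (v + 0 *\<^sub>R h) + p * N v h * (\<mu> / bt 0) powr (p / 2)) / p) (at 0)"
    unfolding g_def[abs_def]
    by (intro DERIV_diff DERIV_cdivide DERIV_mult dr drp dQ1 P_deriv v(1) h)
  have "(bt \<longlongrightarrow> bt 0) (at 0)" "(Qt \<longlongrightarrow> Qt 0) (at 0)"
    unfolding bt_def[abs_def] Qt_def[abs_def] by (intro tendsto_eq_intros refl | simp)+
  moreover from this(1) have "((\<lambda>t. \<mu> / bt t * Qt t) \<longlongrightarrow> \<mu> / bt 0 * Qt 0) (at 0)"
    using \<mu> at0 \<open>(Qt \<longlongrightarrow> Qt 0) (at 0)\<close> by (intro tendsto_intros) auto
  ultimately have "eventually (\<lambda>t. bt t > 0) (at 0)" "eventually (\<lambda>t. \<mu> / bt t * Qt t < R) (at 0)"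
    using \<mu> at0 v(3) by (auto intro: order_tendstoD)
  then have "eventually (\<lambda>t. g 0 \<le> g t) (at 0)"
  proof eventually_elim
    case (elim t)
    define s where "s = sqrt (\<mu> / bt t)"
    have s: "s > 0" "s\<^sup>2 = \<mu> / bt t" using elim \<mu> by (auto simp: s_def)
    define u where "u = s *\<^sub>R (v + t *\<^sub>R h)"
    have uH: "v + t *\<^sub>R h \<in> H" "u \<in> H" using v h by (auto simp: u_def)
    have e: "form \<alpha> \<beta> u u = s\<^sup>2 * form \<alpha> \<beta> (v + t *\<^sub>R h) (v + t *\<^sub>R h)" for \<alpha> \<beta>
      unfolding u_def by (rule form_scale2[OF uH(1)])
    have bu: "b u u = \<mu>" using e[of 0 1] ex(1)[of t] s(2) elim by (simp add: b_form[symmetric])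
    have Qu: "form 1 (-\<kappa>) u u = \<mu> / bt t * Qt t" using e[of 1 "-\<kappa>"] by (simp only: ex s)
    have Q1u: "form 1 (-\<Lambda>) u u = \<mu> / bt t * Q1t t" using e[of 1 "-\<Lambda>"] by (simp only: ex s)
    have "P u = s powr p * P (v + t *\<^sub>R h)" using P_scale[OF uH(1), of s] s(1) by (simp add: u_def)
    also have "s powr p = (\<mu> / bt t) powr (p / 2)"
      using elim \<mu> by (simp add: s_def powr_half_sqrt[symmetric] powr_powr)
    finally have Pu: "P u = (\<mu> / bt t) powr (p / 2) * P (v + t *\<^sub>R h)" .
    have "form 1 (-\<Lambda>) v v / 2 - P v / p \<le> form 1 (-\<Lambda>) u u / 2 - P u / p"
      using elim bu Qu by (intro min uH(2)) auto
    moreover have "g 0 = form 1 (-\<Lambda>) v v / 2 - P v / p" using at0 \<mu> by (simp add: g_def)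
    moreover have "g t = form 1 (-\<Lambda>) u u / 2 - P u / p" unfolding Q1u Pu g_def ..
    ultimately show ?case by simp
  qed
  then obtain d where d: "d > 0" "\<And>t. t \<noteq> 0 \<Longrightarrow> dist t 0 < d \<Longrightarrow> g 0 \<le> g t"
    unfolding eventually_at by auto
  have "\<forall>t. \<bar>0 - t\<bar> < d \<longrightarrow> g 0 \<le> g t" using d(2) by (metis abs_minus_commute dist_real_def order_refl)
  then have "((- 2 * b v h / \<mu>) * Q1t 0 + 2 * form 1 (-\<Lambda>) v h * (\<mu> / bt 0)) / 2
      - ((- p * b v h / \<mu>) * P (v + 0 *\<^sub>R h) + p * N v h * (\<mu> / bt 0) powr (p / 2)) / p = 0"
    by (rule DERIV_local_min[OF dg d(1)])
  moreover have "\<mu> / \<mu> = 1" using \<mu> by simp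
  ultimately have "((- 2 * b v h / \<mu>) * form 1 (-\<Lambda>) v v + 2 * form 1 (-\<Lambda>) v h) / 2
      - ((- p * b v h / \<mu>) * P v + p * N v h) / p = 0"
    by (simp only: at0 scaleR_zero_left add_0_right powr_one_eq_one mult_1_right)
  moreover have "((- 2 * b v h / \<mu>) * form 1 (-\<Lambda>) v v + 2 * form 1 (-\<Lambda>) v h) / 2
      = - (b v h / \<mu>) * form 1 (-\<Lambda>) v v + form 1 (-\<Lambda>) v h"
    by simp
  moreover have "((- p * b v h / \<mu>) * P v + p * N v h) / p = - (b v h / \<mu>) * P v + N v h"
    using p_gt_2 by (simp add: add_divide_distrib diff_divide_distrib)
  ultimately show ?thesis by (simp add: diff_divide_distrib algebra_simps)
qed

text \<open>The ground state for \<open>\<kappa>\<close> settles the cases in which its mass is at most \<open>\<mu>\<close>, and the interior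
  minimiser the remaining one. The multiplier of the latter is \<open>\<Lambda> + (B v v - \<Lambda> b v v - P v) / \<mu>\<close>, and the
  numerator is negative because \<open>F v < 0\<close> and \<open>p > 2\<close>.\<close>

theorem normalized_or_prescribed_multiplier:
  assumes \<Lambda>: "\<And>u. u \<in> H \<Longrightarrow> \<Lambda> * b u u \<le> B u u" "\<Lambda> > 0" and \<kappa>: "\<kappa> < \<Lambda>"
    and \<phi>: "\<phi> \<in> H" "B \<phi> \<phi> = \<Lambda> * b \<phi> \<phi>" "P \<phi> > 0" and \<mu>: "\<mu> > 0"
  shows "(\<exists>u\<in>H. b u u = \<mu> \<and> (\<exists>lam<\<Lambda>. \<forall>h\<in>H. B u h - N u h = lam * b u h)) \<or>
    (\<exists>u\<in>H. 0 < b u u \<and> b u u < \<mu> \<and> (\<forall>h\<in>H. B u h - N u h = \<kappa> * b u h))"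
proof -
  \<comment> \<open>for \<open>\<kappa> > 0\<close> the mass is estimated by \<open>b \<le> B / \<Lambda>\<close>\<close>
  define c where "c = min 1 (1 - \<kappa> / \<Lambda>)"
  have c: "c > 0" using \<kappa> \<Lambda>(2) by (simp add: c_def)
  have coercive: "c * B u u \<le> form 1 (-\<kappa>) u u" if u: "u \<in> H" for u
  proof (cases "\<kappa> \<le> 0")
    case True
    have "c * B u u \<le> 1 * B u u" using B_nonneg[OF u] by (intro mult_right_mono) (auto simp: c_def)
    moreover have "\<kappa> * b u u \<le> 0" using True b_nonneg[OF u] by (simp add: mult_nonpos_nonneg)
    ultimately show ?thesis by (simp add: form_def)
  next
    case False
    have "c * B u u \<le> (1 - \<kappa> / \<Lambda>) * B u u" using B_nonneg[OF u] by (intro mult_right_mono) (auto simp: c_def)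
    moreover have "\<kappa> / \<Lambda> * (\<Lambda> * b u u) \<le> \<kappa> / \<Lambda> * B u u"
      using False \<Lambda> u by (intro mult_left_mono) auto
    ultimately show ?thesis using \<Lambda>(2) by (simp add: form_def algebra_simps)
  qed
  have \<Lambda>0: "0 \<le> form 1 (-\<Lambda>) u u" if "u \<in> H" for u using \<Lambda>(1)[OF that] by (simp add: form_def)
  have \<phi>0: "form 1 (-\<Lambda>) \<phi> \<phi> = 0" using \<phi>(2) by (simp add: form_def)
  obtain R w where R: "R > 0" and w: "w \<in> H" "form 1 (-\<kappa>) w w = R" "P w = R"
    and EL: "\<And>h. h \<in> H \<Longrightarrow> form 1 (-\<kappa>) w h = N w h"
    and bound: "\<And>u. u \<in> H \<Longrightarrow> P u \<le> R * (form 1 (-\<kappa>) u u / R) powr (p / 2)"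
    using ground_state[OF c coercive \<phi>(1,3)] by blast
  have EL': "B w h - N w h = \<kappa> * b w h" if "h \<in> H" for h
    using EL[OF that] by (simp add: form_def)
  have bw: "b w w > 0" using b_nonneg[OF w(1)] P_null[OF w(1)] R w(3) by (cases "b w w = 0") auto
  consider "b w w < \<mu>" | "b w w = \<mu>" | "b w w > \<mu>" by linarith
  then show ?thesis
  proof cases
    case 1
    then show ?thesis using w EL' bw by blast
  next
    case 2
    then show ?thesis using w EL' \<kappa> by blast
  next
    case 3
    obtain v where v: "v \<in> H" "b v v = \<mu>" "form 1 (-\<kappa>) v v < R"
      and neg: "form 1 (-\<Lambda>) v v / 2 - P v / p < 0"
      and min: "\<And>u. u \<in> H \<Longrightarrow> b u u \<le> \<mu> \<Longrightarrow> form 1 (-\<kappa>) u u \<le> R \<Longrightarrow>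
       form 1 (-\<Lambda>) v v / 2 - P v / p \<le> form 1 (-\<Lambda>) u u / 2 - P u / p"
      using interior_minimiser[OF c coercive \<Lambda>0 \<kappa> \<phi>(1) \<phi>0 \<phi>(3) R w bound \<mu> 3] by blast
    define lam where "lam = \<Lambda> + (form 1 (-\<Lambda>) v v - P v) / \<mu>"
    have "B v h - N v h = lam * b v h" if h: "h \<in> H" for h
      using interior_minimiser_critical[OF v \<mu> min h] by (simp add: lam_def form_def algebra_simps)
    moreover have "form 1 (-\<Lambda>) v v - P v < 0"
    proof -
      have "P v / p \<le> P v / 2" using P_nonneg[OF v(1)] p_gt_2 by (intro divide_left_mono) auto
      then show ?thesis using neg by linarith
    qed
    then have "lam < \<Lambda>" using \<mu> by (simp add: lam_def divide_neg_pos)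
    ultimately show ?thesis using v by blast
  qed
qed

end

section \<open>Smooth test functions\<close>

definition smooth :: "(real \<Rightarrow> real) \<Rightarrow> bool" where
  "smooth f \<longleftrightarrow> (\<forall>n x. ((deriv ^^ n) f) differentiable (at x))"

lemma smooth_iff: "smooth f \<longleftrightarrow> (\<forall>x. f differentiable (at x)) \<and> smooth (deriv f)"
proof
  assume f: "smooth f"
  then have "((deriv ^^ 0) f) differentiable (at x)" for x unfolding smooth_def by blast
  moreover have "smooth (deriv f)" unfolding smooth_def
  proof (intro allI)
    fix n x
    have "((deriv ^^ Suc n) f) differentiable (at x)" using f unfolding smooth_def by blast
    then show "((deriv ^^ n) (deriv f)) differentiable (at x)" by (simp only: funpow_Suc_right o_def)
  qed
  ultimately show "(\<forall>x. f differentiable (at x)) \<and> smooth (deriv f)" by simp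
next
  assume f: "(\<forall>x. f differentiable (at x)) \<and> smooth (deriv f)"
  show "smooth f" unfolding smooth_def
  proof (intro allI)
    fix n x show "((deriv ^^ n) f) differentiable (at x)"
    proof (cases n)
      case (Suc m)
      have "((deriv ^^ m) (deriv f)) differentiable (at x)" using f unfolding smooth_def by blast
      then show ?thesis unfolding Suc by (simp only: funpow_Suc_right o_def)
    qed (use f in simp)
  qed
qed

text \<open>To prove smoothness it suffices to exhibit a class of differentiable functions that contains its
  derivatives. Below, this replaces formulas for higher derivatives.\<close>

lemma smooth_coinduct:
  assumes "f \<in> X" and step: "\<And>g. g \<in> X \<Longrightarrow> (\<forall>x. g differentiable (at x)) \<and> deriv g \<in> X"
  shows "smooth f"
proof -
  have "(deriv ^^ n) f \<in> X" for n by (induction n) (use assms in auto)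
  then show ?thesis unfolding smooth_def using step by blast
qed

lemma deriv_eqI: "(\<And>x. (f has_real_derivative f' x) (at x)) \<Longrightarrow> deriv f = f'"
  using DERIV_imp_deriv by blast

lemma real_differentiable_deriv:
  "f differentiable (at x) \<Longrightarrow> (f has_real_derivative deriv f x) (at x)" for f :: "real \<Rightarrow> real"
  by (metis DERIV_imp_deriv real_differentiable_def)

lemma smooth_deriv: "smooth f \<Longrightarrow> smooth (deriv f)"
  using smooth_iff by blast

lemma smooth_has_deriv: "smooth f \<Longrightarrow> (f has_real_derivative deriv f x) (at x)"
  using smooth_iff real_differentiable_deriv by blast

text \<open>The derivative of a product is a sum of products, so it is the class of all such sums that
  contains its derivatives.\<close>

inductive_set smooth_product_sums :: "(real \<Rightarrow> real) set" where
  prod: "smooth f \<Longrightarrow> smooth g \<Longrightarrow> (\<lambda>x. f x * g x) \<in> smooth_product_sums"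
| sum: "f \<in> smooth_product_sums \<Longrightarrow> g \<in> smooth_product_sums \<Longrightarrow> (\<lambda>x. f x + g x) \<in> smooth_product_sums"

lemma smooth_mult: assumes "smooth f" "smooth g" shows "smooth (\<lambda>x. f x * g x)"
proof (rule smooth_coinduct[of _ smooth_product_sums])
  show "(\<lambda>x. f x * g x) \<in> smooth_product_sums" using assms by (rule smooth_product_sums.prod)
  fix h assume "h \<in> smooth_product_sums"
  then have "\<exists>h'\<in>smooth_product_sums. \<forall>x. (h has_real_derivative h' x) (at x)"
  proof induction
    case (prod f g)
    have "((\<lambda>x. f x * g x) has_real_derivative deriv f x * g x + f x * deriv g x) (at x)" for x
      using prod by (auto intro!: derivative_eq_intros smooth_has_deriv)
    moreover have "(\<lambda>x. deriv f x * g x + f x * deriv g x) \<in> smooth_product_sums"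
      using prod by (intro smooth_product_sums.intros smooth_deriv)
    ultimately show ?case by (intro bexI[of _ "\<lambda>x. deriv f x * g x + f x * deriv g x"]) auto
  next
    case (sum f g)
    then obtain f' g' where *: "f' \<in> smooth_product_sums" "g' \<in> smooth_product_sums"
      "\<And>x. (f has_real_derivative f' x) (at x)" "\<And>x. (g has_real_derivative g' x) (at x)" by blast
    then show ?case
      by (intro bexI[of _ "\<lambda>x. f' x + g' x"]) (auto intro!: derivative_eq_intros smooth_product_sums.intros)
  qed
  then obtain h' where h': "h' \<in> smooth_product_sums" "\<And>x. (h has_real_derivative h' x) (at x)" by blast
  then show "(\<forall>x. h differentiable (at x)) \<and> deriv h \<in> smooth_product_sums"
    using deriv_eqI[of h h'] real_differentiable_def by blast
qed

lemma smooth_affine_comp: assumes "smooth f" shows "smooth (\<lambda>x. c * f (a * x + d))"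
proof (rule smooth_coinduct[of _ "{h. \<exists>g c. smooth g \<and> h = (\<lambda>x. c * g (a * x + d))}"])
  fix h assume "h \<in> {h. \<exists>g c. smooth g \<and> h = (\<lambda>x. c * g (a * x + d))}"
  then obtain g c where g: "smooth g" "h = (\<lambda>x. c * g (a * x + d))" by blast
  have "((\<lambda>x. g (a * x + d)) has_real_derivative deriv g (a * x + d) * a) (at x)" for x
    by (rule DERIV_chain2[OF smooth_has_deriv[OF g(1)]]) (auto intro!: derivative_eq_intros)
  then have D: "(h has_real_derivative (c * a) * deriv g (a * x + d)) (at x)" for x
    unfolding g(2) using DERIV_cmult by (fastforce simp: mult_ac)
  have "deriv h = (\<lambda>x. (c * a) * deriv g (a * x + d))" using D by (rule deriv_eqI)
  then show "(\<forall>x. h differentiable (at x)) \<and> deriv h \<in> {h. \<exists>g c. smooth g \<and> h = (\<lambda>x. c * g (a * x + d))}"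
    using D real_differentiable_def smooth_deriv[OF g(1)] by blast
qed (use assms in blast)

lemma smooth_diff: assumes "smooth f" "smooth g" shows "smooth (\<lambda>x. f x - g x)"
proof (rule smooth_coinduct[of _ "{h. \<exists>f g. smooth f \<and> smooth g \<and> h = (\<lambda>x. f x - g x)}"])
  fix h assume "h \<in> {h. \<exists>f g. smooth f \<and> smooth g \<and> h = (\<lambda>x. f x - g x)}"
  then obtain f g where fg: "smooth f" "smooth g" "h = (\<lambda>x. f x - g x)" by blast
  have D: "(h has_real_derivative deriv f x - deriv g x) (at x)" for x
    unfolding fg(3) by (intro DERIV_diff smooth_has_deriv fg)
  have "deriv h = (\<lambda>x. deriv f x - deriv g x)" using D by (rule deriv_eqI)
  then show "(\<forall>x. h differentiable (at x)) \<and> deriv h \<in> {h. \<exists>f g. smooth f \<and> smooth g \<and> h = (\<lambda>x. f x - g x)}"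
    using D real_differentiable_def smooth_deriv[OF fg(1)] smooth_deriv[OF fg(2)] by blast
qed (use assms in blast)

text \<open>All derivatives of \<open>exp (- 1 / x)\<close> have the form \<open>q (1 / x) exp (- 1 / x)\<close> with a polynomial \<open>q\<close>.\<close>

definition flat :: "real poly \<Rightarrow> real \<Rightarrow> real" where
  "flat q x = (if x \<le> 0 then 0 else poly q (1 / x) * exp (- (1 / x)))"

lemma poly_exp_tendsto_0: "((\<lambda>s. poly q s * exp (- s)) \<longlongrightarrow> 0) at_top" for q :: "real poly"
proof -
  have "((\<lambda>s::real. s ^ k / exp s) \<longlongrightarrow> 0) at_top" for k :: nat
    by (rule tendsto_power_div_exp_0)
  then have "((\<lambda>s. \<Sum>i\<le>degree q. coeff q i * (s ^ i / exp s)) \<longlongrightarrow> (\<Sum>i\<le>degree q. coeff q i * 0)) at_top"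
    by (intro tendsto_sum tendsto_mult_left)
  then show ?thesis
    by (simp add: poly_altdef exp_minus sum_distrib_right sum_divide_distrib divide_simps)
qed

lemma flat_deriv: "(flat q has_real_derivative flat ([:0, 0, 1:] * (q - pderiv q)) x) (at x)"
proof -
  consider "x > 0" | "x < 0" | "x = 0" by linarith
  then show ?thesis
  proof cases
    case 1
    have "((\<lambda>x. poly q (1 / x) * exp (- (1 / x))) has_real_derivative
        poly (pderiv q) (1 / x) * (- 1 / x\<^sup>2) * exp (- (1 / x)) + poly q (1 / x) * (exp (- (1 / x)) * (1 / x\<^sup>2))) (at x)"
      using 1 by (auto intro!: derivative_eq_intros simp: power2_eq_square)
    moreover have "\<forall>\<^sub>F y in nhds x. flat q y = poly q (1 / y) * exp (- (1 / y))"
      using eventually_nhds_in_open[of "{0<..}" x] 1 by (auto simp: flat_def elim!: eventually_mono)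
    ultimately have "(flat q has_real_derivative
        poly (pderiv q) (1 / x) * (- 1 / x\<^sup>2) * exp (- (1 / x)) + poly q (1 / x) * (exp (- (1 / x)) * (1 / x\<^sup>2))) (at x)"
      by (subst DERIV_cong_ev[OF refl _ refl])
    then show ?thesis using 1 by (simp add: flat_def algebra_simps power2_eq_square)
  next
    case 2
    have "\<forall>\<^sub>F y in nhds x. flat q y = 0"
      using eventually_nhds_in_open[of "{..<0}" x] 2 by (auto simp: flat_def elim!: eventually_mono)
    then have "(flat q has_real_derivative 0) (at x)"
      using DERIV_cong_ev[OF refl, of "flat q" "\<lambda>_. 0"] by auto
    then show ?thesis using 2 by (simp add: flat_def)
  next
    case 3
    have "((\<lambda>y. flat q y / y) \<longlongrightarrow> 0) (at_right 0)"
    proof -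
      have "((\<lambda>s. poly (pCons 0 q) s * exp (- s)) \<longlongrightarrow> 0) at_top" by (rule poly_exp_tendsto_0)
      then have "((\<lambda>y. poly (pCons 0 q) (1 / y) * exp (- (1 / y))) \<longlongrightarrow> 0) (at_right (0::real))"
        by (rule filterlim_compose) (use filterlim_inverse_at_top_right in \<open>simp add: inverse_eq_divide\<close>)
      moreover have "\<forall>\<^sub>F y in at_right (0::real). poly (pCons 0 q) (1 / y) * exp (- (1 / y)) = flat q y / y"
        using eventually_at_right_less[of "0::real"] by eventually_elim (simp add: flat_def)
      ultimately show ?thesis by (rule Lim_transform_eventually)
    qed
    moreover have "((\<lambda>y. flat q y / y) \<longlongrightarrow> 0) (at_left 0)"
    proof (rule Lim_transform_eventually[OF tendsto_const])
      show "\<forall>\<^sub>F y in at_left (0::real). 0 = flat q y / y"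
        unfolding eventually_at_filter by (simp add: flat_def)
    qed
    ultimately have "((\<lambda>y. flat q y / y) \<longlongrightarrow> 0) (at 0)" by (simp add: filterlim_split_at)
    then have "(flat q has_real_derivative 0) (at 0)" by (simp add: DERIV_def flat_def)
    then show ?thesis using 3 by (simp add: flat_def)
  qed
qed

lemma smooth_flat: "smooth (flat q)"
proof (rule smooth_coinduct[of _ "range flat"])
  fix g assume "g \<in> range flat"
  then obtain q where q: "g = flat q" by blast
  have "deriv g = flat ([:0, 0, 1:] * (q - pderiv q))" unfolding q using flat_deriv by (rule deriv_eqI)
  then show "(\<forall>x. g differentiable (at x)) \<and> deriv g \<in> range flat"
    unfolding q using flat_deriv real_differentiable_def by blast
qed simp

text \<open>A normalised primitive of the bump function \<open>exp (- 1 / x) exp (- 1 / (1 - x))\<close>.\<close>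

lemma smooth_step_exists:
  obtains \<sigma> :: "real \<Rightarrow> real" where "smooth \<sigma>" "\<And>x. x \<le> 0 \<Longrightarrow> \<sigma> x = 0" "\<And>x. x \<ge> 1 \<Longrightarrow> \<sigma> x = 1"
    "\<And>x. deriv \<sigma> x \<ge> 0" "\<And>x. x \<notin> {0..1} \<Longrightarrow> deriv \<sigma> x = 0" "continuous_on UNIV (deriv \<sigma>)"
proof -
  define \<rho> where "\<rho> x = flat 1 x * flat 1 (1 - x)" for x
  have sm: "smooth \<rho>"
    unfolding \<rho>_def[abs_def] using smooth_affine_comp[OF smooth_flat, of 1 1 "-1" 1]
    by (intro smooth_mult smooth_flat) simp
  have cont: "continuous_on S \<rho>" for S
    using DERIV_isCont[OF smooth_has_deriv[OF sm]] by (intro continuous_at_imp_continuous_on) auto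
  have nonneg: "\<rho> x \<ge> 0" for x by (simp add: \<rho>_def flat_def)
  have out: "\<rho> x = 0" if "x \<notin> {0<..<1}" for x using that by (auto simp: \<rho>_def flat_def)
  have pos: "\<rho> (1/2) > 0" by (simp add: \<rho>_def flat_def)
  define I where "I = integral {0..1} \<rho>"
  have I: "I > 0"
  proof -
    have "I \<ge> 0" unfolding I_def using nonneg by (intro integral_nonneg integrable_continuous_real cont) auto
    moreover have "I \<noteq> 0"
      unfolding I_def using integral_eq_0_iff[OF cont[of "{0..1}"]] nonneg pos by force
    ultimately show ?thesis by simp
  qed
  define \<sigma> where "\<sigma> x = integral {-1..x} \<rho> / I" for x
  have D: "(\<sigma> has_real_derivative \<rho> x / I) (at x)" for x
  proof (cases "x > -1")
    case True
    have "((\<lambda>u. integral {-1..u} \<rho>) has_real_derivative \<rho> x) (at x within {-1..x+1})"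
      using True by (intro integral_has_real_derivative cont) auto
    moreover have "at x within {-1..x+1} = at x" using True by (intro at_within_interior) auto
    ultimately have "((\<lambda>u. integral {-1..u} \<rho>) has_real_derivative \<rho> x) (at x)" by simp
    then show ?thesis unfolding \<sigma>_def[abs_def] by (rule DERIV_cdivide)
  next
    case False
    have "\<forall>\<^sub>F y in nhds x. \<sigma> y = 0"
    proof -
      have "\<sigma> y = 0" if "y < 0" for y
      proof -
        have "integral {-1..y} \<rho> = integral {-1..y} (\<lambda>_. 0)"
          using that by (intro Henstock_Kurzweil_Integration.integral_cong out) auto
        then show ?thesis by (simp add: \<sigma>_def)
      qed
      then show ?thesis using eventually_nhds_in_open[of "{..<0}" x] False by (auto elim!: eventually_mono)
    qed
    then have "(\<sigma> has_real_derivative 0) (at x)"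
      using DERIV_cong_ev[OF refl, of \<sigma> "\<lambda>_. 0"] by auto
    then show ?thesis using out[of x] False by simp
  qed
  then have dS: "deriv \<sigma> = (\<lambda>x. \<rho> x / I)" by (rule deriv_eqI)
  show thesis
  proof
    show "smooth \<sigma>" unfolding smooth_iff[of \<sigma>] dS
      using D real_differentiable_def smooth_affine_comp[OF sm, of "1 / I" 1 0] by (auto simp: field_simps)
    show "\<sigma> x = 0" if "x \<le> 0" for x
    proof -
      have "integral {-1..x} \<rho> = integral {-1..x} (\<lambda>_. 0)" using that by (intro Henstock_Kurzweil_Integration.integral_cong out) auto
      then show ?thesis by (simp add: \<sigma>_def)
    qed
    show "\<sigma> x = 1" if "x \<ge> 1" for x
    proof -
      have int: "\<rho> integrable_on {a..b}" for a b by (intro integrable_continuous_real cont)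
      have z: "integral T \<rho> = 0" if "\<And>x. x \<in> T \<Longrightarrow> x \<notin> {0<..<1}" for T
        using Henstock_Kurzweil_Integration.integral_cong[of T \<rho> "\<lambda>_. 0"] out that by simp
      have "integral {-1..0} \<rho> + integral {0..1} \<rho> = integral {-1..1} \<rho>"
        by (intro Henstock_Kurzweil_Integration.integral_combine int) auto
      moreover have "integral {-1..1} \<rho> + integral {1..x} \<rho> = integral {-1..x} \<rho>"
        using that by (intro Henstock_Kurzweil_Integration.integral_combine int) auto
      moreover have "integral {-1..0} \<rho> = 0" by (rule z) auto
      moreover have "integral {1..x} \<rho> = 0" by (rule z) auto
      ultimately show ?thesis using I by (simp add: \<sigma>_def I_def)
    qed
    show "deriv \<sigma> x \<ge> 0" for x using nonneg I by (simp add: dS)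
    show "deriv \<sigma> x = 0" if "x \<notin> {0..1}" for x using out[of x] that by (auto simp: dS)
    show "continuous_on UNIV (deriv \<sigma>)" unfolding dS using I by (intro continuous_intros cont) auto
  qed
qed

section \<open>Continuous functions with a weak derivative\<close>

text \<open>The derivative of \<open>x \<mapsto> \<sigma> ((x - c) / h)\<close> is a probability density on \<open>[c, c + h]\<close>.\<close>

lemma smooth_step_derivative_concentrates:
  fixes u :: "real \<Rightarrow> complex"
  assumes \<sigma>: "smooth \<sigma>" "\<And>x. x \<le> 0 \<Longrightarrow> \<sigma> x = 0" "\<And>x. x \<ge> 1 \<Longrightarrow> \<sigma> x = 1"
    "\<And>x. deriv \<sigma> x \<ge> 0" "\<And>x. x \<notin> {0..1} \<Longrightarrow> deriv \<sigma> x = 0" "continuous_on UNIV (deriv \<sigma>)"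
    and u: "continuous_on {c..c+h} u" and h: "h > 0"
    and close: "\<And>x. x \<in> {c..c+h} \<Longrightarrow> norm (u x - u c) \<le> e"
    and S: "{c..c+h} \<subseteq> S"
  shows "norm ((LINT x:S|lebesgue. u x * of_real (deriv \<sigma> ((x - c) / h) / h)) - u c) \<le> e"
    "set_integrable lebesgue S (\<lambda>x. u x * of_real (deriv \<sigma> ((x - c) / h) / h))"
proof -
  define \<psi> where "\<psi> x = deriv \<sigma> ((x - c) / h) / h" for x
  have \<psi>0: "\<psi> x = 0" if "x \<notin> {c..c+h}" for x
  proof -
    have "(x - c) / h \<notin> {0..1}" using that h by (auto simp: field_simps)
    then show ?thesis using \<sigma>(5) by (simp add: \<psi>_def)
  qed
  have \<psi>pos: "\<psi> x \<ge> 0" for x using \<sigma>(4) h by (simp add: \<psi>_def)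
  have \<psi>cont: "continuous_on T \<psi>" for T
    unfolding \<psi>_def[abs_def] using h
    by (intro continuous_intros continuous_on_compose2[OF \<sigma>(6)]) auto
  have D: "((\<lambda>x. \<sigma> ((x - c) / h)) has_real_derivative \<psi> x) (at x)" for x
  proof -
    have "((\<lambda>x. \<sigma> ((x - c) / h)) has_real_derivative deriv \<sigma> ((x - c) / h) * (1 / h)) (at x)"
      by (rule DERIV_chain2[OF smooth_has_deriv[OF \<sigma>(1)]]) (use h in \<open>auto intro!: derivative_eq_intros\<close>)
    then show ?thesis by (simp add: \<psi>_def)
  qed
  have "(\<psi> has_integral (\<sigma> ((c + h - c) / h) - \<sigma> ((c - c) / h))) {c..c+h}"
    using h D by (intro fundamental_theorem_of_calculus)
      (auto simp flip: has_real_derivative_iff_has_vector_derivative intro: has_field_derivative_at_within)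
  then have one: "(\<psi> has_integral 1) {c..c+h}" using h \<sigma>(2,3) by simp
  have cu: "continuous_on {c..c+h} (\<lambda>x. u x * of_real (\<psi> x))"
    by (intro continuous_intros u \<psi>cont)
  have ind: "indicator S x *\<^sub>R (u x * of_real (\<psi> x)) = indicator {c..c+h} x *\<^sub>R (u x * of_real (\<psi> x))" for x
    using \<psi>0[of x] S by (auto simp: indicator_def)
  have int: "set_integrable lebesgue {c..c+h} (\<lambda>x. u x * of_real (\<psi> x))"
    using cu by (rule absolutely_integrable_continuous_real)
  then show "set_integrable lebesgue S (\<lambda>x. u x * of_real (deriv \<sigma> ((x - c) / h) / h))"
    unfolding set_integrable_def \<psi>_def[symmetric] ind .
  have "(LINT x:S|lebesgue. u x * of_real (\<psi> x)) = (LINT x:{c..c+h}|lebesgue. u x * of_real (\<psi> x))"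
    unfolding set_lebesgue_integral_def ind ..
  also have "\<dots> = integral {c..c+h} (\<lambda>x. u x * of_real (\<psi> x))"
    using int by (rule set_lebesgue_integral_eq_integral)
  finally have L: "(LINT x:S|lebesgue. u x * of_real (\<psi> x)) = integral {c..c+h} (\<lambda>x. u x * of_real (\<psi> x))" .
  have "((\<lambda>x. u c * of_real (\<psi> x)) has_integral u c * of_real 1) {c..c+h}"
    using has_integral_mult_right[OF has_integral_of_real[OF one]] .
  then have c1: "((\<lambda>x. u c * of_real (\<psi> x)) has_integral u c) {c..c+h}" by simp
  have "((\<lambda>x. u x * of_real (\<psi> x)) has_integral integral {c..c+h} (\<lambda>x. u x * of_real (\<psi> x))) {c..c+h}"
    using cu by (intro integrable_integral integrable_continuous_real)
  from has_integral_diff[OF this c1]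
  have d: "((\<lambda>x. (u x - u c) * of_real (\<psi> x)) has_integral
      integral {c..c+h} (\<lambda>x. u x * of_real (\<psi> x)) - u c) {c..c+h}"
    by (simp add: left_diff_distrib)
  have "norm (integral {c..c+h} (\<lambda>x. (u x - u c) * of_real (\<psi> x))) \<le> integral {c..c+h} (\<lambda>x. e * \<psi> x)"
  proof (rule integral_norm_bound_integral)
    show "(\<lambda>x. (u x - u c) * of_real (\<psi> x)) integrable_on {c..c+h}" using d by blast
    show "(\<lambda>x. e * \<psi> x) integrable_on {c..c+h}"
      by (intro integrable_continuous_real continuous_intros \<psi>cont)
    show "norm ((u x - u c) * of_real (\<psi> x)) \<le> e * \<psi> x" if "x \<in> {c..c+h}" for x
      using close[OF that] \<psi>pos[of x] by (simp add: norm_mult mult_right_mono)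
  qed
  also have "\<dots> = e" by (rule trans[OF integral_unique[OF has_integral_mult_right[OF one, of e]]]) simp
  finally show "norm ((LINT x:S|lebesgue. u x * of_real (deriv \<sigma> ((x - c) / h) / h)) - u c) \<le> e"
    unfolding integral_unique[OF d] L[symmetric] unfolding \<psi>_def .
qed

text \<open>The test functions are the differences \<open>\<sigma> ((x - a) / h) - \<sigma> ((x - b) / h)\<close>. As \<open>h\<close> tends to zero they
  converge to the indicator function of \<open>(a, b]\<close>, while their derivatives concentrate at \<open>a\<close> and \<open>b\<close>.\<close>

lemma weak_deriv_FTC_interior:
  fixes u w :: "real \<Rightarrow> complex"
  assumes wd: "weak_deriv_on S u w" and S: "open S" and u: "continuous_on S u"
    and ab: "a < b" "{a..b} \<subseteq> S"
  shows "u b - u a = (LINT x:{a..b}|lebesgue. w x)"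
proof -
  obtain \<sigma> where \<sigma>: "smooth \<sigma>" "\<And>x. x \<le> 0 \<Longrightarrow> \<sigma> x = 0" "\<And>x. x \<ge> 1 \<Longrightarrow> \<sigma> x = 1"
    "\<And>x. deriv \<sigma> x \<ge> 0" "\<And>x. x \<notin> {0..1} \<Longrightarrow> deriv \<sigma> x = 0" "continuous_on UNIV (deriv \<sigma>)"
    using smooth_step_exists by metis
  have mono: "\<sigma> x \<le> \<sigma> y" if "x \<le> y" for x y
    using that smooth_has_deriv[OF \<sigma>(1)] \<sigma>(4) by (intro DERIV_nonneg_imp_nondecreasing[of x y \<sigma>]) auto
  have \<sigma>01: "0 \<le> \<sigma> x" "\<sigma> x \<le> 1" for x
    using mono[of "min x 0" x] mono[of x "max x 1"] \<sigma>(2)[of "min x 0"] \<sigma>(3)[of "max x 1"] by auto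
  obtain \<delta> where \<delta>: "\<delta> > 0" "{a..b+\<delta>} \<subseteq> S"
  proof -
    obtain d where d: "d > 0" "ball b d \<subseteq> S" using S ab by (meson atLeastAtMost_iff less_imp_le open_contains_ball order_refl subsetD)
    have "{a..b+d/2} \<subseteq> S"
    proof
      fix x assume x: "x \<in> {a..b+d/2}"
      show "x \<in> S"
      proof (cases "x \<le> b")
        case True then show ?thesis using x ab by auto
      next
        case False
        then have "x \<in> ball b d" using x d by (auto simp: dist_real_def)
        then show ?thesis using d by blast
      qed
    qed
    then show thesis using d that[of "d/2"] by simp
  qed
  define h where "h n = \<delta> / real (Suc n)" for n
  have h: "h n > 0" "h n \<le> \<delta>" for n
    using \<delta> by (auto simp: h_def field_simps)
  have h0: "h \<longlonglongrightarrow> 0"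
    unfolding h_def[abs_def] using LIMSEQ_Suc[OF lim_const_over_n[of \<delta>]] by simp
  have cS: "{c..c+h n} \<subseteq> S" if "c \<in> {a,b}" for c n
    using \<delta>(2) h(2)[of n] ab(1) that by auto
  define \<phi> where "\<phi> n x = \<sigma> ((x - a) / h n) - \<sigma> ((x - b) / h n)" for n x
  have d\<phi>: "deriv (\<phi> n) = (\<lambda>x. deriv \<sigma> ((x - a) / h n) / h n - deriv \<sigma> ((x - b) / h n) / h n)" for n
  proof (rule deriv_eqI)
    fix x
    have "((\<lambda>x. \<sigma> ((x - c) / h n)) has_real_derivative deriv \<sigma> ((x - c) / h n) * (1 / h n)) (at x)" for c
      by (rule DERIV_chain2[OF smooth_has_deriv[OF \<sigma>(1)]])
        (use h[of n] in \<open>auto intro!: derivative_eq_intros\<close>)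
    then show "(\<phi> n has_real_derivative deriv \<sigma> ((x - a) / h n) / h n - deriv \<sigma> ((x - b) / h n) / h n) (at x)"
      unfolding \<phi>_def[abs_def] by (intro DERIV_diff) simp_all
  qed
  have \<phi>0: "\<phi> n x = 0" if "x \<notin> {a..b+\<delta>}" for n x
  proof -
    have "x < a \<or> x > b + \<delta>" using that by auto
    then consider "x < a" | "x > b + \<delta>" by blast
    then show ?thesis
    proof cases
      case 1
      then have "(x - a) / h n \<le> 0" "(x - b) / h n \<le> 0"
        using ab h[of n] by (auto intro!: divide_nonpos_pos)
      then show ?thesis using \<sigma>(2) by (simp add: \<phi>_def)
    next
      case 2
      then have "(x - a) / h n \<ge> 1" "(x - b) / h n \<ge> 1" using ab h[of n] by (auto simp: field_simps)
      then show ?thesis using \<sigma>(3) by (simp add: \<phi>_def)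
    qed
  qed
  have test: "\<phi> n \<in> test_functions S" for n
  proof -
    have s: "smooth (\<lambda>x. \<sigma> ((x - c) / h n))" for c
      using smooth_affine_comp[OF \<sigma>(1), of 1 "1 / h n" "- c / h n"] by (simp add: diff_divide_distrib)
    have "smooth (\<phi> n)" unfolding \<phi>_def[abs_def] by (intro smooth_diff s)
    then show ?thesis unfolding test_functions_def smooth_def
      using \<phi>0 \<delta>(2) by (auto intro!: exI[of _ "{a..b+\<delta>}"])
  qed
  have eq: "(LINT x:S|lebesgue. u x * of_real (deriv (\<phi> n) x)) = - (LINT x:S|lebesgue. w x * of_real (\<phi> n x))" for n
    using wd test unfolding weak_deriv_on_def by blast
  have uc: "continuous_on {a..b+\<delta>} u" using u \<delta>(2) continuous_on_subset by blast
  \<comment> \<open>the derivatives of the test functions concentrate at the end points\<close>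
  have conc: "(\<lambda>n. LINT x:S|lebesgue. u x * of_real (deriv \<sigma> ((x - c) / h n) / h n)) \<longlonglongrightarrow> u c"
    and cint: "\<And>n. set_integrable lebesgue S (\<lambda>x. u x * of_real (deriv \<sigma> ((x - c) / h n) / h n))"
    if c: "c \<in> {a,b}" for c
  proof -
    have ch: "continuous_on {c..c+h n} u" for n using u cS[OF c] continuous_on_subset by blast
    show "set_integrable lebesgue S (\<lambda>x. u x * of_real (deriv \<sigma> ((x - c) / h n) / h n))" for n
    proof -
      have "bounded (u ` {c..c+h n})" using ch by (intro compact_imp_bounded compact_continuous_image) auto
      then obtain M where M: "\<And>x. x \<in> {c..c+h n} \<Longrightarrow> norm (u x) \<le> M" unfolding bounded_iff by blast
      have "norm (u x - u c) \<le> M + M" if "x \<in> {c..c+h n}" for x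
        using M[OF that] M[of c] h(1)[of n] norm_triangle_ineq4[of "u x" "u c"] by auto
      then show ?thesis using smooth_step_derivative_concentrates(2)[OF \<sigma> ch h(1) _ cS[OF c]] by blast
    qed
    show "(\<lambda>n. LINT x:S|lebesgue. u x * of_real (deriv \<sigma> ((x - c) / h n) / h n)) \<longlonglongrightarrow> u c"
    proof (rule LIMSEQ_I)
      fix e :: real assume e: "e > 0"
      have "c \<in> S" using c ab by auto
      then have "isCont u c" using u S continuous_on_eq_continuous_at by blast
      then obtain d where d: "d > 0" "\<And>x. dist x c < d \<Longrightarrow> dist (u x) (u c) < e / 2"
        using e unfolding continuous_at_eps_delta by (metis half_gt_zero)
      obtain N where N: "\<And>n. n \<ge> N \<Longrightarrow> h n < d"
        using order_tendstoD(2)[OF h0 d(1)] by (auto simp: eventually_sequentially)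
      have "norm ((LINT x:S|lebesgue. u x * of_real (deriv \<sigma> ((x - c) / h n) / h n)) - u c) < e" if "n \<ge> N" for n
      proof -
        have "norm (u x - u c) \<le> e / 2" if x: "x \<in> {c..c+h n}" for x
          using d(2)[of x] x N[OF \<open>n \<ge> N\<close>] by (auto simp: dist_norm)
        from smooth_step_derivative_concentrates(1)[OF \<sigma> ch h(1) this cS[OF c], of n]
        show ?thesis using e by linarith
      qed
      then show "\<exists>no. \<forall>n\<ge>no. norm ((LINT x:S|lebesgue. u x * of_real (deriv \<sigma> ((x - c) / h n) / h n)) - u c) < e"
        by blast
    qed
  qed
  have "(LINT x:S|lebesgue. u x * of_real (deriv (\<phi> n) x))
      = (LINT x:S|lebesgue. u x * of_real (deriv \<sigma> ((x - a) / h n) / h n))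
      - (LINT x:S|lebesgue. u x * of_real (deriv \<sigma> ((x - b) / h n) / h n))" for n
    unfolding d\<phi> using cint by (subst set_integral_diff(2)[symmetric]) (auto simp: right_diff_distrib)
  then have lhs: "(\<lambda>n. LINT x:S|lebesgue. u x * of_real (deriv (\<phi> n) x)) \<longlonglongrightarrow> u a - u b"
    using tendsto_diff[OF conc[of a] conc[of b]] by simp
  \<comment> \<open>the test functions converge boundedly to an indicator function\<close>
  have wint: "set_integrable lebesgue {a..b+\<delta>} w" using wd \<delta>(2) unfolding weak_deriv_on_def by blast
  have rhs: "(\<lambda>n. LINT x:S|lebesgue. w x * of_real (\<phi> n x)) \<longlonglongrightarrow> (LINT x:{a<..b}|lebesgue. w x)"
  proof -
    have e: "(LINT x:S|lebesgue. w x * of_real (\<phi> n x)) = (LINT x|lebesgue. of_real (\<phi> n x) * (indicator {a..b+\<delta>} x *\<^sub>R w x))" for n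
      unfolding set_lebesgue_integral_def
      using \<phi>0[of _ n] \<delta>(2) by (intro Bochner_Integration.integral_cong) (auto simp: indicator_def)
    have "(\<lambda>n. LINT x|lebesgue. of_real (\<phi> n x) * (indicator {a..b+\<delta>} x *\<^sub>R w x)) \<longlonglongrightarrow> (LINT x|lebesgue. indicator {a<..b} x *\<^sub>R w x)"
    proof (rule integral_dominated_convergence)
      have m: "(\<lambda>x. indicator {a..b+\<delta>} x *\<^sub>R w x) \<in> borel_measurable lebesgue"
        using wint unfolding set_integrable_def by (rule borel_measurable_integrable)
      have "continuous_on UNIV (\<phi> n)" for n
        using test[of n] DERIV_isCont smooth_has_deriv unfolding test_functions_def smooth_def[symmetric]
        by (intro continuous_at_imp_continuous_on) blast
      then have m\<phi>: "\<phi> n \<in> borel_measurable lebesgue" for n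
        using borel_measurable_continuous_onI[of "\<phi> n"] by (intro measurable_completion) simp
      then show "(\<lambda>x. of_real (\<phi> n x) * (indicator {a..b+\<delta>} x *\<^sub>R w x)) \<in> borel_measurable lebesgue" for n
        using m measurable_compose[OF m\<phi>[of n] borel_measurable_of_real]
        by (intro borel_measurable_times)
      have "(\<lambda>x. indicator {a<..b} x *\<^sub>R (indicator {a..b+\<delta>} x *\<^sub>R w x)) \<in> borel_measurable lebesgue"
        by (intro borel_measurable_scaleR[OF _ m] borel_measurable_indicator) auto
      also have "(\<lambda>x. indicator {a<..b} x *\<^sub>R (indicator {a..b+\<delta>} x *\<^sub>R w x)) = (\<lambda>x. indicator {a<..b} x *\<^sub>R w x)"
        using \<delta>(1) by (auto simp: indicator_def fun_eq_iff)
      finally show "(\<lambda>x. indicator {a<..b} x *\<^sub>R w x) \<in> borel_measurable lebesgue" .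
      show "integrable lebesgue (\<lambda>x. norm (indicator {a..b+\<delta>} x *\<^sub>R w x))"
        using wint unfolding set_integrable_def by (rule integrable_norm)
      show "AE x in lebesgue. norm (of_real (\<phi> n x) * (indicator {a..b+\<delta>} x *\<^sub>R w x)) \<le> norm (indicator {a..b+\<delta>} x *\<^sub>R w x)" for n
      proof (rule AE_I2)
        fix x
        have "\<bar>\<phi> n x\<bar> \<le> 1" using \<sigma>01[of "(x - a) / h n"] \<sigma>01[of "(x - b) / h n"] by (auto simp: \<phi>_def abs_if)
        then have "\<bar>\<phi> n x\<bar> * norm (indicator {a..b+\<delta>} x *\<^sub>R w x) \<le> 1 * norm (indicator {a..b+\<delta>} x *\<^sub>R w x)"
          by (intro mult_right_mono) auto
        then show "norm (of_real (\<phi> n x) * (indicator {a..b+\<delta>} x *\<^sub>R w x)) \<le> norm (indicator {a..b+\<delta>} x *\<^sub>R w x)"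
          by (simp only: norm_mult norm_of_real mult_1)
      qed
      show "AE x in lebesgue. (\<lambda>n. of_real (\<phi> n x) * (indicator {a..b+\<delta>} x *\<^sub>R w x)) \<longlonglongrightarrow> indicator {a<..b} x *\<^sub>R w x"
      proof (rule AE_I2)
        fix x
        have step: "eventually (\<lambda>n. \<sigma> ((x - c) / h n) = (if x \<le> c then 0 else 1)) sequentially" for c
        proof (cases "x \<le> c")
          case True
          then have "(x - c) / h n \<le> 0" for n using h(1)[of n] by (simp add: divide_nonpos_pos)
          then show ?thesis using True \<sigma>(2) by simp
        next
          case False
          then have "eventually (\<lambda>n. h n < x - c) sequentially" using order_tendstoD(2)[OF h0] by simp
          then show ?thesis
          proof eventually_elim
            case (elim n)
            then have "(x - c) / h n \<ge> 1" using h(1)[of n] by (simp add: field_simps)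
            then show ?case using False \<sigma>(3) by simp
          qed
        qed
        have "eventually (\<lambda>n. of_real (\<phi> n x) * (indicator {a..b+\<delta>} x *\<^sub>R w x) = indicator {a<..b} x *\<^sub>R w x) sequentially"
          using step[of a] step[of b]
          by eventually_elim (use ab \<delta> in \<open>auto simp: \<phi>_def indicator_def\<close>)
        then show "(\<lambda>n. of_real (\<phi> n x) * (indicator {a..b+\<delta>} x *\<^sub>R w x)) \<longlonglongrightarrow> indicator {a<..b} x *\<^sub>R w x"
          by (rule tendsto_eventually)
      qed
    qed
    then show ?thesis unfolding e set_lebesgue_integral_def[of _ "{a<..b}"] .
  qed
  have "u a - u b = - (LINT x:{a<..b}|lebesgue. w x)"
    using LIMSEQ_unique[OF lhs] tendsto_minus[OF rhs] unfolding eq by blast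
  moreover have "(LINT x:{a<..b}|lebesgue. w x) = (LINT x:{a..b}|lebesgue. w x)"
  proof -
    have "set_integrable lebesgue {a<..b} w" "set_integrable lebesgue {a..b} w"
      using \<delta>(1) by (auto intro!: set_integrable_subset[OF wint])
    moreover have "integral {a<..b} w = integral {a..b} w"
    proof (rule integral_spike_set)
      have "{x \<in> {a..b} - {a<..b}. w x \<noteq> 0} \<subseteq> {a}" by auto
      then show "negligible {x \<in> {a..b} - {a<..b}. w x \<noteq> 0}" by (rule negligible_subset[rotated]) simp
      have "{x \<in> {a<..b} - {a..b}. w x \<noteq> 0} = {}" by auto
      then show "negligible {x \<in> {a<..b} - {a..b}. w x \<noteq> 0}" by (metis negligible_empty)
    qed
    ultimately show ?thesis by (simp add: set_lebesgue_integral_eq_integral)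
  qed
  ultimately show ?thesis by (simp add: algebra_simps)
qed

lemma geometric_cauchy:
  fixes f :: "nat \<Rightarrow> 'a::banach"
  assumes r: "0 \<le> r" "r < 1" and step: "\<And>n. norm (f (Suc n) - f n) \<le> C * r ^ n"
  shows "convergent f" "\<And>n. norm (f n - lim f) \<le> C * r ^ n / (1 - r)"
proof -
  have C: "C \<ge> 0" using step[of 0] by (simp add: order_trans[OF norm_ge_zero])
  have sumr: "summable (\<lambda>n. C * r ^ n)" using r by (intro summable_mult summable_geometric) auto
  have sd: "summable (\<lambda>n. f (Suc n) - f n)"
    by (rule summable_comparison_test'[OF sumr]) (use step in auto)
  have "(\<lambda>n. (\<Sum>i<n. f (Suc i) - f i) + f 0) \<longlonglongrightarrow> (\<Sum>i. f (Suc i) - f i) + f 0"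
    using summable_LIMSEQ[OF sd] by (intro tendsto_intros)
  then have "f \<longlonglongrightarrow> (\<Sum>i. f (Suc i) - f i) + f 0" by (simp add: sum_lessThan_telescope)
  then show conv: "convergent f" by (rule convergentI)
  have *: "norm (f (n + k) - f n) \<le> C * r ^ n * (1 - r ^ k) / (1 - r)" for n k
  proof (induction k)
    case (Suc k)
    have "norm (f (n + Suc k) - f n) \<le> norm (f (n + k) - f n) + norm (f (Suc (n + k)) - f (n + k))"
      using norm_triangle_ineq[of "f (n + k) - f n" "f (Suc (n + k)) - f (n + k)"] by simp
    also have "\<dots> \<le> C * r ^ n * (1 - r ^ k) / (1 - r) + C * r ^ (n + k)"
      using Suc step by (intro add_mono)
    also have "\<dots> = C * r ^ n * (1 - r ^ Suc k) / (1 - r)"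
      using r by (simp add: field_simps power_add)
    finally show ?case .
  qed simp
  show "norm (f n - lim f) \<le> C * r ^ n / (1 - r)" for n
  proof -
    have "(\<lambda>k. f (k + n)) \<longlonglongrightarrow> lim f" using conv convergent_LIMSEQ_iff LIMSEQ_ignore_initial_segment by blast
    then have "(\<lambda>k. norm (f n - f (k + n))) \<longlonglongrightarrow> norm (f n - lim f)" by (intro tendsto_intros)
    moreover have "norm (f n - f (k + n)) \<le> C * r ^ n / (1 - r)" for k
    proof -
      have "norm (f n - f (k + n)) \<le> C * r ^ n * (1 - r ^ k) / (1 - r)"
        using *[of n k] by (simp add: norm_minus_commute add.commute)
      also have "\<dots> \<le> C * r ^ n * 1 / (1 - r)"
        using C r by (intro divide_right_mono mult_left_mono) auto
      finally show ?thesis by simp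
    qed
    ultimately show ?thesis by (intro LIMSEQ_le_const2) auto
  qed
qed

text \<open>The weighted sum \<open>G\<close> of the terms \<open>2\<^sup>k |f\<^sub>k\<^sub>+\<^sub>1 - f\<^sub>k|\<^sup>2\<close> is integrable. Wherever it is finite, the
  increments are at most \<open>\<surd>G (1 / \<surd>2)\<^sup>k\<close>, so the sequence converges there and the squared error is
  dominated by \<open>G\<close> times a constant that tends to zero.\<close>

lemma L2_complete:
  fixes f :: "nat \<Rightarrow> 'a \<Rightarrow> complex"
  assumes f: "\<And>n. f n \<in> borel_measurable M" "\<And>n. integrable M (\<lambda>x. (norm (f n x))\<^sup>2)"
    and step: "\<And>n. (\<integral>x. (norm (f (Suc n) x - f n x))\<^sup>2 \<partial>M) \<le> (1/4) ^ n"
  obtains g where "g \<in> borel_measurable M" "integrable M (\<lambda>x. (norm (g x))\<^sup>2)"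
    "AE x in M. (\<lambda>n. f n x) \<longlonglongrightarrow> g x"
    "\<And>n. integrable M (\<lambda>x. (norm (f n x - g x))\<^sup>2)"
    "(\<lambda>n. \<integral>x. (norm (f n x - g x))\<^sup>2 \<partial>M) \<longlonglongrightarrow> 0"
proof -
  note [measurable] = f(1)
  have sq: "(norm (a - b))\<^sup>2 \<le> 2 * (norm a)\<^sup>2 + 2 * (norm b)\<^sup>2" for a b :: complex
  proof -
    have "(norm (a - b))\<^sup>2 \<le> (norm a + norm b)\<^sup>2" by (intro power_mono norm_triangle_ineq4) auto
    also have "\<dots> \<le> 2 * (norm a)\<^sup>2 + 2 * (norm b)\<^sup>2"
      using sum_squares_bound[of "norm a" "norm b"] by (simp add: power2_sum)
    finally show ?thesis .
  qed
  define d where "d n x = (norm (f (Suc n) x - f n x))\<^sup>2" for n x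
  have [measurable]: "d n \<in> borel_measurable M" for n unfolding d_def by measurable
  have d0: "d n x \<ge> 0" for n x by (simp add: d_def)
  have dint: "integrable M (d n)" for n
    by (rule Bochner_Integration.integrable_bound[where f="\<lambda>x. 2 * (norm (f (Suc n) x))\<^sup>2 + 2 * (norm (f n x))\<^sup>2"])
      (use f(2) sq in \<open>auto simp: d_def\<close>)
  define D where "D n x = 2 ^ n * d n x" for n x
  have [measurable]: "D n \<in> borel_measurable M" for n unfolding D_def by measurable
  have Dint: "integrable M (D n)" for n unfolding D_def using dint by auto
  have D0: "D n x \<ge> 0" for n x using d0 by (simp add: D_def)
  have ID: "(\<integral>x. D n x \<partial>M) \<le> (1/2) ^ n" for n
  proof -
    have "(\<integral>x. D n x \<partial>M) = 2 ^ n * (\<integral>x. d n x \<partial>M)" by (simp add: D_def)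
    also have "\<dots> \<le> 2 ^ n * (1/4) ^ n" using step[of n] unfolding d_def by (intro mult_left_mono) auto
    also have "\<dots> = (1/2) ^ n" by (simp flip: power_mult_distrib)
    finally show ?thesis .
  qed
  have "(\<integral>\<^sup>+x. (\<Sum>n. ennreal (D n x)) \<partial>M) = (\<Sum>n. \<integral>\<^sup>+x. ennreal (D n x) \<partial>M)"
    by (intro nn_integral_suminf) measurable
  also have "\<dots> = (\<Sum>n. ennreal (\<integral>x. D n x \<partial>M))"
    using Dint D0 by (intro suminf_cong nn_integral_eq_integral) auto
  also have "\<dots> \<le> (\<Sum>n. ennreal ((1/2) ^ n))"
    using ID by (intro suminf_le ennreal_leI) auto
  also have "\<dots> = ennreal (\<Sum>n. (1/2) ^ n)"
    by (intro suminf_ennreal2 summable_geometric) auto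
  also have "\<dots> < \<infinity>" by simp
  finally have "AE x in M. (\<Sum>n. ennreal (D n x)) \<noteq> \<infinity>"
    by (intro nn_integral_noteq_infinite) auto
  then have summ: "AE x in M. summable (\<lambda>n. D n x)"
    by (rule AE_mp) (auto intro!: AE_I2 summable_suminf_not_top D0)
  define G where "G x = (\<Sum>n. D n x)" for x
  have Gint: "integrable M G" unfolding G_def
  proof (rule integrable_suminf[OF Dint])
    show "AE x in M. summable (\<lambda>n. norm (D n x))" using summ D0 by simp
    show "summable (\<lambda>n. \<integral>x. norm (D n x) \<partial>M)"
    proof (rule summable_comparison_test'[of "\<lambda>n. (1/2) ^ n" 0])
      show "norm (\<integral>x. norm (D n x) \<partial>M) \<le> (1/2) ^ n" for n
        using ID[of n] D0 by (simp add: integral_nonneg_AE)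
    qed (simp add: summable_geometric)
  qed
  define r where "r = 1 / sqrt 2"
  have r: "0 \<le> r" "r < 1" "r\<^sup>2 = 1/2" by (auto simp: r_def power_divide)
  define g where "g x = lim (\<lambda>n. f n x)" for x
  have gm [measurable]: "g \<in> borel_measurable M" unfolding g_def by measurable
  define K where "K = (1 / (1 - r))\<^sup>2"
  have main: "AE x in M. (\<lambda>n. f n x) \<longlonglongrightarrow> g x \<and> (\<forall>n. (norm (f n x - g x))\<^sup>2 \<le> K * (1/2) ^ n * G x)"
    using summ
  proof eventually_elim
    case (elim x)
    have DG: "D n x \<le> G x" for n
      unfolding G_def using elim D0 sum_le_suminf[of "\<lambda>n. D n x" "{n}"] by simp
    have G0: "G x \<ge> 0" using D0[of 0 x] DG[of 0] by simp
    have st: "norm (f (Suc n) x - f n x) \<le> sqrt (G x) * r ^ n" for n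
    proof (rule power2_le_imp_le)
      have "(r ^ n)\<^sup>2 = (1/2) ^ n" using r(3) by (metis power_mult mult.commute)
      then have "(sqrt (G x) * r ^ n)\<^sup>2 = G x * (1/2) ^ n" using G0 by (simp add: power_mult_distrib)
      moreover have "d n x \<le> G x * (1/2) ^ n"
        using DG[of n] by (simp add: D_def field_simps power_divide)
      ultimately show "(norm (f (Suc n) x - f n x))\<^sup>2 \<le> (sqrt (G x) * r ^ n)\<^sup>2" by (simp add: d_def)
    qed (use G0 r in auto)
    note gc = geometric_cauchy[OF r(1,2) st]
    have "(norm (f n x - g x))\<^sup>2 \<le> K * (1/2) ^ n * G x" for n
    proof -
      have "(norm (f n x - g x))\<^sup>2 \<le> (sqrt (G x) * r ^ n / (1 - r))\<^sup>2"
        unfolding g_def by (intro power_mono gc(2)) auto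
      also have "\<dots> = K * (r\<^sup>2) ^ n * G x"
        using G0 by (simp add: K_def power_mult_distrib power_divide mult_ac flip: power_mult)
      finally show ?thesis by (simp add: r(3))
    qed
    then show ?case using gc(1) unfolding g_def convergent_LIMSEQ_iff by blast
  qed
  have eint: "integrable M (\<lambda>x. (norm (f n x - g x))\<^sup>2)" for n
  proof (rule Bochner_Integration.integrable_bound)
    show "integrable M (\<lambda>x. K * (1/2) ^ n * G x)" using Gint by simp
    show "AE x in M. norm ((norm (f n x - g x))\<^sup>2) \<le> norm (K * (1/2) ^ n * G x)"
      using main by eventually_elim (smt (verit) real_norm_def zero_le_power2)
  qed measurable
  show thesis
  proof (rule that[OF gm])
    show "AE x in M. (\<lambda>n. f n x) \<longlonglongrightarrow> g x" using main by eventually_elim simp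
    show "integrable M (\<lambda>x. (norm (f n x - g x))\<^sup>2)" for n by (rule eint)
    show "integrable M (\<lambda>x. (norm (g x))\<^sup>2)"
    proof (rule Bochner_Integration.integrable_bound)
      show "integrable M (\<lambda>x. 2 * (norm (f 0 x))\<^sup>2 + 2 * (norm (f 0 x - g x))\<^sup>2)" using f(2) eint by simp
      show "AE x in M. norm ((norm (g x))\<^sup>2) \<le> norm (2 * (norm (f 0 x))\<^sup>2 + 2 * (norm (f 0 x - g x))\<^sup>2)"
      proof (rule AE_I2)
        fix x show "norm ((norm (g x))\<^sup>2) \<le> norm (2 * (norm (f 0 x))\<^sup>2 + 2 * (norm (f 0 x - g x))\<^sup>2)"
          using sq[of "f 0 x" "f 0 x - g x"] by simp
      qed
    qed measurable
    have le: "(\<integral>x. (norm (f n x - g x))\<^sup>2 \<partial>M) \<le> K * (1/2) ^ n * (\<integral>x. G x \<partial>M)" for n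
    proof -
      have "(\<integral>x. (norm (f n x - g x))\<^sup>2 \<partial>M) \<le> (\<integral>x. K * (1/2) ^ n * G x \<partial>M)"
        using eint Gint main by (intro integral_mono_AE) auto
      then show ?thesis by simp
    qed
    have "(\<lambda>n. K * (1/2) ^ n * (\<integral>x. G x \<partial>M)) \<longlonglongrightarrow> K * 0 * (\<integral>x. G x \<partial>M)"
      by (intro tendsto_intros LIMSEQ_power_zero) auto
    then have lim: "(\<lambda>n. K * (1/2) ^ n * (\<integral>x. G x \<partial>M)) \<longlonglongrightarrow> 0" by simp
    show "(\<lambda>n. \<integral>x. (norm (f n x - g x))\<^sup>2 \<partial>M) \<longlonglongrightarrow> 0"
      by (rule tendsto_sandwich[OF _ _ tendsto_const[of 0] lim])
        (auto intro!: always_eventually le)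
  qed
qed

text \<open>Compact intervals generate the Borel sets, and a Lebesgue set is a Borel set up to a null set.\<close>

lemma AE_zero_if_interval_integrals_zero_real:
  fixes f :: "real \<Rightarrow> real"
  assumes f: "integrable lebesgue f" and zero: "\<And>a b. a < b \<Longrightarrow> (LINT x:{a..b}|lebesgue. f x) = 0"
  shows "AE x in lebesgue. f x = 0"
proof -
  have fset: "set_integrable lebesgue A f" if "A \<in> sets lebesgue" for A
    using integrable_mult_indicator[OF that f] by (simp add: set_integrable_def)
  have univ: "(LINT x:UNIV|lebesgue. f x) = 0"
  proof -
    have "(\<lambda>n. LINT x:{- real (Suc n)..real (Suc n)}|lebesgue. f x) \<longlonglongrightarrow> (LINT x:(\<Union>n. {- real (Suc n)..real (Suc n)})|lebesgue. f x)"
    proof (rule set_integral_cont_up)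
      show "set_integrable lebesgue (\<Union>n. {- real (Suc n)..real (Suc n)}) f" by (intro fset) auto
    qed (auto simp: incseq_def)
    moreover have "(\<Union>n. {- real (Suc n)..real (Suc n)}) = (UNIV :: real set)"
    proof -
      have "\<exists>n. x \<in> {- real (Suc n)..real (Suc n)}" for x
      proof -
        obtain n where "\<bar>x\<bar> \<le> real n" using real_arch_simple by blast
        then show ?thesis by (intro exI[of _ n]) auto
      qed
      then show ?thesis by blast
    qed
    moreover have "(LINT x:{- real (Suc n)..real (Suc n)}|lebesgue. f x) = 0" for n by (rule zero) simp
    ultimately show ?thesis by (simp add: LIMSEQ_const_iff)
  qed
  have bor: "(LINT x:A|lebesgue. f x) = 0" if "A \<in> sets borel" for A
    using that
  proof (induction rule: borel_set_induct)
    case empty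
    show ?case by (simp add: set_lebesgue_integral_def)
  next
    case (interval a b)
    show ?case
    proof (cases "a = b")
      case True
      have "set_lebesgue_integral lebesgue {b} f = integral {b} f"
        by (intro set_lebesgue_integral_eq_integral fset) auto
      then show ?thesis using True by simp
    qed (use interval zero in auto)
  next
    case (compl B)
    have Bm: "B \<in> sets lebesgue" "- B \<in> sets lebesgue"
      using compl borel_comp by (auto intro!: sets_completionI_sets)
    have "(LINT x:B \<union> - B|lebesgue. f x) = (LINT x:B|lebesgue. f x) + (LINT x:- B|lebesgue. f x)"
      using Bm by (intro set_integral_Un fset) auto
    moreover have "B \<union> - B = UNIV" by auto
    ultimately show ?case using univ compl by (simp add: Compl_eq_Diff_UNIV)
  next
    case (union B)
    have "(LINT x:(\<Union>i. B i)|lebesgue. f x) = (\<Sum>i. LINT x:B i|lebesgue. f x)"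
    proof (rule lebesgue_integral_countable_add)
      show Bm: "B i \<in> sets lebesgue" for i using union(2)[of i] by (intro sets_completionI_sets) simp
      show "B i \<inter> B j = {}" if "i \<noteq> j" for i j using union(1) that by (auto simp: disjoint_family_on_def)
      show "set_integrable lebesgue (\<Union>i. B i) f" using Bm by (intro fset sets.countable_UN) auto
    qed
    then show ?case using union(3) by simp
  qed
  have "(LINT x:A|lebesgue. f x) = (LINT x:A|lebesgue. (\<lambda>_. 0) x)" if A: "A \<in> sets lebesgue" for A
  proof -
    obtain S N N' where S: "A = S \<union> N" "N \<subseteq> N'" "N' \<in> null_sets lborel" "S \<in> sets lborel"
      using A by (rule sets_completionE)
    have "(LINT x:A|lebesgue. f x) = (LINT x:S|lebesgue. f x)"
    proof (rule set_integral_null_delta[OF f A])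
      show "S \<in> sets lebesgue" using S(4) by simp
      have "N' \<in> null_sets lebesgue" using S(3) by (rule null_sets_completionI)
      then have "N \<in> null_sets lebesgue" using S(2) negligible_iff_null_sets negligible_subset by blast
      moreover have "A - S \<union> (S - A) \<subseteq> N" using S(1) by auto
      ultimately show "A - S \<union> (S - A) \<in> null_sets lebesgue"
        using negligible_iff_null_sets negligible_subset by blast
    qed
    then show ?thesis using bor S(4) by simp
  qed
  then show ?thesis by (intro density_unique_real[OF f]) auto
qed

lemma AE_zero_if_interval_integrals_zero:
  fixes f :: "real \<Rightarrow> complex"
  assumes f: "integrable lebesgue f" and zero: "\<And>a b. a < b \<Longrightarrow> (LINT x:{a..b}|lebesgue. f x) = 0"
  shows "AE x in lebesgue. f x = 0"
proof -
  have fset: "set_integrable lebesgue {a..b} f" for a b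
    using integrable_mult_indicator[OF _ f, of "{a..b}"] by (simp add: set_integrable_def)
  have "AE x in lebesgue. Re (f x) = 0"
  proof (rule AE_zero_if_interval_integrals_zero_real)
    show "(LINT x:{a..b}|lebesgue. Re (f x)) = 0" if "a < b" for a b
      using zero[OF that] integral_Re[OF fset[unfolded set_integrable_def], of a b]
      by (simp add: set_lebesgue_integral_def)
  qed (use f in simp)
  moreover have "AE x in lebesgue. Im (f x) = 0"
  proof (rule AE_zero_if_interval_integrals_zero_real)
    show "(LINT x:{a..b}|lebesgue. Im (f x)) = 0" if "a < b" for a b
      using zero[OF that] integral_Im[OF fset[unfolded set_integrable_def], of a b]
      by (simp add: set_lebesgue_integral_def)
  qed (use f in simp)
  ultimately show ?thesis by eventually_elim (simp add: complex_eq_iff)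
qed

lemma weak_deriv_integrable:
  "weak_deriv_on S u w \<Longrightarrow> {a..b} \<subseteq> S \<Longrightarrow> set_integrable lebesgue {a..b} w"
  unfolding weak_deriv_on_def by blast

text \<open>By the fundamental theorem both weak derivatives have the same integral over every compact
  interval in \<open>S\<close>, and countably many such intervals cover \<open>S\<close>.\<close>

lemma weak_deriv_unique:
  assumes w: "weak_deriv_on S u w" "weak_deriv_on S u w'" and S: "open S" and u: "continuous_on S u"
  shows "AE x in lebesgue. x \<in> S \<longrightarrow> w x = w' x"
proof -
  obtain D where D: "countable D" "D \<subseteq> Pow S" "\<And>X. X \<in> D \<Longrightarrow> \<exists>a b. X = cbox a b" "\<Union>D = S"
    using open_countable_Union_open_cbox[OF S] by blast
  have "AE x in lebesgue. x \<in> X \<longrightarrow> w x = w' x" if X: "X \<in> D" for X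
  proof -
    obtain a b where ab: "X = {a..b}" using D(3)[OF X] by auto
    have sub: "{a..b} \<subseteq> S" using D(2) X ab by auto
    define f where "f x = indicator {a..b} x *\<^sub>R (w x - w' x)" for x
    have int: "set_integrable lebesgue {a..b} w" "set_integrable lebesgue {a..b} w'"
      using w sub by (auto intro: weak_deriv_integrable)
    have "AE x in lebesgue. f x = 0"
    proof (rule AE_zero_if_interval_integrals_zero)
      have "set_integrable lebesgue {a..b} (\<lambda>x. w x - w' x)" using int by (rule set_integral_diff)
      then show "integrable lebesgue f" by (simp add: set_integrable_def f_def[abs_def])
      fix c d :: real assume cd: "c < d"
      define c' d' where "c' = max a c" and "d' = min b d"
      have sub': "{c'..d'} \<subseteq> {a..b}" by (auto simp: c'_def d'_def)
      have int': "set_integrable lebesgue {c'..d'} w" "set_integrable lebesgue {c'..d'} w'"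
        using set_integrable_subset[OF int(1) _ sub'] set_integrable_subset[OF int(2) _ sub'] by simp_all
      have "(LINT x:{c..d}|lebesgue. f x) = (LINT x:{c'..d'}|lebesgue. w x - w' x)"
        unfolding set_lebesgue_integral_def f_def c'_def d'_def
        by (intro Bochner_Integration.integral_cong) (auto simp: indicator_def)
      also have "\<dots> = (LINT x:{c'..d'}|lebesgue. w x) - (LINT x:{c'..d'}|lebesgue. w' x)"
        using int' by (rule set_integral_diff)
      also have "\<dots> = 0"
      proof (cases "c' < d'")
        case True
        then show ?thesis using weak_deriv_FTC_interior[OF w(1) S u True] weak_deriv_FTC_interior[OF w(2) S u True]
            sub sub' by (metis cancel_comm_monoid_add_class.diff_cancel order_trans)
      next
        case False
        have "(LINT x:{c'..d'}|lebesgue. v x) = 0" if "set_integrable lebesgue {c'..d'} v" for v :: "real \<Rightarrow> complex"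
        proof -
          have "negligible {c'..d'}" using False by (cases "c' = d'") auto
          then show ?thesis using set_lebesgue_integral_eq_integral(2)[OF that] integral_unique[OF has_integral_negligible[of "{c'..d'}" "{c'..d'}" v]]
            by simp
        qed
        then show ?thesis using int' by simp
      qed
      finally show "(LINT x:{c..d}|lebesgue. f x) = 0" .
    qed
    then show ?thesis unfolding ab by eventually_elim (auto simp: f_def)
  qed
  then have "AE x in lebesgue. \<forall>X\<in>D. x \<in> X \<longrightarrow> w x = w' x"
    by (subst AE_ball_countable[OF D(1)]) (rule ballI)
  then show ?thesis by eventually_elim (use D(4) in blast)
qed

lemma test_functions_deriv:
  assumes \<phi>: "\<phi> \<in> test_functions S" shows "deriv \<phi> \<in> test_functions S"
proof -
  have sm: "smooth \<phi>" using \<phi> by (simp add: test_functions_def smooth_def)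
  obtain K where K: "compact K" "K \<subseteq> S" "\<And>x. x \<notin> K \<Longrightarrow> \<phi> x = 0"
    using \<phi> unfolding test_functions_def by blast
  have "deriv \<phi> x = 0" if x: "x \<notin> K" for x
  proof -
    have "open (- K)" using K(1) compact_imp_closed by blast
    then have "\<forall>\<^sub>F y in nhds x. \<phi> y = 0"
      using eventually_nhds_in_open[of "- K" x] x K(3) by (auto elim!: eventually_mono)
    then have "(\<phi> has_real_derivative 0) (at x)"
      using DERIV_cong_ev[OF refl, of \<phi> "\<lambda>_. 0"] by auto
    then show ?thesis by (rule DERIV_imp_deriv)
  qed
  then show ?thesis
    using smooth_deriv[OF sm] K unfolding test_functions_def smooth_def by blast
qed

lemma test_function_product:
  fixes u :: "real \<Rightarrow> complex"
  assumes \<phi>: "\<phi> \<in> test_functions S" and u: "\<And>K. compact K \<Longrightarrow> K \<subseteq> S \<Longrightarrow> set_integrable lebesgue K u"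
  shows "set_integrable lebesgue S (\<lambda>x. u x * of_real (\<phi> x))"
proof -
  have sm: "smooth \<phi>" using \<phi> by (simp add: test_functions_def smooth_def)
  obtain K where K: "compact K" "K \<subseteq> S" "\<And>x. x \<notin> K \<Longrightarrow> \<phi> x = 0"
    using \<phi> unfolding test_functions_def by blast
  have cont: "continuous_on T \<phi>" for T
    using DERIV_isCont[OF smooth_has_deriv[OF sm]] by (intro continuous_at_imp_continuous_on) auto
  have "bounded (\<phi> ` K)" using K(1) cont by (intro compact_imp_bounded compact_continuous_image)
  then obtain B where B: "\<And>x. x \<in> K \<Longrightarrow> norm (\<phi> x) \<le> B" unfolding bounded_iff by blast
  have m: "\<phi> \<in> borel_measurable lebesgue"
    using borel_measurable_continuous_onI[OF cont] by (intro measurable_completion) simp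
  have "integrable lebesgue (\<lambda>x. B *\<^sub>R (indicator K x *\<^sub>R u x))"
    using u[OF K(1,2)] unfolding set_integrable_def by (rule integrable_scaleR_right)
  then have "integrable lebesgue (\<lambda>x. (indicator K x *\<^sub>R u x) * of_real (\<phi> x))"
  proof (rule Bochner_Integration.integrable_bound)
    show "(\<lambda>x. (indicator K x *\<^sub>R u x) * of_real (\<phi> x)) \<in> borel_measurable lebesgue"
      using borel_measurable_integrable[OF u[OF K(1,2), unfolded set_integrable_def]]
        measurable_compose[OF m borel_measurable_of_real]
      by (rule borel_measurable_times)
    show "AE x in lebesgue. norm ((indicator K x *\<^sub>R u x) * of_real (\<phi> x)) \<le> norm (B *\<^sub>R (indicator K x *\<^sub>R u x))"
    proof (rule AE_I2)
      fix x
      show "norm ((indicator K x *\<^sub>R u x) * of_real (\<phi> x)) \<le> norm (B *\<^sub>R (indicator K x *\<^sub>R u x))"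
      proof (cases "x \<in> K")
        case True
        then have "norm (u x) * \<bar>\<phi> x\<bar> \<le> norm (u x) * \<bar>B\<bar>" using B[OF True] by (intro mult_left_mono) auto
        then show ?thesis using True by (simp add: norm_mult mult.commute)
      qed simp
    qed
  qed
  also have "(\<lambda>x. (indicator K x *\<^sub>R u x) * of_real (\<phi> x)) = (\<lambda>x. indicator S x *\<^sub>R (u x * of_real (\<phi> x)))"
    using K(2,3) by (auto simp: indicator_def fun_eq_iff)
  finally show ?thesis by (simp add: set_integrable_def)
qed

lemma weak_deriv_on_lin:
  assumes u: "weak_deriv_on S u w" and u': "weak_deriv_on S u' w'"
  shows "weak_deriv_on S (\<lambda>x. u x + c * u' x) (\<lambda>x. w x + c * w' x)"
proof -
  have int: "set_integrable lebesgue K u \<and> set_integrable lebesgue K w" 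
    "set_integrable lebesgue K u' \<and> set_integrable lebesgue K w'" if "compact K" "K \<subseteq> S" for K
    using u u' that unfolding weak_deriv_on_def by blast+
  show ?thesis unfolding weak_deriv_on_def
  proof (intro conjI allI impI ballI)
    fix K assume "compact K \<and> K \<subseteq> S"
    then show "set_integrable lebesgue K (\<lambda>x. u x + c * u' x)" "set_integrable lebesgue K (\<lambda>x. w x + c * w' x)"
      using int by (auto intro!: set_integral_add set_integrable_mult_right)
  next
    fix \<phi> assume \<phi>: "\<phi> \<in> test_functions S"
    note d\<phi> = test_functions_deriv[OF \<phi>]
    have lin: "(LINT x:S|lebesgue. (v x + c * v' x) * of_real (\<psi> x))
        = (LINT x:S|lebesgue. v x * of_real (\<psi> x)) + c * (LINT x:S|lebesgue. v' x * of_real (\<psi> x))"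
      if \<psi>: "\<psi> \<in> test_functions S" and v: "\<And>K. compact K \<Longrightarrow> K \<subseteq> S \<Longrightarrow> set_integrable lebesgue K v"
        "\<And>K. compact K \<Longrightarrow> K \<subseteq> S \<Longrightarrow> set_integrable lebesgue K v'" for v v' \<psi>
    proof -
      have "(LINT x:S|lebesgue. (v x + c * v' x) * of_real (\<psi> x))
          = (LINT x:S|lebesgue. v x * of_real (\<psi> x) + c * (v' x * of_real (\<psi> x)))"
        by (simp add: algebra_simps)
      also have "\<dots> = (LINT x:S|lebesgue. v x * of_real (\<psi> x)) + (LINT x:S|lebesgue. c * (v' x * of_real (\<psi> x)))"
        using test_function_product[OF \<psi> v(1)] test_function_product[OF \<psi> v(2)]
        by (intro set_integral_add set_integrable_mult_right) auto
      finally show ?thesis by (simp only: set_integral_mult_right)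
    qed
    show "(LINT x:S|lebesgue. (u x + c * u' x) * of_real (deriv \<phi> x)) =
        - (LINT x:S|lebesgue. (w x + c * w' x) * of_real (\<phi> x))"
      using u u' \<phi> int unfolding weak_deriv_on_def by (simp add: lin[OF d\<phi>] lin[OF \<phi>])
  qed
qed

text \<open>Here the end points may lie on the boundary of \<open>S\<close>: the difference between \<open>u\<close> and the primitive of
  \<open>w\<close> is constant inside and continuous up to the end points.\<close>

lemma weak_deriv_FTC:
  fixes u w :: "real \<Rightarrow> complex"
  assumes wd: "weak_deriv_on S u w" and S: "open S" and uS: "continuous_on S u"
    and ab: "a \<le> b" "{a<..<b} \<subseteq> S" and u: "continuous_on {a..b} u"
    and w: "set_integrable lebesgue {a..b} w"
  shows "u b - u a = integral {a..b} w"
proof (cases "a = b")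
  case False
  then have lt: "a < b" using ab by simp
  have wi: "w integrable_on {a..b}" using w by (rule set_lebesgue_integral_eq_integral)
  define F where "F t = u t - integral {a..t} w" for t
  have Fc: "continuous_on {a..b} F"
    unfolding F_def by (intro continuous_intros u indefinite_integral_continuous_1 wi)
  have eq: "F t = F ((a + b) / 2)" if t: "t \<in> {a<..<b}" for t
  proof -
    have *: "F s = F t" if st: "s < t" "s \<in> {a<..<b}" "t \<in> {a<..<b}" for s t
    proof -
      have "{s..t} \<subseteq> {a<..<b}" using st by auto
      then have "{s..t} \<subseteq> S" using ab(2) by blast
      then have "u t - u s = (LINT x:{s..t}|lebesgue. w x)"
        using weak_deriv_FTC_interior[OF wd S uS st(1)] by blast
      also have "\<dots> = integral {s..t} w"
        using st by (intro set_lebesgue_integral_eq_integral set_integrable_subset[OF w]) auto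
      finally have "u t - u s = integral {s..t} w" .
      moreover have "integral {a..s} w + integral {s..t} w = integral {a..t} w"
        using st by (intro Henstock_Kurzweil_Integration.integral_combine integrable_on_subinterval[OF wi]) auto
      ultimately show ?thesis by (simp add: F_def algebra_simps)
    qed
    have "(a + b) / 2 \<in> {a<..<b}" using lt by auto
    then show ?thesis using *[of t "(a + b) / 2"] *[of "(a + b) / 2" t] t by (metis linorder_neqE_linordered_idom)
  qed
  have cl: "closure {a<..<b} = {a..b}" using lt by (rule closure_greaterThanLessThan)
  have "F t = F ((a + b) / 2)" if "t \<in> {a..b}" for t
    using continuous_constant_on_closure[of "{a<..<b}" F "F ((a + b) / 2)" t] Fc eq that unfolding cl by blast
  then have "F a = F b" using ab(1) by (metis atLeastAtMost_iff order_refl)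
  then show ?thesis by (simp add: F_def algebra_simps)
qed simp

section \<open>The magnetic Sobolev space as a form space\<close>

text \<open>With the pointwise operations, functions on the graph form a real vector space.\<close>

instantiation "fun" :: (type, real_vector) real_vector
begin

definition scaleR_fun :: "real \<Rightarrow> ('a \<Rightarrow> 'b) \<Rightarrow> 'a \<Rightarrow> 'b" where
  "scaleR_fun r f = (\<lambda>x. r *\<^sub>R f x)"

instance
  by standard (auto simp: scaleR_fun_def fun_eq_iff scaleR_add_right scaleR_add_left)

end

lemma scaleR_apply [simp]: "(c *\<^sub>R v) e x = of_real c * v e x"
  for v :: "'e \<Rightarrow> real \<Rightarrow> complex"
  by (simp add: scaleR_fun_def scaleR_conv_of_real)

lemma set_integrable_lebesgue_on:
  "S \<in> sets lebesgue \<Longrightarrow> set_integrable lebesgue S f \<longleftrightarrow> integrable (lebesgue_on S) f"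
  for f :: "real \<Rightarrow> 'b::{banach, second_countable_topology}"
  by (simp add: set_integrable_def integrable_restrict_space)

lemma set_integral_lebesgue_on:
  "S \<in> sets lebesgue \<Longrightarrow> (LINT x:S|lebesgue. f x) = integral\<^sup>L (lebesgue_on S) f"
  for f :: "real \<Rightarrow> 'b::{banach, second_countable_topology}"
  by (simp add: set_lebesgue_integral_def integral_restrict_space)

lemma L2_on_iff:
  "S \<in> sets lebesgue \<Longrightarrow> L2_on S f \<longleftrightarrow>
    f \<in> borel_measurable (lebesgue_on S) \<and> integrable (lebesgue_on S) (\<lambda>x. (norm (f x))\<^sup>2)"
  for f :: "real \<Rightarrow> 'b::{banach, second_countable_topology}"
  by (simp add: L2_on_def set_borel_measurable_def set_integrable_lebesgue_on borel_measurable_restrict_space_iff)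

lemma borel_measurable_lebesgue_on_AE:
  fixes f g :: "real \<Rightarrow> 'b::euclidean_space"
  assumes S: "S \<in> sets lebesgue" and f: "f \<in> borel_measurable (lebesgue_on S)"
    and ae: "AE x in lebesgue_on S. f x = g x"
  shows "g \<in> borel_measurable (lebesgue_on S)"
proof -
  have "(\<lambda>x. indicator S x *\<^sub>R g x) \<in> borel_measurable lebesgue"
  proof (rule borel_measurable_AE)
    show "(\<lambda>x. indicator S x *\<^sub>R f x) \<in> borel_measurable lebesgue"
      using f S by (simp add: borel_measurable_restrict_space_iff)
    have "AE x in lebesgue. x \<in> S \<longrightarrow> f x = g x" using ae S by (simp add: AE_restrict_space_iff)
    then show "AE x in lebesgue. indicator S x *\<^sub>R f x = indicator S x *\<^sub>R g x"
      by eventually_elim (auto simp: indicator_def)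
  qed
  then show ?thesis using S by (simp add: borel_measurable_restrict_space_iff)
qed

definition square_integrable :: "'a measure \<Rightarrow> ('a \<Rightarrow> complex) \<Rightarrow> bool" where
  "square_integrable M f \<longleftrightarrow> f \<in> borel_measurable M \<and> integrable M (\<lambda>x. (norm (f x))\<^sup>2)"

lemma cmod_mult_le_squares: "cmod (a * b) \<le> (cmod a)\<^sup>2 + (cmod b)\<^sup>2"
  using sum_squares_bound[of "cmod a" "cmod b"] zero_le_power2[of "cmod a"] zero_le_power2[of "cmod b"]
  unfolding norm_mult by linarith

lemma cnj_borel_measurable [measurable]: "cnj \<in> borel_measurable borel"
  by (intro borel_measurable_continuous_onI continuous_intros)

lemma weighted_product_integrable:
  assumes "f \<in> borel_measurable M" "g \<in> borel_measurable M" "w \<in> borel_measurable M"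
    and w: "AE x in M. 0 \<le> w x"
    and int: "integrable M (\<lambda>x. w x * (cmod (f x))\<^sup>2)" "integrable M (\<lambda>x. w x * (cmod (g x))\<^sup>2)"
  shows "integrable M (\<lambda>x. complex_of_real (w x) * f x * cnj (g x))"
proof (rule Bochner_Integration.integrable_bound[OF Bochner_Integration.integrable_add[OF int]])
  show "(\<lambda>x. complex_of_real (w x) * f x * cnj (g x)) \<in> borel_measurable M"
    using assms(1-3) by measurable
  show "AE x in M. norm (complex_of_real (w x) * f x * cnj (g x))
      \<le> norm (w x * (cmod (f x))\<^sup>2 + w x * (cmod (g x))\<^sup>2)"
    using w
  proof eventually_elim
    case (elim x)
    have "w x * cmod (f x * cnj (g x)) \<le> w x * ((cmod (f x))\<^sup>2 + (cmod (g x))\<^sup>2)"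
      using cmod_mult_le_squares[of "f x" "cnj (g x)"] elim by (intro mult_left_mono) auto
    then show ?case using elim by (simp add: norm_mult algebra_simps)
  qed
qed

lemma square_integrable_product:
  assumes "square_integrable M f" "square_integrable M g"
  shows "integrable M (\<lambda>x. f x * cnj (g x))"
  using weighted_product_integrable[of f M g "\<lambda>_. 1"] assms by (simp add: square_integrable_def)

lemma norm_add_mult_sq_le: "(cmod (a + c * b))\<^sup>2 \<le> 2 * (cmod a)\<^sup>2 + 2 * (cmod c)\<^sup>2 * (cmod b)\<^sup>2"
proof -
  have "(cmod (a + c * b))\<^sup>2 \<le> (cmod a + cmod (c * b))\<^sup>2" by (intro power_mono norm_triangle_ineq) auto
  also have "\<dots> \<le> 2 * (cmod a)\<^sup>2 + 2 * (cmod (c * b))\<^sup>2"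
    using sum_squares_bound[of "cmod a" "cmod (c * b)"] by (simp add: power2_sum)
  finally show ?thesis by (simp add: norm_mult power_mult_distrib)
qed

lemma weighted_square_integrable_lin:
  assumes "f \<in> borel_measurable M" "g \<in> borel_measurable M" "w \<in> borel_measurable M"
    and w: "AE x in M. 0 \<le> w x"
    and int: "integrable M (\<lambda>x. w x * (cmod (f x))\<^sup>2)" "integrable M (\<lambda>x. w x * (cmod (g x))\<^sup>2)"
  shows "integrable M (\<lambda>x. w x * (cmod (f x + c * g x))\<^sup>2)"
proof (rule Bochner_Integration.integrable_bound)
  show "integrable M (\<lambda>x. 2 * (w x * (cmod (f x))\<^sup>2) + 2 * (cmod c)\<^sup>2 * (w x * (cmod (g x))\<^sup>2))"
    using int by simp
  show "(\<lambda>x. w x * (cmod (f x + c * g x))\<^sup>2) \<in> borel_measurable M"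
    using assms(1-3) by measurable
  show "AE x in M. norm (w x * (cmod (f x + c * g x))\<^sup>2)
      \<le> norm (2 * (w x * (cmod (f x))\<^sup>2) + 2 * (cmod c)\<^sup>2 * (w x * (cmod (g x))\<^sup>2))"
    using w
  proof eventually_elim
    case (elim x)
    have "w x * (cmod (f x + c * g x))\<^sup>2 \<le> w x * (2 * (cmod (f x))\<^sup>2 + 2 * (cmod c)\<^sup>2 * (cmod (g x))\<^sup>2)"
      using norm_add_mult_sq_le elim by (intro mult_left_mono) auto
    then show ?case using elim by (simp add: algebra_simps)
  qed
qed

lemma square_integrable_lin:
  assumes "square_integrable M f" "square_integrable M g"
  shows "square_integrable M (\<lambda>x. f x + c * g x)"
  using weighted_square_integrable_lin[of f M g "\<lambda>_. 1"] assms by (auto simp: square_integrable_def)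

locale magnetic_graph =
  fixes G :: "('v, 'e) metric_graph" and A V :: "'e \<Rightarrow> real \<Rightarrow> real"
  assumes fin: "finite_metric_graph G"
    and V1: "\<forall>e\<in>edges G. \<forall>x\<in>edge_dom G e. V e x \<ge> 1"
    and A_loc: "L2_loc G A" and V_loc: "L1_loc G V"
begin

abbreviation "H \<equiv> H1A G A V"
abbreviation "D \<equiv> mag_deriv G A"
abbreviation "leb e \<equiv> lebesgue_on (edge_dom G e)"
abbreviation "energy_form u v \<equiv> Re (mag_form G A V u v)"
abbreviation "mass_form u v \<equiv> Re (l2_inner G u v)"

lemma finite_edges [simp]: "finite (edges G)"
  using fin by (simp add: finite_metric_graph_def)

lemma bounded_edges_sub: "bounded_edges G \<subseteq> edges G"
  by (auto simp: bounded_edges_def)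

lemma finite_bounded_edges [simp]: "finite (bounded_edges G)"
  using finite_subset[OF bounded_edges_sub] by simp

lemma edge_dom_bounded:
  assumes "e \<in> bounded_edges G"
  obtains l where "l > 0" "edge_dom G e = {0..l}" "real_of_ereal (len G e) = l"
proof -
  have "0 < len G e" "len G e < \<infinity>"
    using assms fin by (auto simp: bounded_edges_def finite_metric_graph_def)
  then obtain l where l: "len G e = ereal l" "l > 0" by (cases "len G e") auto
  then have "edge_dom G e = {0..l}" by (auto simp: edge_dom_def)
  then show thesis using that[of l] l by simp
qed

lemma edge_dom_unbounded:
  "e \<in> edges G \<Longrightarrow> e \<notin> bounded_edges G \<Longrightarrow> edge_dom G e = {0..}"
  by (auto simp: bounded_edges_def edge_dom_def)

lemma edge_dom_cases:
  assumes "e \<in> edges G"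
  obtains l where "l > 0" "edge_dom G e = {0..l}" | "edge_dom G e = {0..}"
  using edge_dom_bounded edge_dom_unbounded assms by metis

lemma edge_dom_sets [simp]: "e \<in> edges G \<Longrightarrow> edge_dom G e \<in> sets lebesgue"
  by (erule edge_dom_cases) auto

lemma Ioo_interior: "{a..b} \<subseteq> edge_dom G e \<Longrightarrow> {a<..<b} \<subseteq> interior (edge_dom G e)"
  by (meson interior_maximal open_greaterThanLessThan greaterThanLessThan_subseteq_atLeastAtMost_iff
      order_refl order_trans less_imp_le)

lemma AE_interior:
  assumes "e \<in> edges G" shows "AE x in leb e. x \<in> interior (edge_dom G e)"
proof -
  have "edge_dom G e - interior (edge_dom G e) \<subseteq> frontier (edge_dom G e)"
    using closure_subset by (auto simp: frontier_def)
  moreover have "convex (edge_dom G e)"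
    using assms by (rule edge_dom_cases) auto
  then have "negligible (frontier (edge_dom G e))" by (rule negligible_convex_frontier)
  ultimately have "edge_dom G e - interior (edge_dom G e) \<in> null_sets lebesgue"
    using negligible_subset negligible_iff_null_sets by blast
  then have "AE x in lebesgue. x \<notin> edge_dom G e - interior (edge_dom G e)" by (rule AE_not_in)
  then have "AE x in lebesgue. x \<in> edge_dom G e \<longrightarrow> x \<in> interior (edge_dom G e)"
    by eventually_elim auto
  then show ?thesis using assms by (simp add: AE_restrict_space_iff)
qed

lemma graph_integral_eq:
  "F \<subseteq> edges G \<Longrightarrow> graph_integral G F f = (\<Sum>e\<in>F. integral\<^sup>L (leb e) (f e))"
  unfolding graph_integral_def by (intro sum.cong refl set_integral_lebesgue_on) auto

lemma graph_integrable_eq: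
  "F \<subseteq> edges G \<Longrightarrow> graph_integrable G F f \<longleftrightarrow> (\<forall>e\<in>F. integrable (leb e) (f e))"
  unfolding graph_integrable_def by (auto simp: set_integrable_lebesgue_on subset_iff)

lemma L2_eq: "u \<in> L2 G \<longleftrightarrow> (\<forall>e\<in>edges G. square_integrable (leb e) (u e))"
  by (auto simp: L2_def L2_on_iff square_integrable_def)

text \<open>Local integrability gives measurability on bounded pieces, which exhaust the edge.\<close>

lemma V_measurable [measurable]:
  assumes e: "e \<in> edges G" shows "V e \<in> borel_measurable (leb e)"
proof -
  have "(\<lambda>x. indicator (edge_dom G e) x *\<^sub>R V e x) \<in> borel_measurable lebesgue"
  proof (rule borel_measurable_LIMSEQ_metric)
    fix n :: nat
    have "edge_dom G e \<inter> {- real n..real n} \<in> sets lebesgue" using e by (intro sets.Int) auto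
    moreover have "bounded (edge_dom G e \<inter> {- real n..real n})" by (simp add: bounded_Int)
    ultimately have "set_integrable lebesgue (edge_dom G e \<inter> {- real n..real n}) (V e)"
      using V_loc e unfolding L1_loc_def by blast
    then show "(\<lambda>x. indicator (edge_dom G e \<inter> {- real n..real n}) x *\<^sub>R V e x) \<in> borel_measurable lebesgue"
      unfolding set_integrable_def by (rule borel_measurable_integrable)
  next
    fix x :: real
    obtain N where N: "\<bar>x\<bar> \<le> real N" using real_arch_simple by blast
    have "\<forall>\<^sub>F n in sequentially. indicator (edge_dom G e \<inter> {- real n..real n}) x *\<^sub>R V e x = indicator (edge_dom G e) x *\<^sub>R V e x"
      using eventually_ge_at_top[of N] by eventually_elim (use N in \<open>auto simp: indicator_def\<close>)
    then show "(\<lambda>n. indicator (edge_dom G e \<inter> {- real n..real n}) x *\<^sub>R V e x) \<longlonglongrightarrow> indicator (edge_dom G e) x *\<^sub>R V e x"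
      by (rule tendsto_eventually)
  qed
  then show ?thesis using e by (simp add: borel_measurable_restrict_space_iff)
qed

lemma V_nonneg: "e \<in> edges G \<Longrightarrow> AE x in leb e. 0 \<le> V e x"
  and V_ge_1: "e \<in> edges G \<Longrightarrow> AE x in leb e. 1 \<le> V e x"
  using V1 by (force intro!: AE_I2 simp: space_restrict_space)+


lemma H_continuous: "u \<in> H \<Longrightarrow> e \<in> edges G \<Longrightarrow> continuous_on (edge_dom G e) (u e)"
  by (simp add: H1A_def graph_continuous_def)

lemma continuous_measurable:
  fixes f :: "real \<Rightarrow> complex"
  shows "e \<in> edges G \<Longrightarrow> continuous_on (edge_dom G e) f \<Longrightarrow> f \<in> borel_measurable (leb e)"
  by (rule continuous_imp_measurable_on_sets_lebesgue) simp_all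

lemma H_measurable: "u \<in> H \<Longrightarrow> e \<in> edges G \<Longrightarrow> u e \<in> borel_measurable (leb e)"
  using continuous_measurable H_continuous by blast

lemma H_weak_deriv: "u \<in> H \<Longrightarrow> has_weak_deriv G u (weak_deriv G u)"
  unfolding weak_deriv_def using someI_ex[of "has_weak_deriv G u"] by (simp add: H1A_def)

lemma H_D: "u \<in> H \<Longrightarrow> e \<in> edges G \<Longrightarrow> square_integrable (leb e) (D u e)"
  by (simp add: H1A_def L2_eq)

lemma H_V: "u \<in> H \<Longrightarrow> e \<in> edges G \<Longrightarrow> integrable (leb e) (\<lambda>x. V e x * (cmod (u e x))\<^sup>2)"
  by (simp add: H1A_def graph_integrable_eq)

lemma H_square_integrable:
  assumes "u \<in> H" "e \<in> edges G" shows "square_integrable (leb e) (u e)"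
  unfolding square_integrable_def
proof
  show "integrable (leb e) (\<lambda>x. (cmod (u e x))\<^sup>2)"
  proof (rule Bochner_Integration.integrable_bound[OF H_V[OF assms]])
    show "AE x in leb e. norm ((cmod (u e x))\<^sup>2) \<le> norm (V e x * (cmod (u e x))\<^sup>2)"
      using V_ge_1[OF assms(2)]
    proof eventually_elim
      case (elim x)
      then have "1 * (cmod (u e x))\<^sup>2 \<le> V e x * (cmod (u e x))\<^sup>2" by (intro mult_right_mono) auto
      then show ?case by simp
    qed
  qed (use H_measurable[OF assms] in measurable)
qed (rule H_measurable[OF assms])

lemma H_L2: "u \<in> H \<Longrightarrow> u \<in> L2 G"
  by (simp add: L2_eq H_square_integrable)

lemma weak_deriv_formula: "weak_deriv G u e x = \<i> * (D u e x + of_real (A e x) * u e x)"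
  by (simp add: mag_deriv_def algebra_simps)

text \<open>Since \<^const>\<open>weak_deriv\<close> picks an arbitrary representative, linearity of the magnetic derivative
  and its behaviour under limits can only be stated almost everywhere.\<close>

lemma D_unique:
  assumes u: "\<And>e. e \<in> edges G \<Longrightarrow> continuous_on (edge_dom G e) (u e)" and w: "has_weak_deriv G u w"
    and e: "e \<in> edges G"
  shows "AE x in leb e. D u e x = (1 / \<i>) * w e x - of_real (A e x) * u e x"
proof -
  have "has_weak_deriv G u (weak_deriv G u)"
    unfolding weak_deriv_def using someI[of "has_weak_deriv G u", OF w] .
  then have "AE x in lebesgue. x \<in> interior (edge_dom G e) \<longrightarrow> weak_deriv G u e x = w e x"
    using w e continuous_on_subset[OF u[OF e] interior_subset] unfolding has_weak_deriv_def
    by (intro weak_deriv_unique[of _ "u e"]) simp_all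
  then have "AE x in lebesgue. x \<in> edge_dom G e \<longrightarrow> x \<in> interior (edge_dom G e) \<longrightarrow> weak_deriv G u e x = w e x"
    by eventually_elim simp
  then have "AE x in leb e. x \<in> interior (edge_dom G e) \<longrightarrow> weak_deriv G u e x = w e x"
    using e by (simp add: AE_restrict_space_iff)
  then show ?thesis using AE_interior[OF e] by eventually_elim (simp add: mag_deriv_def)
qed

lemma H_I:
  assumes gc: "graph_continuous G u" and w: "has_weak_deriv G u w"
    and g: "\<And>e. e \<in> edges G \<Longrightarrow> square_integrable (leb e) (g e)"
    and wg: "\<And>e. e \<in> edges G \<Longrightarrow> AE x in leb e. (1 / \<i>) * w e x - of_real (A e x) * u e x = g e x"
    and V: "\<And>e. e \<in> edges G \<Longrightarrow> integrable (leb e) (\<lambda>x. V e x * (cmod (u e x))\<^sup>2)"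
  shows "u \<in> H" "\<And>e. e \<in> edges G \<Longrightarrow> AE x in leb e. D u e x = g e x"
proof -
  show ae: "AE x in leb e. D u e x = g e x" if e: "e \<in> edges G" for e
    using D_unique[OF _ w e] wg[OF e] gc by (auto simp: graph_continuous_def)
  have "D u \<in> L2 G" unfolding L2_eq square_integrable_def
  proof (intro ballI conjI)
    fix e assume e: "e \<in> edges G"
    have ae': "AE x in leb e. g e x = D u e x" using ae[OF e] by eventually_elim simp
    show m: "D u e \<in> borel_measurable (leb e)"
      using g[OF e] by (intro borel_measurable_lebesgue_on_AE[OF edge_dom_sets[OF e] _ ae'])
        (simp add: square_integrable_def)
    show "integrable (leb e) (\<lambda>x. (cmod (D u e x))\<^sup>2)"
    proof (rule integrable_cong_AE_imp)
      show "integrable (leb e) (\<lambda>x. (cmod (g e x))\<^sup>2)" using g[OF e] by (simp add: square_integrable_def)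
      show "(\<lambda>x. (cmod (D u e x))\<^sup>2) \<in> borel_measurable (leb e)" using m by measurable
      show "AE x in leb e. (cmod (g e x))\<^sup>2 = (cmod (D u e x))\<^sup>2" using ae' by eventually_elim simp
    qed
  qed
  then show "u \<in> H" using gc w V by (auto simp: H1A_def graph_integrable_eq)
qed

lemma H_lin:
  assumes u: "u \<in> H" and v: "v \<in> H"
  shows "u + c *\<^sub>R v \<in> H"
    "\<And>e. e \<in> edges G \<Longrightarrow> AE x in leb e. D (u + c *\<^sub>R v) e x = D u e x + of_real c * D v e x"
proof -
  have fe: "(u + c *\<^sub>R v) e = (\<lambda>x. u e x + of_real c * v e x)" for e by (simp add: fun_eq_iff scaleR_apply)
  obtain wu wv where w: "\<forall>e\<in>edges G. u e 0 = wu (src G e)"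
      "\<forall>e\<in>bounded_edges G. u e (real_of_ereal (len G e)) = wu (tgt G e)"
      "\<forall>e\<in>edges G. v e 0 = wv (src G e)"
      "\<forall>e\<in>bounded_edges G. v e (real_of_ereal (len G e)) = wv (tgt G e)"
    using u v unfolding H1A_def graph_continuous_def by blast
  have gc: "graph_continuous G (u + c *\<^sub>R v)"
    unfolding graph_continuous_def fe using w H_continuous[OF u] H_continuous[OF v]
    by (intro conjI ballI continuous_intros exI[of _ "\<lambda>x. wu x + of_real c * wv x"]) auto
  have hw: "has_weak_deriv G (u + c *\<^sub>R v) (\<lambda>e x. weak_deriv G u e x + of_real c * weak_deriv G v e x)"
    using H_weak_deriv[OF u] H_weak_deriv[OF v] unfolding has_weak_deriv_def fe
    by (intro ballI weak_deriv_on_lin) auto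
  note HI = H_I[OF gc hw, of "\<lambda>e x. D u e x + of_real c * D v e x"]
  have *: "square_integrable (leb e) (\<lambda>x. D u e x + of_real c * D v e x)"
    "AE x in leb e. (1 / \<i>) * (weak_deriv G u e x + of_real c * weak_deriv G v e x) - of_real (A e x) * (u + c *\<^sub>R v) e x = D u e x + of_real c * D v e x"
    "integrable (leb e) (\<lambda>x. V e x * (cmod ((u + c *\<^sub>R v) e x))\<^sup>2)" if e: "e \<in> edges G" for e
    using square_integrable_lin[OF H_D[OF u e] H_D[OF v e]]
      weighted_square_integrable_lin[OF H_measurable[OF u e] H_measurable[OF v e] V_measurable[OF e] V_nonneg[OF e] H_V[OF u e] H_V[OF v e]]
    by (simp_all add: scaleR_apply weak_deriv_formula fe distrib_left add_divide_distrib) (simp add: algebra_simps)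
  show "u + c *\<^sub>R v \<in> H" "\<And>e. e \<in> edges G \<Longrightarrow> AE x in leb e. D (u + c *\<^sub>R v) e x = D u e x + of_real c * D v e x"
    using HI * by blast+
qed

lemma H_zero: "(0 :: 'e \<Rightarrow> real \<Rightarrow> complex) \<in> H"
proof -
  have "has_weak_deriv G 0 (\<lambda>e x. 0)"
    unfolding has_weak_deriv_def weak_deriv_on_def
    by (auto simp: set_integrable_def set_lebesgue_integral_def)
  moreover have "graph_continuous G 0" unfolding graph_continuous_def by auto
  ultimately show ?thesis
    by (intro H_I(1)[of 0 "\<lambda>e x. 0" "\<lambda>e x. 0"]) (auto simp: square_integrable_def)
qed

lemma subspace_H: "subspace H"
proof (rule subspaceI)
  show "0 \<in> H" by (rule H_zero)
  show "x + y \<in> H" if "x \<in> H" "y \<in> H" for x y using H_lin(1)[OF that, of 1] by simp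
  show "c *\<^sub>R x \<in> H" if "x \<in> H" for c x using H_lin(1)[OF H_zero that, of c] by simp
qed


lemma form_integrand_integrable:
  assumes u: "u \<in> H" and v: "v \<in> H" and e: "e \<in> edges G"
  shows "integrable (leb e) (\<lambda>x. D u e x * cnj (D v e x))"
    "integrable (leb e) (\<lambda>x. of_real (V e x) * u e x * cnj (v e x))"
    "integrable (leb e) (\<lambda>x. u e x * cnj (v e x))"
  using square_integrable_product[OF H_D[OF u e] H_D[OF v e]]
    square_integrable_product[OF H_square_integrable[OF u e] H_square_integrable[OF v e]]
    weighted_product_integrable[OF H_measurable[OF u e] H_measurable[OF v e] V_measurable[OF e] V_nonneg[OF e] H_V[OF u e] H_V[OF v e]]
  by auto

lemma mag_form_eq:
  "mag_form G A V u v = (\<Sum>e\<in>edges G. integral\<^sup>L (leb e) (\<lambda>x. D u e x * cnj (D v e x) + of_real (V e x) * u e x * cnj (v e x)))"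
  by (simp add: mag_form_def graph_integral_eq)

lemma l2_inner_eq:
  "l2_inner G u v = (\<Sum>e\<in>edges G. integral\<^sup>L (leb e) (\<lambda>x. u e x * cnj (v e x)))"
  by (simp add: l2_inner_def graph_integral_eq)

lemma mag_form_lin:
  assumes "u \<in> H" "v \<in> H" "w \<in> H"
  shows "mag_form G A V (u + c *\<^sub>R v) w = mag_form G A V u w + of_real c * mag_form G A V v w"
  unfolding mag_form_eq sum_distrib_left sum.distrib[symmetric]
proof (rule sum.cong[OF refl])
  fix e assume e: "e \<in> edges G"
  note I = form_integrand_integrable[OF _ _ e]
  have i: "integrable (leb e) (\<lambda>x. D u e x * cnj (D w e x) + of_real (V e x) * u e x * cnj (w e x))"
    "integrable (leb e) (\<lambda>x. D v e x * cnj (D w e x) + of_real (V e x) * v e x * cnj (w e x))"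
    using I(1,2) assms by auto
  have i2: "integrable (leb e) (\<lambda>x. of_real c * (D v e x * cnj (D w e x) + of_real (V e x) * v e x * cnj (w e x)))"
    by (intro integrable_mult_right i(2))
  have "integral\<^sup>L (leb e) (\<lambda>x. D (u + c *\<^sub>R v) e x * cnj (D w e x) + of_real (V e x) * (u + c *\<^sub>R v) e x * cnj (w e x))
      = integral\<^sup>L (leb e) (\<lambda>x. (D u e x * cnj (D w e x) + of_real (V e x) * u e x * cnj (w e x))
          + of_real c * (D v e x * cnj (D w e x) + of_real (V e x) * v e x * cnj (w e x)))"
  proof (rule integral_cong_AE)
    show "AE x in leb e. D (u + c *\<^sub>R v) e x * cnj (D w e x) + of_real (V e x) * (u + c *\<^sub>R v) e x * cnj (w e x)
        = (D u e x * cnj (D w e x) + of_real (V e x) * u e x * cnj (w e x))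
          + of_real c * (D v e x * cnj (D w e x) + of_real (V e x) * v e x * cnj (w e x))"
      using H_lin(2)[OF assms(1,2) e, of c] by eventually_elim (simp add: scaleR_apply algebra_simps)
    show "(\<lambda>x. D (u + c *\<^sub>R v) e x * cnj (D w e x) + of_real (V e x) * (u + c *\<^sub>R v) e x * cnj (w e x)) \<in> borel_measurable (leb e)"
      using borel_measurable_integrable[OF Bochner_Integration.integrable_add[OF I(1,2)[OF H_lin(1)[OF assms(1,2), of c] assms(3)]]] .
    show "(\<lambda>x. (D u e x * cnj (D w e x) + of_real (V e x) * u e x * cnj (w e x))
          + of_real c * (D v e x * cnj (D w e x) + of_real (V e x) * v e x * cnj (w e x))) \<in> borel_measurable (leb e)"
      by (rule borel_measurable_integrable[OF Bochner_Integration.integrable_add[OF i(1) i2]])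
  qed
  also have "\<dots> = integral\<^sup>L (leb e) (\<lambda>x. D u e x * cnj (D w e x) + of_real (V e x) * u e x * cnj (w e x))
      + of_real c * integral\<^sup>L (leb e) (\<lambda>x. D v e x * cnj (D w e x) + of_real (V e x) * v e x * cnj (w e x))"
    by (subst Bochner_Integration.integral_add[OF i(1) i2]) (simp only: integral_mult_right_zero)
  finally show "integral\<^sup>L (leb e) (\<lambda>x. D (u + c *\<^sub>R v) e x * cnj (D w e x) + of_real (V e x) * (u + c *\<^sub>R v) e x * cnj (w e x))
      = integral\<^sup>L (leb e) (\<lambda>x. D u e x * cnj (D w e x) + of_real (V e x) * u e x * cnj (w e x))
      + of_real c * integral\<^sup>L (leb e) (\<lambda>x. D v e x * cnj (D w e x) + of_real (V e x) * v e x * cnj (w e x))" .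
qed

lemma l2_inner_lin:
  assumes "u \<in> L2 G" "v \<in> L2 G" "w \<in> L2 G"
  shows "l2_inner G (u + c *\<^sub>R v) w = l2_inner G u w + of_real c * l2_inner G v w"
  unfolding l2_inner_eq sum_distrib_left sum.distrib[symmetric]
proof (rule sum.cong[OF refl])
  fix e assume e: "e \<in> edges G"
  have i: "integrable (leb e) (\<lambda>x. u e x * cnj (w e x))" "integrable (leb e) (\<lambda>x. v e x * cnj (w e x))"
    using assms e by (auto intro!: square_integrable_product simp: L2_eq)
  have "(\<lambda>x. (u + c *\<^sub>R v) e x * cnj (w e x)) = (\<lambda>x. u e x * cnj (w e x) + of_real c * (v e x * cnj (w e x)))"
    by (simp add: fun_eq_iff scaleR_apply algebra_simps)
  then show "integral\<^sup>L (leb e) (\<lambda>x. (u + c *\<^sub>R v) e x * cnj (w e x))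
      = integral\<^sup>L (leb e) (\<lambda>x. u e x * cnj (w e x)) + of_real c * integral\<^sup>L (leb e) (\<lambda>x. v e x * cnj (w e x))"
    using i by simp
qed

lemma mag_form_cnj: "mag_form G A V v u = cnj (mag_form G A V u v)"
  unfolding mag_form_eq cnj_sum Bochner_Integration.integral_cnj[symmetric]
  by (simp add: mult_ac del: Bochner_Integration.integral_cnj)

lemma l2_inner_cnj: "l2_inner G v u = cnj (l2_inner G u v)"
  unfolding l2_inner_eq cnj_sum Bochner_Integration.integral_cnj[symmetric]
  by (simp add: mult_ac del: Bochner_Integration.integral_cnj)

lemma mag_form_self: "mag_form G A V u u = of_real (mag_normsq G A V u)"
proof -
  have "D u e x * cnj (D u e x) + of_real (V e x) * u e x * cnj (u e x)
     = of_real ((cmod (D u e x))\<^sup>2 + V e x * (cmod (u e x))\<^sup>2)" for e x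
    by (simp only: of_real_add of_real_mult complex_norm_square mult.assoc)
  then show ?thesis
    by (simp only: mag_form_eq mag_normsq_def graph_integral_eq order_refl of_real_sum integral_complex_of_real)
qed

lemma l2_inner_self: "l2_inner G u u = of_real (l2_normsq G u)"
proof -
  have "u e x * cnj (u e x) = of_real ((cmod (u e x))\<^sup>2)" for e x
    by (simp only: complex_norm_square)
  then show ?thesis
    by (simp only: l2_inner_eq l2_normsq_def graph_integral_eq order_refl of_real_sum integral_complex_of_real)
qed

lemma l2_normsq_nonneg: "0 \<le> l2_normsq G u"
  by (auto simp: l2_normsq_def graph_integral_eq intro!: sum_nonneg)

lemma edge_energy_le:
  assumes u: "u \<in> H" and e: "e \<in> edges G"
  shows "(\<integral>x. (cmod (D u e x))\<^sup>2 + V e x * (cmod (u e x))\<^sup>2 \<partial>leb e) \<le> mag_normsq G A V u"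
proof -
  have "0 \<le> (\<integral>x. (cmod (D u e x))\<^sup>2 + V e x * (cmod (u e x))\<^sup>2 \<partial>leb e)" if "e \<in> edges G" for e
    using V_nonneg[OF that] by (intro integral_nonneg_AE) (auto elim!: AE_mp)
  then show ?thesis
    unfolding mag_normsq_def graph_integral_eq[OF order_refl] using e
    by (intro member_le_sum) auto
qed

lemma edge_D_le:
  assumes u: "u \<in> H" and e: "e \<in> edges G"
  shows "(\<integral>x. (cmod (D u e x))\<^sup>2 \<partial>leb e) \<le> mag_normsq G A V u"
proof -
  have "(\<integral>x. (cmod (D u e x))\<^sup>2 \<partial>leb e) \<le> (\<integral>x. (cmod (D u e x))\<^sup>2 + V e x * (cmod (u e x))\<^sup>2 \<partial>leb e)"
    using H_D[OF u e] H_V[OF u e] V_nonneg[OF e] by (intro integral_mono_AE) (auto simp: square_integrable_def)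
  then show ?thesis using edge_energy_le[OF assms] by simp
qed

lemma edge_V_le:
  assumes u: "u \<in> H" and e: "e \<in> edges G"
  shows "(\<integral>x. V e x * (cmod (u e x))\<^sup>2 \<partial>leb e) \<le> mag_normsq G A V u"
proof -
  have "(\<integral>x. V e x * (cmod (u e x))\<^sup>2 \<partial>leb e) \<le> (\<integral>x. (cmod (D u e x))\<^sup>2 + V e x * (cmod (u e x))\<^sup>2 \<partial>leb e)"
    using H_D[OF u e] H_V[OF u e] by (intro integral_mono_AE) (auto simp: square_integrable_def)
  then show ?thesis using edge_energy_le[OF assms] by simp
qed

lemma l2_le_mag:
  assumes u: "u \<in> H" shows "l2_normsq G u \<le> mag_normsq G A V u"
  unfolding mag_normsq_def l2_normsq_def graph_integral_eq[OF order_refl]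
proof (rule sum_mono)
  fix e assume e: "e \<in> edges G"
  show "(\<integral>x. (cmod (u e x))\<^sup>2 \<partial>leb e) \<le> (\<integral>x. (cmod (D u e x))\<^sup>2 + V e x * (cmod (u e x))\<^sup>2 \<partial>leb e)"
  proof (rule integral_mono_AE)
    show "AE x in leb e. (cmod (u e x))\<^sup>2 \<le> (cmod (D u e x))\<^sup>2 + V e x * (cmod (u e x))\<^sup>2"
      using V_ge_1[OF e]
    proof eventually_elim
      case (elim x)
      then have "1 * (cmod (u e x))\<^sup>2 \<le> V e x * (cmod (u e x))\<^sup>2" by (intro mult_right_mono) auto
      then show ?case using zero_le_power2[of "cmod (D u e x)"] by linarith
    qed
  qed (use H_D[OF u e] H_V[OF u e] H_square_integrable[OF u e] in \<open>auto simp: square_integrable_def\<close>)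
qed

sublocale form_space H energy_form mass_form
proof
  show "subspace H" by (rule subspace_H)
  show "energy_form u v = energy_form v u" for u v using mag_form_cnj[of v u] by simp
  show "mass_form u v = mass_form v u" for u v using l2_inner_cnj[of v u] by simp
  show "energy_form (u + c *\<^sub>R v) w = energy_form u w + c * energy_form v w" if "u \<in> H" "v \<in> H" "w \<in> H" for u v w c
    using mag_form_lin[OF that, of c] by simp
  show "mass_form (u + c *\<^sub>R v) w = mass_form u w + c * mass_form v w" if "u \<in> H" "v \<in> H" "w \<in> H" for u v w c
    using l2_inner_lin[of u v w c] H_L2 that by simp
  show "0 \<le> mass_form u u" for u using l2_normsq_nonneg by (simp add: l2_inner_self)
  show "mass_form u u \<le> energy_form u u" if "u \<in> H" for u using l2_le_mag[OF that] by (simp add: l2_inner_self mag_form_self)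
qed

end

section \<open>Local bounds and equicontinuity\<close>

lemma L2_imp_L1_Icc:
  fixes f :: "real \<Rightarrow> 'b::{banach, second_countable_topology}"
  assumes "f \<in> borel_measurable (lebesgue_on {a..b})" "integrable (lebesgue_on {a..b}) (\<lambda>x. (norm (f x))\<^sup>2)"
  shows "set_integrable lebesgue {a..b} f"
proof -
  interpret finite_measure "lebesgue_on {a..b}" by (rule finite_measure_lebesgue_on) simp
  have "integrable (lebesgue_on {a..b}) f"
  proof (rule Bochner_Integration.integrable_bound)
    show "integrable (lebesgue_on {a..b}) (\<lambda>x. 1 + (norm (f x))\<^sup>2)" using assms(2) by simp
    show "AE x in lebesgue_on {a..b}. norm (f x) \<le> norm (1 + (norm (f x))\<^sup>2)"
    proof (rule AE_I2)
      fix x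
      have "norm (f x) \<le> 1 + (norm (f x))\<^sup>2"
        using sum_squares_bound[of "norm (f x)" 1] norm_ge_zero[of "f x"]
        unfolding power_one mult_1_right by linarith
      then show "norm (f x) \<le> norm (1 + (norm (f x))\<^sup>2)" by simp
    qed
  qed (rule assms)
  then show ?thesis by (simp add: set_integrable_lebesgue_on)
qed

text \<open>Integrating \<open>|f| \<le> \<eta> + |f|\<^sup>2 / \<eta>\<close> for small \<open>\<eta>\<close>.\<close>

lemma L1_tendsto_0_if_L2:
  fixes f :: "nat \<Rightarrow> 'a \<Rightarrow> complex"
  assumes M: "finite_measure M" and f: "\<And>n. f n \<in> borel_measurable M" "\<And>n. integrable M (\<lambda>x. (norm (f n x))\<^sup>2)"
    and lim: "(\<lambda>n. \<integral>x. (norm (f n x))\<^sup>2 \<partial>M) \<longlonglongrightarrow> 0"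
  shows "(\<lambda>n. \<integral>x. norm (f n x) \<partial>M) \<longlonglongrightarrow> 0"
proof (rule LIMSEQ_I)
  interpret finite_measure M by (rule M)
  fix e :: real assume e: "e > 0"
  define m where "m = measure M (space M)"
  define \<eta> where "\<eta> = e / (2 * (m + 1))"
  have m: "m \<ge> 0" by (simp add: m_def)
  have \<eta>: "\<eta> > 0" "\<eta> * m \<le> e / 2" using e m by (auto simp: \<eta>_def field_simps)
  have "(\<lambda>n. (\<integral>x. (norm (f n x))\<^sup>2 \<partial>M) / \<eta>) \<longlonglongrightarrow> 0 / \<eta>" using lim \<eta> by (intro tendsto_intros) auto
  then have "\<forall>\<^sub>F n in sequentially. (\<integral>x. (norm (f n x))\<^sup>2 \<partial>M) / \<eta> < e / 2"
    using e by (intro order_tendstoD) auto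
  then obtain N where N: "\<And>n. n \<ge> N \<Longrightarrow> (\<integral>x. (norm (f n x))\<^sup>2 \<partial>M) / \<eta> < e / 2"
    by (auto simp: eventually_sequentially)
  have "norm ((\<integral>x. norm (f n x) \<partial>M) - 0) < e" if "n \<ge> N" for n
  proof -
    have le: "norm (f n x) \<le> \<eta> + (norm (f n x))\<^sup>2 / \<eta>" for x
    proof (cases "norm (f n x) \<le> \<eta>")
      case False
      then have "norm (f n x) * \<eta> \<le> norm (f n x) * norm (f n x)" by (intro mult_left_mono) auto
      then have "norm (f n x) \<le> (norm (f n x))\<^sup>2 / \<eta>" using \<eta> by (simp add: field_simps power2_eq_square)
      then show ?thesis using \<eta> by linarith
    qed (use \<eta> in \<open>simp add: add_increasing2\<close>)
    have "(\<integral>x. norm (f n x) \<partial>M) \<le> (\<integral>x. \<eta> + (norm (f n x))\<^sup>2 / \<eta> \<partial>M)"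
    proof (rule integral_mono')
      show "integrable M (\<lambda>x. \<eta> + (norm (f n x))\<^sup>2 / \<eta>)" using f(2) by auto
      show "0 \<le> \<eta> + (norm (f n x))\<^sup>2 / \<eta>" for x using \<eta> by simp
    qed (rule le)
    also have "\<dots> = \<eta> * m + (\<integral>x. (norm (f n x))\<^sup>2 \<partial>M) / \<eta>" using f(2)[of n] by (simp add: m_def)
    finally have "(\<integral>x. norm (f n x) \<partial>M) < e" using N[OF that] \<eta>(2) by linarith
    moreover have "(\<integral>x. norm (f n x) \<partial>M) \<ge> 0" by simp
    ultimately show ?thesis by simp
  qed
  then show "\<exists>no. \<forall>n\<ge>no. norm ((\<integral>x. norm (f n x) \<partial>M) - 0) < e" by blast
qed

lemma test_function_integral_tendsto:
  fixes v :: "real \<Rightarrow> complex"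
  assumes \<phi>: "\<phi> \<in> test_functions S" and S: "S \<in> sets lebesgue"
    and u: "\<And>n K. compact K \<Longrightarrow> K \<subseteq> S \<Longrightarrow> set_integrable lebesgue K (u n)"
    and v: "\<And>K. compact K \<Longrightarrow> K \<subseteq> S \<Longrightarrow> set_integrable lebesgue K v"
    and lim: "\<And>K. compact K \<Longrightarrow> K \<subseteq> S \<Longrightarrow> (\<lambda>n. LINT x:K|lebesgue. norm (u n x - v x)) \<longlonglongrightarrow> 0"
  shows "(\<lambda>n. LINT x:S|lebesgue. u n x * of_real (\<phi> x)) \<longlonglongrightarrow> (LINT x:S|lebesgue. v x * of_real (\<phi> x))"
proof -
  have sm: "smooth \<phi>" using \<phi> by (simp add: test_functions_def smooth_def)
  obtain K where K: "compact K" "K \<subseteq> S" "\<And>x. x \<notin> K \<Longrightarrow> \<phi> x = 0"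
    using \<phi> unfolding test_functions_def by blast
  have "continuous_on K \<phi>"
    using DERIV_isCont[OF smooth_has_deriv[OF sm]] by (intro continuous_at_imp_continuous_on) auto
  then have "bounded (\<phi> ` K)" using K(1) by (intro compact_imp_bounded compact_continuous_image)
  then obtain C where C: "\<And>x. x \<in> K \<Longrightarrow> norm (\<phi> x) \<le> C" unfolding bounded_iff by blast
  have Ks: "K \<in> sets lebesgue" using K(1) lmeasurable_compact by blast
  have bound: "norm ((LINT x:S|lebesgue. u n x * of_real (\<phi> x)) - (LINT x:S|lebesgue. v x * of_real (\<phi> x)))
      \<le> C * (LINT x:K|lebesgue. norm (u n x - v x))" for n
  proof -
    note I = test_function_product[OF \<phi> u] test_function_product[OF \<phi> v]
    have uv: "set_integrable lebesgue K (\<lambda>x. u n x - v x)" using u v K by (intro set_integral_diff) auto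
    have eq: "(LINT x:S|lebesgue. u n x * of_real (\<phi> x)) - (LINT x:S|lebesgue. v x * of_real (\<phi> x))
        = (LINT x:S|lebesgue. (u n x - v x) * of_real (\<phi> x))"
      using I by (subst set_integral_diff(2)[symmetric]) (auto simp: left_diff_distrib)
    have "norm (LINT x:S|lebesgue. (u n x - v x) * of_real (\<phi> x)) \<le> (LINT x|lebesgue. C * (indicator K x *\<^sub>R norm (u n x - v x)))"
      unfolding set_lebesgue_integral_def
    proof (rule Bochner_Integration.integral_norm_bound_integral)
      have "set_integrable lebesgue S (\<lambda>x. u n x * of_real (\<phi> x) - v x * of_real (\<phi> x))"
        using I by (intro set_integral_diff) auto
      then show "integrable lebesgue (\<lambda>x. indicator S x *\<^sub>R ((u n x - v x) * of_real (\<phi> x)))"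
        by (simp add: set_integrable_def left_diff_distrib)
      show "integrable lebesgue (\<lambda>x. C * (indicator K x *\<^sub>R norm (u n x - v x)))"
        using set_integrable_norm[OF uv] unfolding set_integrable_def by (rule integrable_mult_right)
      fix x
      show "norm (indicator S x *\<^sub>R ((u n x - v x) * of_real (\<phi> x))) \<le> C * (indicator K x *\<^sub>R norm (u n x - v x))"
      proof (cases "x \<in> K")
        case True
        then have "norm (u n x - v x) * \<bar>\<phi> x\<bar> \<le> norm (u n x - v x) * C" using C[OF True] by (intro mult_left_mono) auto
        then show ?thesis using True K(2) by (auto simp: norm_mult mult.commute)
      qed (use K(3) in simp)
    qed
    then show ?thesis unfolding eq by (simp add: set_lebesgue_integral_def)
  qed
  have "(\<lambda>n. C * (LINT x:K|lebesgue. norm (u n x - v x))) \<longlonglongrightarrow> C * 0"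
    using lim[OF K(1,2)] by (intro tendsto_mult_left)
  then have "(\<lambda>n. C * (LINT x:K|lebesgue. norm (u n x - v x))) \<longlonglongrightarrow> 0" by simp
  then have "(\<lambda>n. (LINT x:S|lebesgue. u n x * of_real (\<phi> x)) - (LINT x:S|lebesgue. v x * of_real (\<phi> x))) \<longlonglongrightarrow> 0"
    by (rule Lim_null_comparison[rotated]) (auto intro!: always_eventually bound)
  then show ?thesis by (simp add: LIM_zero_iff)
qed

lemma weak_deriv_on_limit:
  assumes wd: "\<And>n. weak_deriv_on S (u n) (w n)" and S: "S \<in> sets lebesgue"
    and v: "\<And>K. compact K \<Longrightarrow> K \<subseteq> S \<Longrightarrow> set_integrable lebesgue K v"
    and z: "\<And>K. compact K \<Longrightarrow> K \<subseteq> S \<Longrightarrow> set_integrable lebesgue K z"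
    and limu: "\<And>K. compact K \<Longrightarrow> K \<subseteq> S \<Longrightarrow> (\<lambda>n. LINT x:K|lebesgue. norm (u n x - v x)) \<longlonglongrightarrow> 0"
    and limw: "\<And>K. compact K \<Longrightarrow> K \<subseteq> S \<Longrightarrow> (\<lambda>n. LINT x:K|lebesgue. norm (w n x - z x)) \<longlonglongrightarrow> 0"
  shows "weak_deriv_on S v z"
  unfolding weak_deriv_on_def
proof (intro conjI allI impI ballI)
  fix \<phi> assume \<phi>: "\<phi> \<in> test_functions S"
  have int: "set_integrable lebesgue K (u n)" "set_integrable lebesgue K (w n)" if "compact K" "K \<subseteq> S" for n K
    using wd that unfolding weak_deriv_on_def by blast+
  have eq: "(LINT x:S|lebesgue. u n x * of_real (deriv \<phi> x)) = - (LINT x:S|lebesgue. w n x * of_real (\<phi> x))" for n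
    using wd \<phi> unfolding weak_deriv_on_def by blast
  have "(\<lambda>n. LINT x:S|lebesgue. u n x * of_real (deriv \<phi> x)) \<longlonglongrightarrow> (LINT x:S|lebesgue. v x * of_real (deriv \<phi> x))"
    using int v limu by (intro test_function_integral_tendsto[OF test_functions_deriv[OF \<phi>] S]) auto
  moreover have "(\<lambda>n. LINT x:S|lebesgue. w n x * of_real (\<phi> x)) \<longlonglongrightarrow> (LINT x:S|lebesgue. z x * of_real (\<phi> x))"
    using int z limw by (intro test_function_integral_tendsto[OF \<phi> S]) auto
  ultimately show "(LINT x:S|lebesgue. v x * of_real (deriv \<phi> x)) = - (LINT x:S|lebesgue. z x * of_real (\<phi> x))"
    unfolding eq using LIMSEQ_unique tendsto_minus by blast
qed (use v z in auto)

context magnetic_graph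
begin

lemma square_integrable_Icc:
  assumes f: "square_integrable (leb e) f" and e: "e \<in> edges G" and ab: "{a..b} \<subseteq> edge_dom G e"
  shows "f absolutely_integrable_on {a..b}" "(\<lambda>x. (cmod (f x))\<^sup>2) absolutely_integrable_on {a..b}"
    "integral {a..b} (\<lambda>x. (cmod (f x))\<^sup>2) \<le> (\<integral>x. (cmod (f x))\<^sup>2 \<partial>leb e)"
proof -
  have S: "(\<lambda>x. (cmod (f x))\<^sup>2) absolutely_integrable_on edge_dom G e"
    using f e by (simp add: square_integrable_def set_integrable_lebesgue_on)
  show sq: "(\<lambda>x. (cmod (f x))\<^sup>2) absolutely_integrable_on {a..b}"
    using set_integrable_subset[OF S _ ab] by simp
  show "f absolutely_integrable_on {a..b}"
  proof (rule L2_imp_L1_Icc)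
    show "f \<in> borel_measurable (lebesgue_on {a..b})"
      using f measurable_restrict_mono[OF _ ab] by (auto simp: square_integrable_def)
    show "integrable (lebesgue_on {a..b}) (\<lambda>x. (cmod (f x))\<^sup>2)"
      using sq by (simp add: set_integrable_lebesgue_on)
  qed
  have "integral {a..b} (\<lambda>x. (cmod (f x))\<^sup>2) \<le> integral (edge_dom G e) (\<lambda>x. (cmod (f x))\<^sup>2)"
    using S sq ab by (intro integral_subset_le set_lebesgue_integral_eq_integral(1)) auto
  then show "integral {a..b} (\<lambda>x. (cmod (f x))\<^sup>2) \<le> (\<integral>x. (cmod (f x))\<^sup>2 \<partial>leb e)"
    using set_lebesgue_integral_eq_integral(2)[OF S] e by (simp add: set_integral_lebesgue_on)
qed

lemma A_Icc:
  assumes "e \<in> edges G" "{a..b} \<subseteq> edge_dom G e"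
  shows "A e absolutely_integrable_on {a..b}"
proof -
  have "L2_on {a..b} (A e)" using A_loc assms unfolding L2_loc_def by (auto simp: bounded_closed_interval)
  then show ?thesis by (intro L2_imp_L1_Icc) (auto simp: L2_on_iff)
qed

lemma A_times_continuous:
  assumes e: "e \<in> edges G" "{a..b} \<subseteq> edge_dom G e" and f: "continuous_on {a..b} f"
  shows "(\<lambda>x. of_real (A e x) * f x :: complex) absolutely_integrable_on {a..b}"
proof -
  have "bounded (f ` {a..b})" using f by (intro compact_imp_bounded compact_continuous_image) auto
  then obtain M where M: "\<And>x. x \<in> {a..b} \<Longrightarrow> cmod (f x) \<le> M" unfolding bounded_iff by blast
  have A: "integrable (lebesgue_on {a..b}) (A e)"
    using A_Icc[OF e] by (simp add: set_integrable_lebesgue_on)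
  have "integrable (lebesgue_on {a..b}) (\<lambda>x. of_real (A e x) * f x)"
  proof (rule Bochner_Integration.integrable_bound)
    show "integrable (lebesgue_on {a..b}) (\<lambda>x. M * A e x)" using A by simp
    have "f \<in> borel_measurable (lebesgue_on {a..b})"
      using f by (intro continuous_imp_measurable_on_sets_lebesgue) auto
    then show "(\<lambda>x. of_real (A e x) * f x) \<in> borel_measurable (lebesgue_on {a..b})"
      using borel_measurable_integrable[OF A] by measurable
    show "AE x in lebesgue_on {a..b}. norm (of_real (A e x) * f x) \<le> norm (M * A e x)"
    proof (rule AE_I2)
      fix x assume "x \<in> space (lebesgue_on {a..b})"
      then have "cmod (f x) \<le> M" using M by simp
      then have "\<bar>A e x\<bar> * cmod (f x) \<le> \<bar>A e x\<bar> * \<bar>M\<bar>" by (intro mult_left_mono) auto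
      then show "norm (of_real (A e x) * f x) \<le> norm (M * A e x)" by (simp add: norm_mult abs_mult mult.commute)
    qed
  qed
  then show ?thesis by (simp add: set_integrable_lebesgue_on)
qed

text \<open>The weak derivative of \<open>u\<close> is \<open>i (D u + A u)\<close>; the first term is estimated by
  \<open>t \<le> \<eta> t\<^sup>2 + 1 / \<eta>\<close>.\<close>

lemma edge_increment:
  assumes u: "u \<in> H" and e: "e \<in> edges G" and ab: "a \<le> b" "{a..b} \<subseteq> edge_dom G e"
    and M: "\<And>x. x \<in> {a..b} \<Longrightarrow> cmod (u e x) \<le> M" and \<eta>: "\<eta> > 0"
  shows "cmod (u e b - u e a) \<le> \<eta> * mag_normsq G A V u + (b - a) / \<eta> + M * integral {a..b} (\<lambda>x. \<bar>A e x\<bar>)"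
proof -
  have cont: "continuous_on {a..b} (u e)" using H_continuous[OF u e] ab(2) continuous_on_subset by blast
  note DI = square_integrable_Icc[OF H_D[OF u e] e ab(2)]
  have Au: "(\<lambda>x. of_real (A e x) * u e x) absolutely_integrable_on {a..b}"
    by (rule A_times_continuous[OF e ab(2) cont])
  have wI: "weak_deriv G u e absolutely_integrable_on {a..b}"
    unfolding weak_deriv_formula[abs_def]
    by (intro set_integrable_mult_right set_integral_add DI Au)
  have "u e b - u e a = integral {a..b} (weak_deriv G u e)"
  proof (rule weak_deriv_FTC[OF _ _ _ ab(1) Ioo_interior[OF ab(2)] cont wI])
    show "weak_deriv_on (interior (edge_dom G e)) (u e) (weak_deriv G u e)"
      using H_weak_deriv[OF u] e by (simp add: has_weak_deriv_def)
    show "continuous_on (interior (edge_dom G e)) (u e)"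
      using H_continuous[OF u e] interior_subset continuous_on_subset by blast
  qed simp
  also have "cmod \<dots> \<le> integral {a..b} (\<lambda>x. \<eta> * (cmod (D u e x))\<^sup>2 + 1 / \<eta> + M * \<bar>A e x\<bar>)"
  proof (rule integral_norm_bound_integral)
    show "weak_deriv G u e integrable_on {a..b}" using wI by (rule set_lebesgue_integral_eq_integral)
    show "(\<lambda>x. \<eta> * (cmod (D u e x))\<^sup>2 + 1 / \<eta> + M * \<bar>A e x\<bar>) integrable_on {a..b}"
      using DI(2) A_Icc[OF e ab(2)] 
      by (intro integrable_add integrable_on_mult_right integrable_const_ivl)
        (auto simp: absolutely_integrable_on_def)
    fix x assume x: "x \<in> {a..b}"
    have "cmod (D u e x) \<le> \<eta> * (cmod (D u e x))\<^sup>2 + 1 / \<eta>"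
    proof (cases "\<eta> * cmod (D u e x) \<le> 1")
      case True
      then have "cmod (D u e x) \<le> 1 / \<eta>" using \<eta> by (simp add: field_simps)
      then show ?thesis using \<eta> by (simp add: add_increasing)
    next
      case False
      then have "1 * cmod (D u e x) \<le> (\<eta> * cmod (D u e x)) * cmod (D u e x)" by (intro mult_right_mono) auto
      moreover have "1 / \<eta> > 0" using \<eta> by simp
      ultimately show ?thesis unfolding power2_eq_square by argo
    qed
    moreover have "cmod (of_real (A e x) * u e x) \<le> M * \<bar>A e x\<bar>"
      using mult_left_mono[OF M[OF x], of "\<bar>A e x\<bar>"] by (simp add: norm_mult mult.commute)
    moreover have "cmod (weak_deriv G u e x) \<le> cmod (D u e x) + cmod (of_real (A e x) * u e x)"
      using norm_triangle_ineq[of "D u e x" "of_real (A e x) * u e x"]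
      by (simp add: weak_deriv_formula norm_mult)
    ultimately show "norm (weak_deriv G u e x) \<le> \<eta> * (cmod (D u e x))\<^sup>2 + 1 / \<eta> + M * \<bar>A e x\<bar>" by linarith
  qed
  also have "\<dots> = \<eta> * integral {a..b} (\<lambda>x. (cmod (D u e x))\<^sup>2) + (b - a) / \<eta> + M * integral {a..b} (\<lambda>x. \<bar>A e x\<bar>)"
  proof -
    have I: "(\<lambda>x. (cmod (D u e x))\<^sup>2) integrable_on {a..b}" "(\<lambda>x. \<bar>A e x\<bar>) integrable_on {a..b}"
      using DI(2) A_Icc[OF e ab(2)] by (auto simp: absolutely_integrable_on_def)
    have "((\<lambda>x. \<eta> * (cmod (D u e x))\<^sup>2 + 1 / \<eta> + M * \<bar>A e x\<bar>) has_integral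
        \<eta> * integral {a..b} (\<lambda>x. (cmod (D u e x))\<^sup>2) + (b - a) *\<^sub>R (1 / \<eta>) + M * integral {a..b} (\<lambda>x. \<bar>A e x\<bar>)) {a..b}"
      using has_integral_const_real[of "1 / \<eta>" a b] ab(1)
      by (intro has_integral_add has_integral_mult_right integrable_integral I) simp
    then show ?thesis by (simp add: integral_unique)
  qed
  also have "\<dots> \<le> \<eta> * mag_normsq G A V u + (b - a) / \<eta> + M * integral {a..b} (\<lambda>x. \<bar>A e x\<bar>)"
    using mult_left_mono[OF order_trans[OF DI(3) edge_D_le[OF u e]], of \<eta>] \<eta> by simp
  finally show ?thesis .
qed

text \<open>Uniform continuity of the primitive of \<open>|A|\<close>.\<close>

lemma A_small:
  assumes e: "e \<in> edges G" and L: "{0..L} \<subseteq> edge_dom G e" and \<epsilon>: "\<epsilon> > 0"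
  obtains \<delta> where "\<delta> > 0" "\<And>a b. 0 \<le> a \<Longrightarrow> a \<le> b \<Longrightarrow> b \<le> L \<Longrightarrow> b - a < \<delta> \<Longrightarrow> integral {a..b} (\<lambda>x. \<bar>A e x\<bar>) \<le> \<epsilon>"
proof -
  have I: "(\<lambda>x. \<bar>A e x\<bar>) integrable_on {0..L}" using A_Icc[OF e L] by (simp add: absolutely_integrable_on_def)
  have "uniformly_continuous_on {0..L} (\<lambda>t. integral {0..t} (\<lambda>x. \<bar>A e x\<bar>))"
    by (intro compact_uniformly_continuous indefinite_integral_continuous_1 I compact_Icc)
  then obtain \<delta> where \<delta>: "\<delta> > 0" "\<And>x y. x \<in> {0..L} \<Longrightarrow> y \<in> {0..L} \<Longrightarrow> dist y x < \<delta> \<Longrightarrow>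
      dist (integral {0..y} (\<lambda>x. \<bar>A e x\<bar>)) (integral {0..x} (\<lambda>x. \<bar>A e x\<bar>)) < \<epsilon>"
    using \<epsilon> unfolding uniformly_continuous_on_def by metis
  show thesis
  proof (rule that[OF \<delta>(1)])
    fix a b assume ab: "0 \<le> a" "a \<le> b" "b \<le> L" "b - a < \<delta>"
    have "integral {0..a} (\<lambda>x. \<bar>A e x\<bar>) + integral {a..b} (\<lambda>x. \<bar>A e x\<bar>) = integral {0..b} (\<lambda>x. \<bar>A e x\<bar>)"
      using ab by (intro Henstock_Kurzweil_Integration.integral_combine integrable_on_subinterval[OF I]) auto
    moreover have "dist (integral {0..b} (\<lambda>x. \<bar>A e x\<bar>)) (integral {0..a} (\<lambda>x. \<bar>A e x\<bar>)) < \<epsilon>"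
      using ab by (intro \<delta>(2)) (auto simp: dist_real_def)
    ultimately show "integral {a..b} (\<lambda>x. \<bar>A e x\<bar>) \<le> \<epsilon>" unfolding dist_real_def by linarith
  qed
qed

text \<open>On an interval on which the integral of \<open>|A|\<close> is at most \<open>1/2\<close>, the term \<open>A u\<close> of the weak derivative
  is absorbed into the supremum of \<open>|u|\<close>. As the mass is at most 1, an interval of length \<open>d\<close> contains a
  point where \<open>|u|\<^sup>2 \<le> 2 / d\<close>.\<close>

lemma edge_sup_bound_unit:
  assumes e: "e \<in> edges G" and L: "{0..L} \<subseteq> edge_dom G e" "L > 0"
  obtains C where "\<And>u x. u \<in> H \<Longrightarrow> mag_normsq G A V u \<le> 1 \<Longrightarrow> x \<in> {0..L} \<Longrightarrow> cmod (u e x) \<le> C"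
proof -
  obtain \<delta> where \<delta>: "\<delta> > 0"
    "\<And>a b. 0 \<le> a \<Longrightarrow> a \<le> b \<Longrightarrow> b \<le> L \<Longrightarrow> b - a < \<delta> \<Longrightarrow> integral {a..b} (\<lambda>x. \<bar>A e x\<bar>) \<le> 1/2"
    using A_small[OF e L(1), of "1/2"] by auto
  define d where "d = min (\<delta> / 2) L"
  have d: "0 < d" "d < \<delta>" "d \<le> L" using \<delta>(1) L(2) by (auto simp: d_def)
  have "cmod (u e x) \<le> 2 * sqrt (2 / d) + 2 * (1 + d)"
    if u: "u \<in> H" and n: "mag_normsq G A V u \<le> 1" and x: "x \<in> {0..L}" for u x
  proof -
    define a where "a = min x (L - d)"
    have a: "0 \<le> a" "a + d \<le> L" "x \<in> {a..a+d}" using x d by (auto simp: a_def)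
    have J: "{a..a+d} \<subseteq> edge_dom G e" using a L(1) by auto
    have cont: "continuous_on {a..a+d} (u e)" using H_continuous[OF u e] J continuous_on_subset by blast
    have "\<exists>y\<in>{a..a+d}. \<forall>z\<in>{a..a+d}. cmod (u e z) \<le> cmod (u e y)"
      using d(1) by (intro continuous_attains_sup continuous_intros cont) auto
    then obtain y where y: "y \<in> {a..a+d}" "\<And>z. z \<in> {a..a+d} \<Longrightarrow> cmod (u e z) \<le> cmod (u e y)"
      by blast
    define M where "M = cmod (u e y)"
    have "\<exists>z\<in>{a..a+d}. (cmod (u e z))\<^sup>2 \<le> 2 / d"
    proof (rule ccontr)
      assume neg: "\<not> ?thesis"
      have sq: "(\<lambda>z. (cmod (u e z))\<^sup>2) integrable_on {a..a+d}"
        by (intro integrable_continuous_real continuous_intros cont)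
      have "2 = integral {a..a+d} (\<lambda>z. 2 / d)" using d(1) by simp
      also have "\<dots> \<le> integral {a..a+d} (\<lambda>z. (cmod (u e z))\<^sup>2)"
        using neg by (intro integral_le sq) (auto simp: not_le intro: less_imp_le)
      also have "\<dots> \<le> (\<integral>x. (cmod (u e x))\<^sup>2 \<partial>leb e)"
        by (rule square_integrable_Icc(3)[OF H_square_integrable[OF u e] e J])
      also have "\<dots> \<le> (\<integral>x. V e x * (cmod (u e x))\<^sup>2 \<partial>leb e)"
      proof (rule integral_mono_AE)
        show "AE x in leb e. (cmod (u e x))\<^sup>2 \<le> V e x * (cmod (u e x))\<^sup>2"
          using V_ge_1[OF e]
        proof eventually_elim
          case (elim x)
          then show ?case using mult_right_mono[of 1 "V e x" "(cmod (u e x))\<^sup>2"] by simp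
        qed
      qed (use H_square_integrable[OF u e] H_V[OF u e] in \<open>auto simp: square_integrable_def\<close>)
      also have "\<dots> \<le> 1" using edge_V_le[OF u e] n by linarith
      finally show False by simp
    qed
    then obtain z where z: "z \<in> {a..a+d}" "(cmod (u e z))\<^sup>2 \<le> 2 / d" by blast
    have "cmod (u e z) \<le> sqrt (2 / d)" using z(2) by (simp add: real_le_rsqrt)
    moreover have inc: "cmod (u e t - u e s) \<le> 1 + d + M / 2" if st: "s \<in> {a..a+d}" "t \<in> {a..a+d}" "s \<le> t" for s t
    proof -
      have "{s..t} \<subseteq> edge_dom G e" using st J by auto
      then have "cmod (u e t - u e s) \<le> 1 * mag_normsq G A V u + (t - s) / 1 + M * integral {s..t} (\<lambda>x. \<bar>A e x\<bar>)"
        using st y(2) unfolding M_def by (intro edge_increment[OF u e]) auto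
      moreover have "M * integral {s..t} (\<lambda>x. \<bar>A e x\<bar>) \<le> M * (1/2)"
        using st a d unfolding M_def by (intro mult_left_mono \<delta>(2)) auto
      ultimately show ?thesis using n st by auto
    qed
    have "cmod (u e y - u e z) \<le> 1 + d + M / 2"
    proof (cases "z \<le> y")
      case True then show ?thesis using inc z y by blast
    next
      case False then show ?thesis using inc[of y z] z y by (simp add: norm_minus_commute)
    qed
    moreover have "M \<le> cmod (u e z) + cmod (u e y - u e z)"
      unfolding M_def using norm_triangle_sub[of "u e y" "u e z"] by simp
    moreover have "M \<le> 2 * q + 2 * (1 + d)" if "M \<le> c + c'" "c \<le> q" "c' \<le> 1 + d + M / 2" for c c' q
      using that by (simp add: field_simps)
    ultimately have "M \<le> 2 * sqrt (2 / d) + 2 * (1 + d)" by blast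
    then show ?thesis using y(2)[OF a(3)] unfolding M_def by linarith
  qed
  then show thesis using that by blast
qed

lemma mag_normsq_form: "mag_normsq G A V u = form 1 0 u u"
  by (simp add: form_def mag_form_self)

lemma mag_normsq_scale: "u \<in> H \<Longrightarrow> mag_normsq G A V (c *\<^sub>R u) = c\<^sup>2 * mag_normsq G A V u"
  unfolding mag_normsq_form by (rule form_scale2)

text \<open>Stated with a scaling factor so that functions of energy zero are covered.\<close>

lemma edge_sup_bound:
  assumes e: "e \<in> edges G" and L: "{0..L} \<subseteq> edge_dom G e" "L > 0"
  obtains C where "\<And>u t x. u \<in> H \<Longrightarrow> t > 0 \<Longrightarrow> t\<^sup>2 * mag_normsq G A V u \<le> 1 \<Longrightarrow> x \<in> {0..L} \<Longrightarrow> cmod (u e x) \<le> C / t"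
proof -
  obtain C where C: "\<And>u x. u \<in> H \<Longrightarrow> mag_normsq G A V u \<le> 1 \<Longrightarrow> x \<in> {0..L} \<Longrightarrow> cmod (u e x) \<le> C"
    using edge_sup_bound_unit[OF assms] by blast
  have "cmod (u e x) \<le> C / t" if "u \<in> H" "t > 0" "t\<^sup>2 * mag_normsq G A V u \<le> 1" "x \<in> {0..L}" for u t x
    using C[of "t *\<^sub>R u" x] that by (simp add: mag_normsq_scale norm_mult field_simps)
  then show thesis using that by blast
qed

end

section \<open>Compactness on the core and completeness\<close>

lemma set_integral_mono_subset:
  fixes f :: "real \<Rightarrow> real"
  assumes f: "set_integrable lebesgue T f" and K: "K \<in> sets lebesgue" "K \<subseteq> T" and nonneg: "\<And>x. 0 \<le> f x"
  shows "norm (LINT x:K|lebesgue. f x) \<le> (LINT x:T|lebesgue. f x)"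
proof -
  have "(LINT x:K|lebesgue. f x) \<le> (LINT x:T|lebesgue. f x)"
    unfolding set_lebesgue_integral_def
  proof (rule integral_mono)
    show "integrable lebesgue (\<lambda>x. indicator T x *\<^sub>R f x)" using f by (simp add: set_integrable_def)
    show "integrable lebesgue (\<lambda>x. indicator K x *\<^sub>R f x)"
      using set_integrable_subset[OF f K] by (simp add: set_integrable_def)
    show "indicator K x *\<^sub>R f x \<le> indicator T x *\<^sub>R f x" for x
      using K(2) nonneg[of x] by (auto simp: indicator_def)
  qed
  moreover have "0 \<le> (LINT x:K|lebesgue. f x)"
    unfolding set_lebesgue_integral_def using nonneg by (intro integral_nonneg_AE AE_I2) simp
  ultimately show ?thesis by simp
qed

context magnetic_graph
begin

text \<open>Zero is inserted because the supremum of the empty set is unspecified.\<close>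

definition core_sup :: "('e \<Rightarrow> real \<Rightarrow> complex) \<Rightarrow> real" where
  "core_sup u = Sup (insert 0 (\<Union>e\<in>bounded_edges G. (\<lambda>x. cmod (u e x)) ` edge_dom G e))"

lemma core_sup_ge:
  assumes u: "u \<in> H"
  shows "0 \<le> core_sup u" "\<And>e x. e \<in> bounded_edges G \<Longrightarrow> x \<in> edge_dom G e \<Longrightarrow> cmod (u e x) \<le> core_sup u"
proof -
  have "bdd_above ((\<lambda>x. cmod (u e x)) ` edge_dom G e)" if e: "e \<in> bounded_edges G" for e
  proof -
    have "compact (edge_dom G e)" by (rule edge_dom_bounded[OF e]) simp
    then show ?thesis using e bounded_edges_sub
      by (intro bounded_imp_bdd_above compact_imp_bounded compact_continuous_image continuous_intros H_continuous[OF u]) auto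
  qed
  then have bdd: "bdd_above (insert 0 (\<Union>e\<in>bounded_edges G. (\<lambda>x. cmod (u e x)) ` edge_dom G e))"
    by simp
  show "0 \<le> core_sup u" unfolding core_sup_def by (rule cSup_upper[OF _ bdd]) simp
  show "cmod (u e x) \<le> core_sup u" if "e \<in> bounded_edges G" "x \<in> edge_dom G e" for e x
    unfolding core_sup_def by (rule cSup_upper[OF _ bdd]) (use that in blast)
qed

lemma core_sup_le:
  assumes "0 \<le> c" "\<And>e x. e \<in> bounded_edges G \<Longrightarrow> x \<in> edge_dom G e \<Longrightarrow> cmod (u e x) \<le> c"
  shows "core_sup u \<le> c"
  unfolding core_sup_def using assms by (intro cSup_least) auto

lemma core_sup_triangle: "u \<in> H \<Longrightarrow> v \<in> H \<Longrightarrow> core_sup (u + v) \<le> core_sup u + core_sup v"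
  using core_sup_ge[of u] core_sup_ge[of v]
  by (intro core_sup_le) (auto intro!: norm_triangle_le add_mono)

lemma core_sup_scale:
  assumes u: "u \<in> H" shows "core_sup (c *\<^sub>R u) = \<bar>c\<bar> * core_sup u"
proof (rule antisym)
  show le: "core_sup (c *\<^sub>R u) \<le> \<bar>c\<bar> * core_sup u"
    using core_sup_ge[OF u] by (intro core_sup_le) (auto simp: norm_mult intro!: mult_left_mono)
  show "\<bar>c\<bar> * core_sup u \<le> core_sup (c *\<^sub>R u)"
  proof (cases "c = 0")
    case True
    then show ?thesis using core_sup_ge(1)[of "c *\<^sub>R u"] u subspace_scale[OF subspace_H] by simp
  next
    case False
    have "core_sup u \<le> core_sup (c *\<^sub>R u) / \<bar>c\<bar>"
    proof (rule core_sup_le)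
      have cu: "c *\<^sub>R u \<in> H" using u subspace_scale[OF subspace_H] by blast
      show "0 \<le> core_sup (c *\<^sub>R u) / \<bar>c\<bar>" using core_sup_ge(1)[OF cu] by simp
      show "cmod (u e x) \<le> core_sup (c *\<^sub>R u) / \<bar>c\<bar>" if "e \<in> bounded_edges G" "x \<in> edge_dom G e" for e x
        using core_sup_ge(2)[OF cu that] False by (simp add: norm_mult field_simps)
    qed
    then show ?thesis using False by (simp add: field_simps)
  qed
qed

lemma core_sup_bound: "\<exists>C. \<forall>u\<in>H. mag_normsq G A V u \<le> 1 \<longrightarrow> core_sup u \<le> C"
proof -
  have "\<exists>C. \<forall>u x. u \<in> H \<longrightarrow> mag_normsq G A V u \<le> 1 \<longrightarrow> x \<in> edge_dom G e \<longrightarrow> cmod (u e x) \<le> C"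
    if e: "e \<in> bounded_edges G" for e
  proof -
    obtain l where l: "l > 0" "edge_dom G e = {0..l}" using edge_dom_bounded[OF e] by metis
    then show ?thesis using edge_sup_bound_unit[of e l] e bounded_edges_sub by (metis order_refl subsetD)
  qed
  then obtain C where C: "\<And>e u x. e \<in> bounded_edges G \<Longrightarrow> u \<in> H \<Longrightarrow> mag_normsq G A V u \<le> 1 \<Longrightarrow> x \<in> edge_dom G e \<Longrightarrow> cmod (u e x) \<le> C e"
    by metis
  have "core_sup u \<le> (\<Sum>e\<in>bounded_edges G. \<bar>C e\<bar>)" if "u \<in> H" "mag_normsq G A V u \<le> 1" for u
  proof (rule core_sup_le)
    fix e x assume e: "e \<in> bounded_edges G" "x \<in> edge_dom G e"
    have "cmod (u e x) \<le> \<bar>C e\<bar>" using C[OF e(1) that e(2)] by simp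
    also have "\<dots> \<le> (\<Sum>e\<in>bounded_edges G. \<bar>C e\<bar>)" using e(1) by (intro member_le_sum) auto
    finally show "cmod (u e x) \<le> (\<Sum>e\<in>bounded_edges G. \<bar>C e\<bar>)" .
  qed (simp add: sum_nonneg)
  then show ?thesis by blast
qed

text \<open>The estimate of the increments shows that sequences of bounded energy are equicontinuous.\<close>

lemma edge_compactness:
  assumes u: "\<And>n. u n \<in> H" and K: "\<And>n. mag_normsq G A V (u n) \<le> K" and e: "e \<in> bounded_edges G"
  obtains r g where "strict_mono (r :: nat \<Rightarrow> nat)"
    "\<And>\<epsilon>. \<epsilon> > 0 \<Longrightarrow> \<exists>N. \<forall>n\<ge>N. \<forall>x\<in>edge_dom G e. cmod (u (r n) e x - g x) < \<epsilon>"
proof -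
  have eE: "e \<in> edges G" using e bounded_edges_sub by blast
  obtain l where l: "l > 0" "edge_dom G e = {0..l}" using edge_dom_bounded[OF e] by metis
  have sub: "{0..l} \<subseteq> edge_dom G e" by (simp add: l)
  have K0: "K \<ge> 0" using K[of 0] mag_normsq_form B_nonneg[OF u] by (metis B_form order_trans)
  obtain C where C: "\<And>u t x. u \<in> H \<Longrightarrow> t > 0 \<Longrightarrow> t\<^sup>2 * mag_normsq G A V u \<le> 1 \<Longrightarrow> x \<in> {0..l} \<Longrightarrow> cmod (u e x) \<le> C / t"
    using edge_sup_bound[OF eE sub l(1)] by blast
  define t where "t = 1 / sqrt (K + 1)"
  have t: "t > 0" "t\<^sup>2 = 1 / (K + 1)" using K0 by (auto simp: t_def power_divide)
  define M where "M = C / t"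
  have M: "cmod (u n e x) \<le> M" if "x \<in> {0..l}" for n x
    unfolding M_def
  proof (rule C[OF u t(1) _ that])
    show "t\<^sup>2 * mag_normsq G A V (u n) \<le> 1" using K[of n] K0 by (simp add: t(2) field_simps)
  qed
  have M0: "M \<ge> 0" using M[of 0 0] l(1) by (meson atLeastAtMost_iff less_imp_le norm_ge_zero order_refl order_trans)
  have equi: "\<exists>d>0. \<forall>n x y. x \<in> {0..l} \<and> y \<in> {0..l} \<and> norm (x - y) < d \<longrightarrow> norm (u n e x - u n e y) < \<epsilon>"
    if \<epsilon>: "\<epsilon> > 0" for \<epsilon>
  proof -
    \<comment> \<open>each of the three terms in the estimate of the increments is made at most \<open>\<epsilon> / 4\<close>\<close>
    define \<eta> where "\<eta> = \<epsilon> / (4 * (K + 1))"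
    have \<eta>: "\<eta> > 0" "\<eta> * K \<le> \<epsilon> / 4" using \<epsilon> K0 by (auto simp: \<eta>_def field_simps)
    obtain \<delta> where \<delta>: "\<delta> > 0"
      "\<And>a b. 0 \<le> a \<Longrightarrow> a \<le> b \<Longrightarrow> b \<le> l \<Longrightarrow> b - a < \<delta> \<Longrightarrow> integral {a..b} (\<lambda>x. \<bar>A e x\<bar>) \<le> \<epsilon> / (4 * (M + 1))"
      using A_small[OF eE sub, of "\<epsilon> / (4 * (M + 1))"] \<epsilon> M0 by auto
    define d where "d = min \<delta> (\<eta> * \<epsilon> / 4)"
    have d: "d > 0" using \<delta>(1) \<eta> \<epsilon> by (simp add: d_def)
    have inc: "cmod (u n e y - u n e x) < \<epsilon>" if xy: "0 \<le> x" "x \<le> y" "y \<le> l" "y - x < d" for n x y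
    proof -
      have "cmod (u n e y - u n e x) \<le> \<eta> * mag_normsq G A V (u n) + (y - x) / \<eta> + M * integral {x..y} (\<lambda>x. \<bar>A e x\<bar>)"
        using xy M l \<eta>(1) by (intro edge_increment[OF u eE]) auto
      moreover have "\<eta> * mag_normsq G A V (u n) \<le> \<epsilon> / 4"
        using mult_left_mono[OF K[of n], of \<eta>] \<eta> by linarith
      moreover have "(y - x) / \<eta> \<le> \<epsilon> / 4" using xy \<eta>(1) by (simp add: d_def field_simps)
      moreover have "M * integral {x..y} (\<lambda>x. \<bar>A e x\<bar>) \<le> \<epsilon> / 4"
      proof -
        have "M * integral {x..y} (\<lambda>x. \<bar>A e x\<bar>) \<le> M * (\<epsilon> / (4 * (M + 1)))"
          using xy M0 by (intro mult_left_mono \<delta>(2)) (auto simp: d_def)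
        also have "\<dots> \<le> \<epsilon> / 4" using M0 \<epsilon> by (simp add: field_simps)
        finally show ?thesis .
      qed
      ultimately show ?thesis using \<epsilon> by linarith
    qed
    show ?thesis
    proof (intro exI[of _ d] conjI d allI impI)
      fix n x y assume "x \<in> {0..l} \<and> y \<in> {0..l} \<and> norm (x - y) < d"
      then show "norm (u n e x - u n e y) < \<epsilon>"
        using inc[of x y n] inc[of y x n] by (cases "x \<le> y") (auto simp: norm_minus_commute)
    qed
  qed
  obtain g r where r: "strict_mono (r :: nat \<Rightarrow> nat)"
    and g: "\<And>\<epsilon>. 0 < \<epsilon> \<Longrightarrow> \<exists>N. \<forall>n x. n \<ge> N \<and> x \<in> {0..l} \<longrightarrow> norm (u (r n) e x - g x) < \<epsilon>"
  proof (rule Arzela_Ascoli[of "{0..l}" "\<lambda>n. u n e" M])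
    show "\<exists>d>0. \<forall>n y. y \<in> {0..l} \<and> norm (x - y) < d \<longrightarrow> norm (u n e x - u n e y) < \<epsilon>"
      if "x \<in> {0..l}" "0 < \<epsilon>" for x \<epsilon>
      using equi[OF that(2)] that(1) by blast
  qed (use M in auto)
  show thesis
  proof (rule that[OF r])
    show "\<exists>N. \<forall>n\<ge>N. \<forall>x\<in>edge_dom G e. cmod (u (r n) e x - g x) < \<epsilon>" if "\<epsilon> > 0" for \<epsilon>
      using g[OF that] unfolding l(2) by blast
  qed
qed

lemma core_compactness:
  assumes u: "\<And>n. u n \<in> H" and K: "\<And>n. mag_normsq G A V (u n) \<le> K"
  shows "\<exists>r. strict_mono (r :: nat \<Rightarrow> nat) \<and>
    (\<forall>\<epsilon>>0. \<exists>M. \<forall>m\<ge>M. \<forall>n\<ge>M. core_sup (u (r m) - u (r n)) \<le> \<epsilon>)"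
proof -
  have "\<exists>r. strict_mono (r :: nat \<Rightarrow> nat) \<and> (\<forall>e\<in>F. \<exists>g. \<forall>\<epsilon>>0. \<exists>N. \<forall>n\<ge>N. \<forall>x\<in>edge_dom G e. cmod (u (r n) e x - g x) < \<epsilon>)"
    if "finite F" "F \<subseteq> bounded_edges G" for F
    using that
  proof (induction F rule: finite_induct)
    case empty
    show ?case by (intro exI[of _ id]) (auto simp: strict_mono_def)
  next
    case (insert e F)
    then obtain r where r: "strict_mono (r :: nat \<Rightarrow> nat)"
      and g: "\<And>e. e \<in> F \<Longrightarrow> \<exists>g. \<forall>\<epsilon>>0. \<exists>N. \<forall>n\<ge>N. \<forall>x\<in>edge_dom G e. cmod (u (r n) e x - g x) < \<epsilon>"
      by auto
    obtain s h where s: "strict_mono (s :: nat \<Rightarrow> nat)"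
      and h: "\<And>\<epsilon>. \<epsilon> > 0 \<Longrightarrow> \<exists>N. \<forall>n\<ge>N. \<forall>x\<in>edge_dom G e. cmod (u (r (s n)) e x - h x) < \<epsilon>"
      using edge_compactness[of "\<lambda>n. u (r n)" K e] u K insert.prems by auto
    have "\<exists>g. \<forall>\<epsilon>>0. \<exists>N. \<forall>n\<ge>N. \<forall>x\<in>edge_dom G e'. cmod (u ((r \<circ> s) n) e' x - g x) < \<epsilon>" if e': "e' \<in> insert e F" for e'
    proof (cases "e' = e")
      case True
      then show ?thesis using h by auto
    next
      case False
      then obtain g' where g': "\<And>\<epsilon>. \<epsilon> > 0 \<Longrightarrow> \<exists>N. \<forall>n\<ge>N. \<forall>x\<in>edge_dom G e'. cmod (u (r n) e' x - g' x) < \<epsilon>"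
        using g e' by blast
      have "\<exists>N. \<forall>n\<ge>N. \<forall>x\<in>edge_dom G e'. cmod (u ((r \<circ> s) n) e' x - g' x) < \<epsilon>" if \<epsilon>: "\<epsilon> > 0" for \<epsilon>
      proof -
        obtain N where "\<forall>n\<ge>N. \<forall>x\<in>edge_dom G e'. cmod (u (r n) e' x - g' x) < \<epsilon>" using g'[OF \<epsilon>] by blast
        moreover have "s n \<ge> n" for n using s by (rule strict_mono_imp_increasing)
        ultimately show ?thesis by (metis comp_apply order_trans)
      qed
      then show ?thesis by blast
    qed
    then show ?case using strict_mono_o[OF r s] by blast
  qed
  from this[OF finite_bounded_edges order_refl] obtain r where r: "strict_mono (r :: nat \<Rightarrow> nat)"
    and "\<forall>e\<in>bounded_edges G. \<exists>g. \<forall>\<epsilon>>0. \<exists>N. \<forall>n\<ge>N. \<forall>x\<in>edge_dom G e. cmod (u (r n) e x - g x) < \<epsilon>" by blast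
  then obtain g where g: "\<And>e \<epsilon>. e \<in> bounded_edges G \<Longrightarrow> \<epsilon> > 0 \<Longrightarrow> \<exists>N. \<forall>n\<ge>N. \<forall>x\<in>edge_dom G e. cmod (u (r n) e x - g e x) < \<epsilon>"
    by metis
  have "\<exists>M. \<forall>m\<ge>M. \<forall>n\<ge>M. core_sup (u (r m) - u (r n)) \<le> \<epsilon>" if \<epsilon>: "\<epsilon> > 0" for \<epsilon>
  proof -
    obtain N where N: "\<And>e n x. e \<in> bounded_edges G \<Longrightarrow> n \<ge> N e \<Longrightarrow> x \<in> edge_dom G e \<Longrightarrow> cmod (u (r n) e x - g e x) < \<epsilon> / 2"
      using g[of _ "\<epsilon> / 2"] \<epsilon> by (metis half_gt_zero)
    define M where "M = (\<Sum>e\<in>bounded_edges G. N e)"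
    have NM: "N e \<le> M" if "e \<in> bounded_edges G" for e
      unfolding M_def using that by (intro member_le_sum) auto
    have "core_sup (u (r m) - u (r n)) \<le> \<epsilon>" if "m \<ge> M" "n \<ge> M" for m n
    proof (rule core_sup_le)
      fix e x assume e: "e \<in> bounded_edges G" "x \<in> edge_dom G e"
      have "cmod (u (r m) e x - g e x) < \<epsilon> / 2" "cmod (u (r n) e x - g e x) < \<epsilon> / 2"
        using N[OF e(1) _ e(2)] NM[OF e(1)] that by auto
      then have "cmod ((u (r m) e x - g e x) - (u (r n) e x - g e x)) \<le> \<epsilon>"
        using norm_triangle_ineq4[of "u (r m) e x - g e x" "u (r n) e x - g e x"] by linarith
      then show "cmod ((u (r m) - u (r n)) e x) \<le> \<epsilon>" by simp
    qed (use \<epsilon> in simp)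
    then show ?thesis by blast
  qed
  then show ?thesis using r by blast
qed

lemma H_D_measurable: "u \<in> H \<Longrightarrow> e \<in> edges G \<Longrightarrow> D u e \<in> borel_measurable (leb e)"
  using H_D by (simp add: square_integrable_def)

lemma H_diff: "u \<in> H \<Longrightarrow> v \<in> H \<Longrightarrow> e \<in> edges G \<Longrightarrow> AE x in leb e. D (u - v) e x = D u e x - D v e x"
  using H_lin(2)[of u v e "-1"] by simp

text \<open>On each edge \<open>D u\<close> and \<open>\<surd>V u\<close> converge in \<open>L\<^sup>2\<close>, and \<open>u\<close> converges locally uniformly by the supremum
  bound. The local uniform convergence identifies the limits: it makes \<open>A u\<close> converge in \<open>L\<^sup>1\<close> on compact
  intervals, so that the weak derivatives \<open>i (D u + A u)\<close> converge there as well.\<close>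

lemma H_complete:
  assumes u: "\<And>n. u n \<in> H" and step: "\<And>n. mag_normsq G A V (u (Suc n) - u n) \<le> (1/4) ^ n"
  shows "\<exists>v\<in>H. (\<lambda>n. mag_normsq G A V (u n - v)) \<longlonglongrightarrow> 0"
proof -
  have du: "u (Suc n) - u n \<in> H" for n using u subspace_diff[OF subspace_H] by blast
  have "\<exists>g. square_integrable (leb e) g \<and> (\<lambda>n. \<integral>x. (cmod (D (u n) e x - g x))\<^sup>2 \<partial>leb e) \<longlonglongrightarrow> 0
      \<and> (\<forall>n. integrable (leb e) (\<lambda>x. (cmod (D (u n) e x - g x))\<^sup>2))" if e: "e \<in> edges G" for e
  proof -
    note [measurable] = H_D_measurable[OF u e] H_D_measurable[OF du e]
    have st: "(\<integral>x. (norm (D (u (Suc n)) e x - D (u n) e x))\<^sup>2 \<partial>leb e) \<le> (1/4) ^ n" for n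
    proof -
      have "(\<integral>x. (norm (D (u (Suc n)) e x - D (u n) e x))\<^sup>2 \<partial>leb e) = (\<integral>x. (cmod (D (u (Suc n) - u n) e x))\<^sup>2 \<partial>leb e)"
      proof (rule integral_cong_AE)
        show "AE x in leb e. (norm (D (u (Suc n)) e x - D (u n) e x))\<^sup>2 = (cmod (D (u (Suc n) - u n) e x))\<^sup>2"
          using H_diff[OF u u e, of "Suc n" n] by eventually_elim simp
      qed measurable
      also have "\<dots> \<le> (1/4) ^ n" using edge_D_le[OF du e, of n] step[of n] by linarith
      finally show ?thesis .
    qed
    have "integrable (leb e) (\<lambda>x. (norm (D (u n) e x))\<^sup>2)" for n
      using H_D[OF u e] by (simp add: square_integrable_def)
    from L2_complete[OF H_D_measurable[OF u e] this st]
    obtain h where "h \<in> borel_measurable (leb e)" "integrable (leb e) (\<lambda>x. (norm (h x))\<^sup>2)"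
      "\<And>n. integrable (leb e) (\<lambda>x. (norm (D (u n) e x - h x))\<^sup>2)"
      "(\<lambda>n. \<integral>x. (norm (D (u n) e x - h x))\<^sup>2 \<partial>leb e) \<longlonglongrightarrow> 0" by blast
    then show ?thesis by (intro exI[of _ h]) (simp add: square_integrable_def)
  qed
  then have "\<forall>e\<in>edges G. \<exists>g. square_integrable (leb e) g \<and> (\<lambda>n. \<integral>x. (cmod (D (u n) e x - g x))\<^sup>2 \<partial>leb e) \<longlonglongrightarrow> 0
      \<and> (\<forall>n. integrable (leb e) (\<lambda>x. (cmod (D (u n) e x - g x))\<^sup>2))" by (intro ballI)
  from bchoice[OF this] obtain g where "\<forall>e\<in>edges G. square_integrable (leb e) (g e)
      \<and> (\<lambda>n. \<integral>x. (cmod (D (u n) e x - g e x))\<^sup>2 \<partial>leb e) \<longlonglongrightarrow> 0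
      \<and> (\<forall>n. integrable (leb e) (\<lambda>x. (cmod (D (u n) e x - g e x))\<^sup>2))" ..
  then have g: "\<And>e. e \<in> edges G \<Longrightarrow> square_integrable (leb e) (g e)"
    and glim: "\<And>e. e \<in> edges G \<Longrightarrow> (\<lambda>n. \<integral>x. (cmod (D (u n) e x - g e x))\<^sup>2 \<partial>leb e) \<longlonglongrightarrow> 0"
    and gint: "\<And>e n. e \<in> edges G \<Longrightarrow> integrable (leb e) (\<lambda>x. (cmod (D (u n) e x - g e x))\<^sup>2)"
    by simp_all
  define v where "v e x = lim (\<lambda>n. u n e x)" for e x
  have geo: "\<exists>C. \<forall>n. \<forall>x\<in>{0..L}. convergent (\<lambda>n. u n e x) \<and> cmod (u n e x - v e x) \<le> C * (1/2) ^ n"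
    if e: "e \<in> edges G" and L: "{0..L} \<subseteq> edge_dom G e" "L > 0" for e L
  proof -
    obtain C where C: "\<And>u t x. u \<in> H \<Longrightarrow> t > 0 \<Longrightarrow> t\<^sup>2 * mag_normsq G A V u \<le> 1 \<Longrightarrow> x \<in> {0..L} \<Longrightarrow> cmod (u e x) \<le> C / t"
      using edge_sup_bound[OF e L] by blast
    have "convergent (\<lambda>n. u n e x) \<and> cmod (u n e x - v e x) \<le> (2 * C) * (1/2) ^ n" if x: "x \<in> {0..L}" for n x
    proof -
      have st: "cmod (u (Suc n) e x - u n e x) \<le> C * (1/2) ^ n" for n
      proof -
        have "(2 ^ n)\<^sup>2 * mag_normsq G A V (u (Suc n) - u n) \<le> (2 ^ n)\<^sup>2 * (1/4) ^ n"
          using step by (intro mult_left_mono) auto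
        also have "(2 ^ n)\<^sup>2 * (1/4) ^ n = (1::real)"
          by (simp add: power2_eq_square flip: power_mult_distrib)
        finally have "cmod ((u (Suc n) - u n) e x) \<le> C / 2 ^ n" by (intro C[OF du _ _ x]) auto
        then show ?thesis by (simp add: power_one_over)
      qed
      show ?thesis
        using geometric_cauchy[of "1/2" "\<lambda>n. u n e x" C, OF _ _ st] by (simp add: v_def mult_ac)
    qed
    then show ?thesis by blast
  qed
  have point: "(\<lambda>n. u n e x) \<longlonglongrightarrow> v e x" if e: "e \<in> edges G" and x: "x \<in> edge_dom G e" for e x
  proof -
    have "\<exists>L>0. {0..L} \<subseteq> edge_dom G e \<and> x \<in> {0..L}" using e
    proof (rule edge_dom_cases)
      show ?thesis if "l > 0" "edge_dom G e = {0..l}" for l using that x by auto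
      show ?thesis if "edge_dom G e = {0..}" using that x by (intro exI[of _ "x + 1"]) auto
    qed
    then show ?thesis using geo[OF e] convergent_LIMSEQ_iff unfolding v_def by blast
  qed
  have contL: "continuous_on {0..L} (v e)" if e: "e \<in> edges G" and L: "{0..L} \<subseteq> edge_dom G e" "L > 0" for e L
  proof -
    obtain C where C: "\<And>n x. x \<in> {0..L} \<Longrightarrow> cmod (u n e x - v e x) \<le> C * (1/2) ^ n" using geo[OF e L] by blast
    have lim: "(\<lambda>n. C * (1/2) ^ n) \<longlonglongrightarrow> C * 0" by (intro tendsto_intros LIMSEQ_power_zero) auto
    show ?thesis
    proof (rule uniform_limit_theorem[where f = "\<lambda>n. u n e" and F = sequentially])
      show "\<forall>\<^sub>F n in sequentially. continuous_on {0..L} (u n e)"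
        using H_continuous[OF u e] L(1) continuous_on_subset by (intro always_eventually) blast
      show "uniform_limit {0..L} (\<lambda>n. u n e) (v e) sequentially"
      proof (rule uniform_limitI)
        fix \<epsilon> :: real assume "\<epsilon> > 0"
        then have "\<forall>\<^sub>F n in sequentially. C * (1/2) ^ n < \<epsilon>" using lim by (intro order_tendstoD) auto
        then show "\<forall>\<^sub>F n in sequentially. \<forall>x\<in>{0..L}. dist (u n e x) (v e x) < \<epsilon>"
        proof eventually_elim
          case (elim n)
          show ?case
          proof
            fix x assume "x \<in> {0..L}"
            then show "dist (u n e x) (v e x) < \<epsilon>" unfolding dist_norm by (rule le_less_trans[OF C elim])
          qed
        qed
      qed
    qed simp
  qed
  have cont: "continuous_on (edge_dom G e) (v e)" if e: "e \<in> edges G" for e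
    using e
  proof (rule edge_dom_cases)
    show ?thesis if "l > 0" "edge_dom G e = {0..l}" for l using contL[OF e, of l] that by simp
    assume S: "edge_dom G e = {0..}"
    show ?thesis unfolding S continuous_on_eq_continuous_within
    proof
      fix x :: real assume x: "x \<in> {0..}"
      have "continuous (at x within {0..x+1}) (v e)"
        using contL[OF e, of "x + 1"] x S by (auto simp: continuous_on_eq_continuous_within)
      moreover have "at x within {0..x+1} = at x within {0..}"
        by (rule at_within_nhd[of x "{..<x+1}"]) auto
      ultimately show "continuous (at x within {0..}) (v e)" by simp
    qed
  qed
  have gc: "graph_continuous G v"
  proof -
    have "\<forall>n. \<exists>w. (\<forall>e\<in>edges G. u n e 0 = w (src G e)) \<and>
        (\<forall>e\<in>bounded_edges G. u n e (real_of_ereal (len G e)) = w (tgt G e))"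
      using u unfolding H1A_def graph_continuous_def by blast
    from choice[OF this] obtain w where "\<forall>n. (\<forall>e\<in>edges G. u n e 0 = w n (src G e)) \<and>
        (\<forall>e\<in>bounded_edges G. u n e (real_of_ereal (len G e)) = w n (tgt G e))" ..
    then have w: "\<And>n e. e \<in> edges G \<Longrightarrow> u n e 0 = w n (src G e)"
      "\<And>n e. e \<in> bounded_edges G \<Longrightarrow> u n e (real_of_ereal (len G e)) = w n (tgt G e)" by simp_all
    have "v e 0 = lim (\<lambda>n. w n (src G e))" if "e \<in> edges G" for e unfolding v_def w(1)[OF that] ..
    moreover have "v e (real_of_ereal (len G e)) = lim (\<lambda>n. w n (tgt G e))" if "e \<in> bounded_edges G" for e
      unfolding v_def w(2)[OF that] ..
    ultimately show ?thesis unfolding graph_continuous_def using cont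
      by (intro conjI ballI exI[of _ "\<lambda>y. lim (\<lambda>n. w n y)"]) auto
  qed
  have vm: "v e \<in> borel_measurable (leb e)" if "e \<in> edges G" for e using continuous_measurable cont that by blast
  \<comment> \<open>the \<open>L\<^sup>2\<close> limit of \<open>\<surd>V u\<close> is \<open>\<surd>V v\<close>, by pointwise convergence\<close>
  have Vpart: "integrable (leb e) (\<lambda>x. V e x * (cmod (v e x))\<^sup>2) \<and>
      (\<forall>n. integrable (leb e) (\<lambda>x. V e x * (cmod (u n e x - v e x))\<^sup>2)) \<and>
      (\<lambda>n. \<integral>x. V e x * (cmod (u n e x - v e x))\<^sup>2 \<partial>leb e) \<longlonglongrightarrow> 0" if e: "e \<in> edges G" for e
  proof -
    note [measurable] = V_measurable[OF e] H_measurable[OF u e] vm[OF e]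
    define f where "f n x = of_real (sqrt (V e x)) * u n e x" for n x
    have sqf: "AE x in leb e. (cmod (of_real (sqrt (V e x)) * z x))\<^sup>2 = V e x * (cmod (z x))\<^sup>2" for z :: "real \<Rightarrow> complex"
      using V_nonneg[OF e] by eventually_elim (simp add: norm_mult power_mult_distrib)
    have fm: "f n \<in> borel_measurable (leb e)" for n unfolding f_def by measurable
    have fi: "integrable (leb e) (\<lambda>x. (norm (f n x))\<^sup>2)" for n
    proof (rule integrable_cong_AE_imp[OF H_V[OF u e]])
      show "AE x in leb e. V e x * (cmod (u n e x))\<^sup>2 = (norm (f n x))\<^sup>2"
        using sqf[of "u n e"] unfolding f_def by eventually_elim simp
    qed (use fm in measurable)
    have st: "(\<integral>x. (norm (f (Suc n) x - f n x))\<^sup>2 \<partial>leb e) \<le> (1/4) ^ n" for n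
    proof -
      have "(\<integral>x. (norm (f (Suc n) x - f n x))\<^sup>2 \<partial>leb e) = (\<integral>x. V e x * (cmod ((u (Suc n) - u n) e x))\<^sup>2 \<partial>leb e)"
      proof (rule integral_cong_AE)
        show "AE x in leb e. (norm (f (Suc n) x - f n x))\<^sup>2 = V e x * (cmod ((u (Suc n) - u n) e x))\<^sup>2"
          using sqf[of "\<lambda>x. u (Suc n) e x - u n e x"] unfolding f_def
          by eventually_elim (simp add: right_diff_distrib)
      qed (use fm in measurable, simp)
      also have "\<dots> \<le> (1/4) ^ n" using edge_V_le[OF du e, of n] step[of n] by linarith
      finally show ?thesis .
    qed
    obtain h where h: "h \<in> borel_measurable (leb e)" "integrable (leb e) (\<lambda>x. (norm (h x))\<^sup>2)"
      "AE x in leb e. (\<lambda>n. f n x) \<longlonglongrightarrow> h x"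
      "\<And>n. integrable (leb e) (\<lambda>x. (norm (f n x - h x))\<^sup>2)"
      "(\<lambda>n. \<integral>x. (norm (f n x - h x))\<^sup>2 \<partial>leb e) \<longlonglongrightarrow> 0"
      using L2_complete[OF fm fi st] by blast
    have sp: "AE x in leb e. x \<in> edge_dom G e" by (rule AE_I2) simp
    have hv: "AE x in leb e. h x = of_real (sqrt (V e x)) * v e x"
      using h(3) sp
    proof eventually_elim
      case (elim x)
      have "(\<lambda>n. f n x) \<longlonglongrightarrow> of_real (sqrt (V e x)) * v e x"
        unfolding f_def using point[OF e elim(2)] by (intro tendsto_intros)
      then show ?case using elim(1) LIMSEQ_unique by blast
    qed
    have ae1: "AE x in leb e. (norm (h x))\<^sup>2 = V e x * (cmod (v e x))\<^sup>2"
      using hv sqf[of "v e"] by eventually_elim simp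
    have ae2: "AE x in leb e. (norm (f n x - h x))\<^sup>2 = V e x * (cmod (u n e x - v e x))\<^sup>2" for n
      using hv sqf[of "\<lambda>x. u n e x - v e x"] unfolding f_def by eventually_elim (simp add: right_diff_distrib)
    have i1: "integrable (leb e) (\<lambda>x. V e x * (cmod (v e x))\<^sup>2)"
      by (rule integrable_cong_AE_imp[OF h(2) _ ae1]) measurable
    have i2: "integrable (leb e) (\<lambda>x. V e x * (cmod (u n e x - v e x))\<^sup>2)" for n
      by (rule integrable_cong_AE_imp[OF h(4) _ ae2]) measurable
    have "(\<integral>x. (norm (f n x - h x))\<^sup>2 \<partial>leb e) = (\<integral>x. V e x * (cmod (u n e x - v e x))\<^sup>2 \<partial>leb e)" for n
      using h(4) i2 ae2 by (intro integral_cong_AE) auto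
    then show ?thesis using i1 i2 h(5) by simp
  qed
  define w where "w e x = \<i> * (g e x + of_real (A e x) * v e x)" for e x
  have hw: "has_weak_deriv G v w" unfolding has_weak_deriv_def
  proof
    fix e assume e: "e \<in> edges G"
    have inc: "\<exists>L>0. {0..L} \<subseteq> edge_dom G e \<and> K \<subseteq> {0..L}" if K: "compact K" "K \<subseteq> interior (edge_dom G e)" for K
      using e
    proof (rule edge_dom_cases)
      show ?thesis if "l > 0" "edge_dom G e = {0..l}" for l
        using that K interior_subset by (intro exI[of _ l]) auto
      assume S: "edge_dom G e = {0..}"
      obtain M where M: "\<forall>x\<in>K. \<bar>x\<bar> \<le> M"
        using compact_imp_bounded[OF K(1)] unfolding bounded_iff real_norm_def by blast
      have "K \<subseteq> {0..\<bar>M\<bar> + 1}"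
      proof
        fix x assume x: "x \<in> K"
        then have "x \<in> edge_dom G e" using K(2) interior_subset by blast
        then show "x \<in> {0..\<bar>M\<bar> + 1}" using bspec[OF M x] unfolding S by auto
      qed
      then show ?thesis unfolding S by (intro exI[of _ "\<bar>M\<bar> + 1"]) auto
    qed
    have Ks: "K \<in> sets lebesgue" if "compact K" for K :: "real set" using that lmeasurable_compact by blast
    have wL: "v e absolutely_integrable_on {0..L}" "w e absolutely_integrable_on {0..L}"
      if L: "{0..L} \<subseteq> edge_dom G e" "L > 0" for L
      using absolutely_integrable_continuous_real[OF contL[OF e L]]
        set_integral_add(1)[OF square_integrable_Icc(1)[OF g[OF e] e L(1)] A_times_continuous[OF e L(1) contL[OF e L]]]
      unfolding w_def[abs_def] by (auto intro!: set_integrable_mult_right)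
    show "weak_deriv_on (interior (edge_dom G e)) (v e) (w e)"
    proof (rule weak_deriv_on_limit[of _ "\<lambda>n. u n e" "\<lambda>n. weak_deriv G (u n) e"])
      show "weak_deriv_on (interior (edge_dom G e)) (u n e) (weak_deriv G (u n) e)" for n
        using H_weak_deriv[OF u] e by (simp add: has_weak_deriv_def)
      show "interior (edge_dom G e) \<in> sets lebesgue" by simp
      fix K assume K: "compact K" "K \<subseteq> interior (edge_dom G e)"
      obtain L where L: "L > 0" "{0..L} \<subseteq> edge_dom G e" "K \<subseteq> {0..L}" using inc[OF K] by blast
      show vK: "v e absolutely_integrable_on K" "w e absolutely_integrable_on K"
        using set_integrable_subset[OF wL(1)[OF L(2,1)] Ks[OF K(1)] L(3)]
          set_integrable_subset[OF wL(2)[OF L(2,1)] Ks[OF K(1)] L(3)] by auto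
      obtain C where C: "\<And>n x. x \<in> {0..L} \<Longrightarrow> cmod (u n e x - v e x) \<le> C * (1/2) ^ n" using geo[OF e L(2,1)] by blast
      have contu: "continuous_on {0..L} (u n e)" for n using H_continuous[OF u e] L(2) continuous_on_subset by blast
      have Aint: "(\<lambda>x. \<bar>A e x\<bar>) absolutely_integrable_on {0..L}"
        using set_integrable_abs[OF A_Icc[OF e L(2)]] .
      have Dg: "(\<lambda>x. cmod (D (u n) e x - g e x)) absolutely_integrable_on {0..L}" for n
        by (intro set_integrable_norm set_integral_diff square_integrable_Icc[OF _ e L(2)] H_D[OF u e] g[OF e])
      have lim2: "(\<lambda>n. C * (1/2) ^ n) \<longlonglongrightarrow> C * 0" by (intro tendsto_intros LIMSEQ_power_zero) auto
      show "(\<lambda>n. LINT x:K|lebesgue. cmod (u n e x - v e x)) \<longlonglongrightarrow> 0"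
      proof (rule Lim_null_comparison)
        have "(\<lambda>n. (C * (1/2) ^ n) * L) \<longlonglongrightarrow> (C * 0) * L" by (intro tendsto_mult lim2 tendsto_const)
        then show "(\<lambda>n. (C * (1/2) ^ n) * L) \<longlonglongrightarrow> 0" by simp
        have "norm (LINT x:K|lebesgue. cmod (u n e x - v e x)) \<le> (C * (1/2) ^ n) * L" for n
        proof -
          have i: "(\<lambda>x. cmod (u n e x - v e x)) absolutely_integrable_on {0..L}"
            by (intro absolutely_integrable_continuous_real continuous_intros contu contL[OF e L(2,1)])
          have "norm (LINT x:K|lebesgue. cmod (u n e x - v e x)) \<le> (LINT x:{0..L}|lebesgue. cmod (u n e x - v e x))"
            by (rule set_integral_mono_subset[OF i Ks[OF K(1)] L(3)]) simp
          also have "\<dots> = integral {0..L} (\<lambda>x. cmod (u n e x - v e x))" using i by (rule set_lebesgue_integral_eq_integral)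
          also have "\<dots> \<le> integral {0..L} (\<lambda>x. C * (1/2) ^ n)"
            using C i by (intro integral_le set_lebesgue_integral_eq_integral(1)) auto
          also have "\<dots> = (C * (1/2) ^ n) * L" using L(1) by simp
          finally show ?thesis .
        qed
        then show "\<forall>\<^sub>F n in sequentially. norm (LINT x:K|lebesgue. cmod (u n e x - v e x)) \<le> (C * (1/2) ^ n) * L"
          by (intro always_eventually) blast
      qed
      show "(\<lambda>n. LINT x:K|lebesgue. cmod (weak_deriv G (u n) e x - w e x)) \<longlonglongrightarrow> 0"
      proof (rule Lim_null_comparison)
        define R where "R n = (LINT x:{0..L}|lebesgue. cmod (D (u n) e x - g e x)) + (C * (1/2) ^ n) * (LINT x:{0..L}|lebesgue. \<bar>A e x\<bar>)" for n
        have "(\<lambda>n. \<integral>x. cmod (D (u n) e x - g e x) \<partial>lebesgue_on {0..L}) \<longlonglongrightarrow> 0"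
        proof (rule L1_tendsto_0_if_L2)
          have dsq: "square_integrable (leb e) (\<lambda>x. D (u n) e x - g e x)" for n
            using square_integrable_lin[OF H_D[OF u e] g[OF e], of _ "-1"] by simp
          show "finite_measure (lebesgue_on {0..L})" by (rule finite_measure_lebesgue_on) simp
          show "(\<lambda>x. D (u n) e x - g e x) \<in> borel_measurable (lebesgue_on {0..L})" for n
            using dsq measurable_restrict_mono[OF _ L(2)] by (auto simp: square_integrable_def)
          show "integrable (lebesgue_on {0..L}) (\<lambda>x. (cmod (D (u n) e x - g e x))\<^sup>2)" for n
            using square_integrable_Icc(2)[OF dsq e L(2)] by (simp add: set_integrable_lebesgue_on)
          have le: "(\<integral>x. (cmod (D (u n) e x - g e x))\<^sup>2 \<partial>lebesgue_on {0..L}) \<le> (\<integral>x. (cmod (D (u n) e x - g e x))\<^sup>2 \<partial>leb e)" for n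
            using square_integrable_Icc(3)[OF dsq e L(2)] set_lebesgue_integral_eq_integral(2)[OF square_integrable_Icc(2)[OF dsq e L(2)]]
            by (simp add: set_integral_lebesgue_on)
          show "(\<lambda>n. \<integral>x. (cmod (D (u n) e x - g e x))\<^sup>2 \<partial>lebesgue_on {0..L}) \<longlonglongrightarrow> 0"
            by (rule tendsto_sandwich[OF _ _ tendsto_const[of 0] glim[OF e]]) (auto intro!: always_eventually le)
        qed
        then have limD: "(\<lambda>n. LINT x:{0..L}|lebesgue. cmod (D (u n) e x - g e x)) \<longlonglongrightarrow> 0" by (simp add: set_integral_lebesgue_on)
        have "R \<longlonglongrightarrow> 0 + (C * 0) * (LINT x:{0..L}|lebesgue. \<bar>A e x\<bar>)"
          unfolding R_def by (intro tendsto_add tendsto_mult limD lim2 tendsto_const)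
        then show "R \<longlonglongrightarrow> 0" by simp
        have "norm (LINT x:K|lebesgue. cmod (weak_deriv G (u n) e x - w e x)) \<le> R n" for n
        proof -
          have wn: "weak_deriv G (u n) e absolutely_integrable_on {0..L}"
            unfolding weak_deriv_formula[abs_def]
            by (intro set_integrable_mult_right set_integral_add square_integrable_Icc[OF H_D[OF u e] e L(2)] A_times_continuous[OF e L(2) contu])
          have i: "(\<lambda>x. cmod (weak_deriv G (u n) e x - w e x)) absolutely_integrable_on {0..L}"
            by (intro set_integrable_norm set_integral_diff wn wL[OF L(2,1)])
          have AC: "(\<lambda>x. (C * (1/2) ^ n) * \<bar>A e x\<bar>) absolutely_integrable_on {0..L}"
            by (intro set_integrable_mult_right Aint)
          have "norm (LINT x:K|lebesgue. cmod (weak_deriv G (u n) e x - w e x)) \<le> (LINT x:{0..L}|lebesgue. cmod (weak_deriv G (u n) e x - w e x))"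
            by (rule set_integral_mono_subset[OF i Ks[OF K(1)] L(3)]) simp
          also have "\<dots> \<le> (LINT x:{0..L}|lebesgue. cmod (D (u n) e x - g e x) + (C * (1/2) ^ n) * \<bar>A e x\<bar>)"
          proof (rule set_integral_mono[OF i set_integral_add(1)[OF Dg AC]])
            fix x assume x: "x \<in> {0..L}"
            have "weak_deriv G (u n) e x - w e x = \<i> * ((D (u n) e x - g e x) + of_real (A e x) * (u n e x - v e x))"
              by (simp add: weak_deriv_formula w_def algebra_simps)
            then have "cmod (weak_deriv G (u n) e x - w e x) = cmod ((D (u n) e x - g e x) + of_real (A e x) * (u n e x - v e x))"
              by (simp add: norm_mult)
            also have "\<dots> \<le> cmod (D (u n) e x - g e x) + \<bar>A e x\<bar> * cmod (u n e x - v e x)"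
              by (rule order_trans[OF norm_triangle_ineq]) (simp add: norm_mult)
            also have "\<bar>A e x\<bar> * cmod (u n e x - v e x) \<le> \<bar>A e x\<bar> * (C * (1/2) ^ n)" using C[OF x] by (intro mult_left_mono) auto
            finally show "cmod (weak_deriv G (u n) e x - w e x) \<le> cmod (D (u n) e x - g e x) + (C * (1/2) ^ n) * \<bar>A e x\<bar>"
              by (simp add: mult.commute)
          qed
          also have "\<dots> = R n" unfolding R_def by (subst set_integral_add(2)[OF Dg AC]) (simp only: set_integral_mult_right)
          finally show ?thesis .
        qed
        then show "\<forall>\<^sub>F n in sequentially. norm (LINT x:K|lebesgue. cmod (weak_deriv G (u n) e x - w e x)) \<le> R n"
          by (intro always_eventually) blast
      qed
    qed
  qed
  have ae: "AE x in leb e. (1 / \<i>) * w e x - of_real (A e x) * v e x = g e x" for e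
    by (rule AE_I2) (simp add: w_def algebra_simps)
  have vH: "v \<in> H" and Dv: "\<And>e. e \<in> edges G \<Longrightarrow> AE x in leb e. D v e x = g e x"
    using H_I[OF gc hw g ae] Vpart by blast+
  have uv: "u n - v \<in> H" for n using u vH subspace_diff[OF subspace_H] by blast
  have "mag_normsq G A V (u n - v) = (\<Sum>e\<in>edges G. (\<integral>x. (cmod (D (u n) e x - g e x))\<^sup>2 \<partial>leb e) + (\<integral>x. V e x * (cmod (u n e x - v e x))\<^sup>2 \<partial>leb e))" for n
    unfolding mag_normsq_def graph_integral_eq[OF order_refl]
  proof (rule sum.cong[OF refl])
    fix e assume e: "e \<in> edges G"
    have "AE x in leb e. (cmod (D (u n - v) e x))\<^sup>2 + V e x * (cmod ((u n - v) e x))\<^sup>2 = (cmod (D (u n) e x - g e x))\<^sup>2 + V e x * (cmod (u n e x - v e x))\<^sup>2"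
      using H_diff[OF u vH e, of n] Dv[OF e] by eventually_elim simp
    then have "(\<integral>x. (cmod (D (u n - v) e x))\<^sup>2 + V e x * (cmod ((u n - v) e x))\<^sup>2 \<partial>leb e)
        = (\<integral>x. (cmod (D (u n) e x - g e x))\<^sup>2 + V e x * (cmod (u n e x - v e x))\<^sup>2 \<partial>leb e)"
      using H_D[OF uv e] H_V[OF uv e] gint[OF e] Vpart[OF e]
      by (intro integral_cong_AE borel_measurable_integrable Bochner_Integration.integrable_add) (auto simp: square_integrable_def)
    then show "(\<integral>x. (cmod (D (u n - v) e x))\<^sup>2 + V e x * (cmod ((u n - v) e x))\<^sup>2 \<partial>leb e)
        = (\<integral>x. (cmod (D (u n) e x - g e x))\<^sup>2 \<partial>leb e) + (\<integral>x. V e x * (cmod (u n e x - v e x))\<^sup>2 \<partial>leb e)"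
      using gint[OF e] Vpart[OF e] by simp
  qed
  moreover have "(\<lambda>n. \<Sum>e\<in>edges G. (\<integral>x. (cmod (D (u n) e x - g e x))\<^sup>2 \<partial>leb e) + (\<integral>x. V e x * (cmod (u n e x - v e x))\<^sup>2 \<partial>leb e)) \<longlonglongrightarrow> (\<Sum>e\<in>edges G. 0 + 0)"
    using glim Vpart by (intro tendsto_sum tendsto_add) auto
  ultimately have "(\<lambda>n. mag_normsq G A V (u n - v)) \<longlonglongrightarrow> 0" by simp
  then show ?thesis using vH by blast
qed

end

section \<open>The power nonlinearity on the core\<close>

text \<open>Away from zero this is the chain rule for \<open>(|z|\<^sup>2)\<^bsup>p/2\<^esup>\<close>. At a zero of \<open>a + t c\<close> the function is
  \<open>|s - t|\<^sup>p |c|\<^sup>p\<close> of the variable \<open>s\<close>, which has derivative zero since \<open>p > 1\<close>.\<close>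

lemma norm_powr_has_derivative:
  fixes a c :: complex
  assumes p: "p > 2"
  shows "((\<lambda>t. cmod (a + of_real t * c) powr p) has_real_derivative
    p * (cmod (a + of_real t * c) powr (p - 2) * Re ((a + of_real t * c) * cnj c))) (at t)"
proof (cases "a + of_real t * c = 0")
  case False
  define g where "g s = (Re a + s * Re c)\<^sup>2 + (Im a + s * Im c)\<^sup>2" for s
  have g: "(cmod (a + of_real s * c))\<^sup>2 = g s" for s by (simp add: g_def cmod_power2)
  have half: "x powr q = (x\<^sup>2) powr (q / 2)" if "x \<ge> 0" for x q :: real
  proof (cases "x = 0")
    case False
    then have "(x powr 2) powr (q / 2) = x powr q" using that by (subst powr_powr) simp
    then show ?thesis using that False by simp
  qed simp
  have gt: "g t > 0" unfolding g[symmetric] using False by simp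
  have dg: "(g has_real_derivative 2 * Re ((a + of_real t * c) * cnj c)) (at t)"
    unfolding g_def[abs_def] by (auto intro!: derivative_eq_intros simp: algebra_simps)
  have "((\<lambda>s. g s powr (p / 2)) has_real_derivative p / 2 * g t powr (p / 2 - 1) * (2 * Re ((a + of_real t * c) * cnj c))) (at t)"
    using DERIV_fun_powr[OF dg gt, of "p / 2"] by simp
  moreover have "g t powr (p / 2 - 1) = cmod (a + of_real t * c) powr (p - 2)"
    using half[of "cmod (a + of_real t * c)" "p - 2"] by (simp add: g diff_divide_distrib)
  moreover have "(\<lambda>s. cmod (a + of_real s * c) powr p) = (\<lambda>s. g s powr (p / 2))"
    using half[of "cmod (a + of_real _ * c)" p] by (simp add: g fun_eq_iff)
  moreover have "p / 2 * x * (2 * y) = p * (x * y)" for x y :: real by simp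
  ultimately show ?thesis by (simp only:)
next
  case True
  have e: "cmod (a + of_real (t + h) * c) = \<bar>h\<bar> * cmod c" for h
  proof -
    have "a + of_real (t + h) * c = (a + of_real t * c) + of_real h * c" by (simp add: algebra_simps)
    then show ?thesis unfolding True by (simp add: norm_mult)
  qed
  have "((\<lambda>h. \<bar>h\<bar> powr (p - 1) * cmod c powr p) \<longlongrightarrow> 0 * cmod c powr p) (at 0)"
    using p by (intro tendsto_mult tendsto_const tendsto_zero_powrI[where b = "p - 1"]) (auto intro!: tendsto_eq_intros)
  then have lim: "((\<lambda>h. \<bar>h\<bar> powr (p - 1) * cmod c powr p) \<longlongrightarrow> 0) (at 0)" by simp
  have "((\<lambda>h. (cmod (a + of_real (t + h) * c) powr p - cmod (a + of_real t * c) powr p) / h) \<longlongrightarrow> 0) (at 0)"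
  proof (rule Lim_null_comparison[OF _ lim])
    have "norm ((cmod (a + of_real (t + h) * c) powr p - cmod (a + of_real t * c) powr p) / h) \<le> \<bar>h\<bar> powr (p - 1) * cmod c powr p"
      if "h \<noteq> 0" for h
    proof -
      have "\<bar>h\<bar> powr p = \<bar>h\<bar> powr (p - 1) * \<bar>h\<bar>" using that powr_add[of "\<bar>h\<bar>" "p - 1" 1] by simp
      then have "\<bar>h\<bar> powr p / \<bar>h\<bar> = \<bar>h\<bar> powr (p - 1)" using that by simp
      moreover have "\<bar>h\<bar> powr p * cmod c powr p / \<bar>h\<bar> = \<bar>h\<bar> powr p / \<bar>h\<bar> * cmod c powr p" by simp
      ultimately show ?thesis unfolding e True by (simp add: powr_mult abs_mult)
    qed
    then show "\<forall>\<^sub>F h in at 0. norm ((cmod (a + of_real (t + h) * c) powr p - cmod (a + of_real t * c) powr p) / h) \<le> \<bar>h\<bar> powr (p - 1) * cmod c powr p"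
      unfolding eventually_at_filter by (intro always_eventually) blast
  qed
  then show ?thesis unfolding DERIV_def True by simp
qed

context magnetic_graph
begin

lemma bounded_edge_continuous:
  assumes "e \<in> bounded_edges G" "u \<in> H" shows "continuous_on (edge_dom G e) (u e)"
  using H_continuous assms bounded_edges_sub by blast

lemma l2_null_zero_on:
  assumes u: "u \<in> H" and z: "l2_normsq G u = 0"
  shows "zero_on G (edges G) u"
  unfolding zero_on_def
proof (intro ballI)
  fix e x assume e: "e \<in> edges G" and x: "x \<in> edge_dom G e"
  obtain L where L: "L > 0" "{0..L} \<subseteq> edge_dom G e" "x \<in> {0..L}"
    using e
  proof (rule edge_dom_cases)
    show thesis if "l > 0" "edge_dom G e = {0..l}" for l
      using that x \<open>\<And>L. L > 0 \<Longrightarrow> {0..L} \<subseteq> edge_dom G e \<Longrightarrow> x \<in> {0..L} \<Longrightarrow> thesis\<close>[of l] by auto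
    show thesis if "edge_dom G e = {0..}"
      using that x \<open>\<And>L. L > 0 \<Longrightarrow> {0..L} \<subseteq> edge_dom G e \<Longrightarrow> x \<in> {0..L} \<Longrightarrow> thesis\<close>[of "x + 1"] by auto
  qed
  have cont: "continuous_on {0..L} (\<lambda>x. (cmod (u e x))\<^sup>2)"
    by (intro continuous_intros continuous_on_subset[OF H_continuous[OF u e] L(2)])
  have "(\<integral>x. (cmod (u e x))\<^sup>2 \<partial>leb e) \<le> l2_normsq G u"
    unfolding l2_normsq_def graph_integral_eq[OF order_refl] using e by (intro member_le_sum) auto
  then have "integral {0..L} (\<lambda>x. (cmod (u e x))\<^sup>2) \<le> 0"
    using square_integrable_Icc(3)[OF H_square_integrable[OF u e] e L(2)] z by linarith
  moreover have "integral {0..L} (\<lambda>x. (cmod (u e x))\<^sup>2) \<ge> 0"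
    by (intro integral_nonneg integrable_continuous_real cont) simp
  ultimately have "integral {0..L} (\<lambda>x. (cmod (u e x))\<^sup>2) = 0" by simp
  then have "\<forall>x\<in>{0..L}. (cmod (u e x))\<^sup>2 = 0"
    using integral_eq_0_iff[OF cont] L(1) by simp
  then show "u e x = 0" using L(3) by simp
qed

lemma zero_on_l2_null:
  assumes "zero_on G (edges G) u" shows "l2_normsq G u = 0"
proof -
  have "(\<integral>x. (cmod (u e x))\<^sup>2 \<partial>leb e) = (\<integral>x. 0 \<partial>leb e)" if "e \<in> edges G" for e
    using assms that by (intro Bochner_Integration.integral_cong) (auto simp: zero_on_def)
  then show ?thesis by (simp add: l2_normsq_def graph_integral_eq)
qed

end

locale magnetic_graph_power = magnetic_graph G A V
  for G :: "('v, 'e) metric_graph" and A V :: "'e \<Rightarrow> real \<Rightarrow> real" +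
  fixes p :: real
  assumes p: "p > 2"
begin

text \<open>The integrands are continuous on compact intervals, so the gauge integral agrees with the Lebesgue
  integral; it is the one to which Leibniz' rule below refers.\<close>

definition core_power :: "('e \<Rightarrow> real \<Rightarrow> complex) \<Rightarrow> real" where
  "core_power u = (\<Sum>e\<in>bounded_edges G. integral (edge_dom G e) (\<lambda>x. cmod (u e x) powr p))"

definition core_pairing :: "('e \<Rightarrow> real \<Rightarrow> complex) \<Rightarrow> ('e \<Rightarrow> real \<Rightarrow> complex) \<Rightarrow> real" where
  "core_pairing u h = Re (graph_integral G (bounded_edges G)
     (\<lambda>e x. of_real (cmod (u e x) powr (p - 2)) * u e x * cnj (h e x)))"

lemma continuous_power:
  assumes "e \<in> bounded_edges G" "u \<in> H"
  shows "continuous_on (edge_dom G e) (\<lambda>x. cmod (u e x) powr p)"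
  using p by (intro continuous_on_powr' continuous_intros bounded_edge_continuous assms) auto

lemma power_integrable:
  assumes "e \<in> bounded_edges G" "u \<in> H"
  shows "(\<lambda>x. cmod (u e x) powr p) integrable_on edge_dom G e"
  using continuous_power[OF assms] integrable_continuous_real by (metis edge_dom_bounded[OF assms(1)])

lemma core_power_nonneg: "u \<in> H \<Longrightarrow> 0 \<le> core_power u"
  unfolding core_power_def by (intro sum_nonneg integral_nonneg power_integrable) auto

lemma core_power_scale:
  assumes u: "u \<in> H" shows "core_power (c *\<^sub>R u) = \<bar>c\<bar> powr p * core_power u"
  unfolding core_power_def sum_distrib_left by (simp add: norm_mult powr_mult)

lemma core_power_pos:
  assumes u: "u \<in> H" and nz: "\<not> zero_on G (bounded_edges G) u"
  shows "core_power u > 0"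
proof -
  obtain e x where e: "e \<in> bounded_edges G" and x: "x \<in> edge_dom G e" "u e x \<noteq> 0"
    using nz unfolding zero_on_def by blast
  obtain l where l: "l > 0" "edge_dom G e = {0..l}" using edge_dom_bounded[OF e] by metis
  have "integral {0..l} (\<lambda>x. cmod (u e x) powr p) \<noteq> 0"
    using integral_eq_0_iff[OF continuous_power[OF e u, unfolded l]] l x by auto
  then have "integral (edge_dom G e) (\<lambda>x. cmod (u e x) powr p) > 0"
    using integral_nonneg[OF power_integrable[OF e u]] unfolding l(2) by fastforce
  moreover have "integral (edge_dom G e) (\<lambda>x. cmod (u e x) powr p) \<le> core_power u"
    unfolding core_power_def using e by (intro member_le_sum integral_nonneg power_integrable u) auto
  ultimately show ?thesis by linarith
qed

lemma core_power_null:
  assumes u: "u \<in> H" and z: "l2_normsq G u = 0" shows "core_power u = 0"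
proof -
  have "integral (edge_dom G e) (\<lambda>x. cmod (u e x) powr p) = integral (edge_dom G e) (\<lambda>x. 0)"
    if "e \<in> bounded_edges G" for e
    using l2_null_zero_on[OF assms] that bounded_edges_sub
    by (intro Henstock_Kurzweil_Integration.integral_cong) (auto simp: zero_on_def)
  then show ?thesis by (simp add: core_power_def)
qed

lemma core_power_continuous:
  assumes u: "\<And>n. u n \<in> H" and v: "v \<in> H" and lim: "(\<lambda>n. core_sup (u n - v)) \<longlonglongrightarrow> 0"
  shows "(\<lambda>n. core_power (u n)) \<longlonglongrightarrow> core_power v"
  unfolding core_power_def
proof (rule tendsto_sum)
  fix e assume e: "e \<in> bounded_edges G"
  obtain l where l: "l > 0" "edge_dom G e = {0..l}" using edge_dom_bounded[OF e] by metis
  have uv: "u n - v \<in> H" for n using u v subspace_diff[OF subspace_H] by blast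
  have close: "cmod (u n e x - v e x) \<le> core_sup (u n - v)" if "x \<in> edge_dom G e" for n x
    using core_sup_ge(2)[OF uv e that, of n] by simp
  obtain K where K: "\<And>n. norm (core_sup (u n - v)) \<le> K"
    using lim convergent_imp_Bseq convergentI BseqE by metis
  define C where "C = K + core_sup v"
  have bd: "cmod (u n e x) \<le> C" if x: "x \<in> edge_dom G e" for n x
    using norm_triangle_sub[of "u n e x" "v e x"] close[OF x, of n] K[of n] core_sup_ge(2)[OF v e x] unfolding C_def by simp
  show "(\<lambda>n. integral (edge_dom G e) (\<lambda>x. cmod (u n e x) powr p)) \<longlonglongrightarrow> integral (edge_dom G e) (\<lambda>x. cmod (v e x) powr p)"
  proof (rule dominated_convergence(2))
    show "(\<lambda>x. cmod (u n e x) powr p) integrable_on edge_dom G e" for n by (rule power_integrable[OF e u])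
    show "(\<lambda>x. C powr p) integrable_on edge_dom G e" unfolding l(2) by (rule integrable_const_ivl)
    show "norm (cmod (u n e x) powr p) \<le> C powr p" if "x \<in> edge_dom G e" for n x
      using bd[OF that] p by (simp add: powr_mono2)
    show "(\<lambda>n. cmod (u n e x) powr p) \<longlonglongrightarrow> cmod (v e x) powr p" if x: "x \<in> edge_dom G e" for x
    proof -
      have "(\<lambda>n. u n e x - v e x) \<longlonglongrightarrow> 0"
        by (rule Lim_null_comparison[OF _ lim]) (auto intro!: always_eventually close[OF x])
      then have "(\<lambda>n. u n e x) \<longlonglongrightarrow> v e x" by (simp add: LIM_zero_iff)
      then show ?thesis using p by (intro tendsto_powr' tendsto_norm tendsto_const) auto
    qed
  qed
qed

lemma core_power_derivative:
  assumes u: "u \<in> H" and h: "h \<in> H"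
  shows "((\<lambda>t. core_power (u + t *\<^sub>R h)) has_real_derivative p * core_pairing u h) (at 0)"
proof -
  define F where "F e t x = cmod (u e x + of_real t * h e x) powr p" for e t x
  define F' where "F' e t x = p * (cmod (u e x + of_real t * h e x) powr (p - 2) * Re ((u e x + of_real t * h e x) * cnj (h e x)))" for e t x
  have edge: "((\<lambda>t. integral (edge_dom G e) (F e t)) has_real_derivative integral (edge_dom G e) (F' e 0)) (at 0)"
    if e: "e \<in> bounded_edges G" for e
  proof -
    obtain l where l: "l > 0" "edge_dom G e = cbox 0 l" using edge_dom_bounded[OF e] by (metis box_real(2))
    have cu: "continuous_on (cbox 0 l) (u e)" "continuous_on (cbox 0 l) (h e)"
      using bounded_edge_continuous[OF e u] bounded_edge_continuous[OF e h] unfolding l by simp_all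
    have "((\<lambda>t. integral (cbox 0 l) (F e t)) has_field_derivative integral (cbox 0 l) (F' e 0)) (at 0 within UNIV)"
    proof (rule leibniz_rule_field_derivative)
      show "((\<lambda>t. F e t x) has_real_derivative F' e t x) (at t within UNIV)" for t x
        unfolding F_def F'_def using norm_powr_has_derivative[OF p] by simp
      show "F e t integrable_on cbox 0 l" for t
        unfolding F_def using p
        by (intro integrable_continuous continuous_on_powr' continuous_intros cu) auto
      have s: "continuous_on (UNIV \<times> cbox 0 l) (\<lambda>z. u e (snd z))" "continuous_on (UNIV \<times> cbox 0 l) (\<lambda>z. h e (snd z))"
        by (auto intro!: continuous_on_compose2[OF cu(1)] continuous_on_compose2[OF cu(2)] continuous_intros)
      show "continuous_on (UNIV \<times> cbox 0 l) (\<lambda>(t, x). F' e t x)"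
        unfolding F'_def split_beta using p
        by (intro continuous_on_powr' continuous_intros s) auto
    qed auto
    then show ?thesis by (simp add: l(2))
  qed
  have "((\<lambda>t. \<Sum>e\<in>bounded_edges G. integral (edge_dom G e) (F e t)) has_real_derivative (\<Sum>e\<in>bounded_edges G. integral (edge_dom G e) (F' e 0))) (at 0)"
    by (intro DERIV_sum edge)
  moreover have "(\<lambda>t. core_power (u + t *\<^sub>R h)) = (\<lambda>t. \<Sum>e\<in>bounded_edges G. integral (edge_dom G e) (F e t))"
    by (simp add: core_power_def F_def[abs_def] fun_eq_iff)
  moreover have "(\<Sum>e\<in>bounded_edges G. integral (edge_dom G e) (F' e 0)) = p * core_pairing u h"
    unfolding core_pairing_def graph_integral_def Re_sum sum_distrib_left
  proof (rule sum.cong[OF refl])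
    fix e assume e: "e \<in> bounded_edges G"
    obtain l where l: "l > 0" "edge_dom G e = {0..l}" using edge_dom_bounded[OF e] by metis
    define f where "f x = of_real (cmod (u e x) powr (p - 2)) * u e x * cnj (h e x)" for x
    have cu: "continuous_on {0..l} (u e)" "continuous_on {0..l} (h e)"
      using bounded_edge_continuous[OF e u] bounded_edge_continuous[OF e h] unfolding l by simp_all
    have cf: "continuous_on {0..l} f"
      unfolding f_def using p by (intro continuous_intros continuous_on_powr' cu) auto
    have "(LINT x:{0..l}|lebesgue. f x) = integral {0..l} f"
      by (intro set_lebesgue_integral_eq_integral absolutely_integrable_continuous_real cf)
    moreover have "Re (integral {0..l} f) = integral {0..l} (\<lambda>x. Re (f x))"
      using integral_linear[OF integrable_continuous_real[OF cf] bounded_linear_Re] by (simp add: o_def)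
    moreover have "F' e 0 = (\<lambda>x. p * Re (f x))"
      by (simp add: F'_def f_def fun_eq_iff algebra_simps)
    then have "integral {0..l} (F' e 0) = p * integral {0..l} (\<lambda>x. Re (f x))" by simp
    ultimately show "integral (edge_dom G e) (F' e 0) = p * Re (LINT x:edge_dom G e|lebesgue. of_real (cmod (u e x) powr (p - 2)) * u e x * cnj (h e x))"
      unfolding l(2) f_def by simp
  qed
  ultimately show ?thesis by (simp only:)
qed

sublocale variational_problem H energy_form mass_form core_sup core_power core_pairing p
proof
  show "\<exists>C. \<forall>u\<in>H. energy_form u u \<le> 1 \<longrightarrow> core_sup u \<le> C"
    using core_sup_bound by (simp add: mag_form_self)
  show "\<exists>r :: nat \<Rightarrow> nat. strict_mono r \<and> (\<forall>e>0. \<exists>M. \<forall>m\<ge>M. \<forall>n\<ge>M. core_sup (u (r m) - u (r n)) \<le> e)"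
    if "\<And>n. u n \<in> H" "\<And>n. energy_form (u n) (u n) \<le> K" for u K
    using core_compactness[of u K] that by (simp add: mag_form_self)
  show "\<exists>v\<in>H. (\<lambda>n. energy_form (u n - v) (u n - v)) \<longlonglongrightarrow> 0"
    if "\<And>n. u n \<in> H" "\<And>n. energy_form (u (Suc n) - u n) (u (Suc n) - u n) \<le> (1/4) ^ n" for u
    using H_complete[of u] that by (simp add: mag_form_self)
  show "core_power u = 0" if "u \<in> H" "mass_form u u = 0" for u
    using core_power_null that by (simp add: l2_inner_self)
qed (use core_sup_triangle core_sup_scale core_power_continuous core_power_scale core_power_nonneg core_power_derivative p in blast)+

end

section \<open>The infimum of the Rayleigh quotient as an eigenvalue\<close>

context magnetic_graph
begin

lemma l2_normsq_pos: "u \<in> H \<Longrightarrow> \<not> zero_on G (edges G) u \<Longrightarrow> l2_normsq G u > 0"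
  using l2_null_zero_on l2_normsq_nonneg[of u] by fastforce

lemma lambda1_le:
  assumes u: "u \<in> H" shows "lambda1 G A V * l2_normsq G u \<le> mag_normsq G A V u"
proof (cases "zero_on G (edges G) u")
  case True
  then show ?thesis using zero_on_l2_null[OF True] l2_le_mag[OF u] by simp
next
  case False
  then have pos: "l2_normsq G u > 0" using l2_normsq_pos u by blast
  have "lambda1 G A V \<le> mag_normsq G A V u / l2_normsq G u"
    unfolding lambda1_def
  proof (rule cInf_lower)
    show "bdd_below {mag_normsq G A V u / l2_normsq G u |u. u \<in> H \<and> \<not> zero_on G (edges G) u}"
    proof (rule bdd_belowI[of _ 0])
      fix x assume "x \<in> {mag_normsq G A V u / l2_normsq G u |u. u \<in> H \<and> \<not> zero_on G (edges G) u}"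
      then obtain v where "x = mag_normsq G A V v / l2_normsq G v" "v \<in> H" by blast
      then show "0 \<le> x" using l2_le_mag[of v] l2_normsq_nonneg[of v] by simp
    qed
  qed (use u False in blast)
  then show ?thesis using pos by (simp add: field_simps)
qed

lemma ae_eq_iff: "ae_eq G u v \<longleftrightarrow> (\<forall>e\<in>edges G. AE x in leb e. u e x = v e x)"
  by (auto simp: ae_eq_def AE_restrict_space_iff)

lemma ae_eq_l2_inner:
  assumes "ae_eq G u u'" "u \<in> L2 G" "u' \<in> L2 G" "v \<in> L2 G"
  shows "l2_inner G u v = l2_inner G u' v"
  unfolding l2_inner_eq
proof (rule sum.cong[OF refl])
  fix e assume e: "e \<in> edges G"
  have sq: "square_integrable (leb e) (u e)" "square_integrable (leb e) (u' e)" "square_integrable (leb e) (v e)"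
    using assms(2-4) e by (simp_all add: L2_eq)
  show "(\<integral>x. u e x * cnj (v e x) \<partial>leb e) = (\<integral>x. u' e x * cnj (v e x) \<partial>leb e)"
  proof (rule integral_cong_AE)
    have "AE x in leb e. u e x = u' e x" using assms(1) e by (simp add: ae_eq_iff)
    then show "AE x in leb e. u e x * cnj (v e x) = u' e x * cnj (v e x)" by eventually_elim simp
  qed (intro borel_measurable_integrable square_integrable_product sq)+
qed

lemma zero_on_ae_eq:
  assumes "zero_on G (edges G) u" shows "ae_eq G u (\<lambda>e x. 0)"
  using assms by (auto simp: ae_eq_iff zero_on_def intro!: AE_I2)

lemma l2_inner_scale: "l2_inner G (\<lambda>e x. z * u e x) v = z * l2_inner G u v"
  unfolding l2_inner_eq sum_distrib_left by (simp add: mult.assoc)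

lemma eigenvalue_form:
  assumes T: "is_mag_schroedinger G A V T" and ev: "eigenvalue G T z"
  obtains u where "u \<in> H" "\<not> zero_on G (edges G) u"
    "\<And>v. v \<in> H \<Longrightarrow> mag_form G A V u v = z * l2_inner G u v"
proof -
  obtain u where u: "(u, \<lambda>e x. z * u e x) \<in> T" "\<not> ae_eq G u (\<lambda>e x. 0)"
    using ev by (auto simp: eigenvalue_def eigenspace_def)
  obtain u' where u': "u' \<in> H" "ae_eq G u u'"
    "\<And>v. v \<in> H \<Longrightarrow> mag_form G A V u' v = l2_inner G (\<lambda>e x. z * u e x) v"
    using T u(1) unfolding is_mag_schroedinger_def by fastforce
  have uL: "u \<in> L2 G" using T u(1) unfolding is_mag_schroedinger_def self_adjoint_def linear_operator_def by blast
  show thesis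
  proof (rule that[OF u'(1)])
    show "\<not> zero_on G (edges G) u'"
    proof
      assume "zero_on G (edges G) u'"
      then have z: "ae_eq G u' (\<lambda>e x. 0)" by (rule zero_on_ae_eq)
      have "ae_eq G u (\<lambda>e x. 0)" unfolding ae_eq_iff
      proof
        fix e assume e: "e \<in> edges G"
        have "AE x in leb e. u e x = u' e x" "AE x in leb e. u' e x = 0"
          using u'(2) z e by (simp_all add: ae_eq_iff)
        then show "AE x in leb e. u e x = 0" by eventually_elim simp
      qed
      then show False using u(2) by blast
    qed
    show "mag_form G A V u' v = z * l2_inner G u' v" if v: "v \<in> H" for v
      using u'(3)[OF v] ae_eq_l2_inner[OF u'(2) uL H_L2[OF u'(1)] H_L2[OF v]] by (simp add: l2_inner_scale)
  qed
qed

text \<open>If \<open>\<lambda>\<^sub>1\<close> were in the resolvent set, every \<open>u\<close> could be written as \<open>(T - \<lambda>\<^sub>1) w\<close> with \<open>w\<close> bounded by \<open>u\<close> in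
  \<open>L\<^sup>2\<close>. Nonnegativity of the form of \<open>T - \<lambda>\<^sub>1\<close> at \<open>u - s w\<close> then bounds the form at \<open>u\<close> below by
  a positive multiple of the mass, against the choice of \<open>\<lambda>\<^sub>1\<close>.\<close>

lemma lambda1_in_spectrum:
  assumes T: "is_mag_schroedinger G A V T" and u0: "u0 \<in> H" "\<not> zero_on G (edges G) u0"
  shows "of_real (lambda1 G A V) \<in> spectrum G T"
proof (rule ccontr)
  define \<Lambda> where "\<Lambda> = lambda1 G A V"
  assume "of_real (lambda1 G A V) \<notin> spectrum G T"
  then have res: "\<And>f. f \<in> L2 G \<Longrightarrow> \<exists>(u, h)\<in>T. ae_eq G (\<lambda>e x. h e x - of_real \<Lambda> * u e x) f"
    and "\<exists>C. \<forall>(u, h)\<in>T. l2_normsq G u \<le> C * l2_normsq G (\<lambda>e x. h e x - of_real \<Lambda> * u e x)"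
    by (auto simp: spectrum_def resolvent_set_def \<Lambda>_def)
  then obtain C where C: "\<And>u h. (u, h) \<in> T \<Longrightarrow> l2_normsq G u \<le> C * l2_normsq G (\<lambda>e x. h e x - of_real \<Lambda> * u e x)"
    by blast
  define C1 where "C1 = 1 + \<bar>C\<bar>"
  have C1: "C1 > 0" by (simp add: C1_def)
  have main: "(\<Lambda> + 1 / C1) * l2_normsq G u \<le> mag_normsq G A V u" if u: "u \<in> H" for u
  proof -
    have uL: "u \<in> L2 G" using u by (rule H_L2)
    obtain w h where wh: "(w, h) \<in> T" "ae_eq G (\<lambda>e x. h e x - of_real \<Lambda> * w e x) u" using res[OF uL] by blast
    have L: "w \<in> L2 G" "h \<in> L2 G"
      using T wh(1) unfolding is_mag_schroedinger_def self_adjoint_def linear_operator_def by blast+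
    obtain w' where w': "w' \<in> H" "ae_eq G w w'" "\<And>v. v \<in> H \<Longrightarrow> mag_form G A V w' v = l2_inner G h v"
      using T wh(1) unfolding is_mag_schroedinger_def by fastforce
    have fe: "(\<lambda>e x. h e x - of_real \<Lambda> * w e x) = h + (- \<Lambda>) *\<^sub>R w" by (simp add: fun_eq_iff)
    have hwL: "h + (- \<Lambda>) *\<^sub>R w \<in> L2 G"
      unfolding fe[symmetric] L2_eq using square_integrable_lin[of _ "h _" "w _" "- of_real \<Lambda>"] L
      by (auto simp: L2_eq)
    have ww: "l2_inner G w v = l2_inner G w' v" if "v \<in> L2 G" for v
      by (rule ae_eq_l2_inner[OF w'(2) L(1) H_L2[OF w'(1)] that])
    have uu: "l2_inner G (h + (- \<Lambda>) *\<^sub>R w) v = l2_inner G u v" if "v \<in> L2 G" for v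
      by (rule ae_eq_l2_inner[OF wh(2)[unfolded fe] hwL uL that])
    have key: "form 1 (- \<Lambda>) w' v = mass_form u v" if v: "v \<in> H" for v
    proof -
      have "mag_form G A V w' v - of_real \<Lambda> * l2_inner G w' v = l2_inner G u v"
        using w'(3)[OF v] ww[OF H_L2[OF v]] uu[OF H_L2[OF v]] l2_inner_lin[OF L(2,1) H_L2[OF v], of "- \<Lambda>"] by simp
      then have "Re (mag_form G A V w' v - of_real \<Lambda> * l2_inner G w' v) = mass_form u v" by simp
      then show ?thesis by (simp add: form_def)
    qed
    have nonneg: "0 \<le> form 1 (- \<Lambda>) v v" if "v \<in> H" for v
      using lambda1_le[OF that] by (simp add: form_def \<Lambda>_def mag_form_self l2_inner_self)
    define m where "m = l2_normsq G u"
    have m: "m \<ge> 0" by (simp add: m_def l2_normsq_nonneg)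
    have mw: "mass_form w' w' \<le> \<bar>C\<bar> * m"
    proof -
      have "l2_inner G w' w' = l2_inner G w w"
        using ww[OF H_L2[OF w'(1)]] ww[OF L(1)] l2_inner_cnj[of w w'] l2_inner_cnj[of w w]
        by (metis l2_inner_cnj)
      then have "mass_form w' w' = l2_normsq G w" by (simp add: l2_inner_self)
      also have "\<dots> \<le> C * l2_normsq G (h + (- \<Lambda>) *\<^sub>R w)" using C[OF wh(1)] unfolding fe .
      also have "l2_inner G (h + (- \<Lambda>) *\<^sub>R w) (h + (- \<Lambda>) *\<^sub>R w) = l2_inner G u u"
        using uu[OF hwL] uu[OF uL] l2_inner_cnj by metis
      then have "l2_normsq G (h + (- \<Lambda>) *\<^sub>R w) = m" by (simp add: l2_inner_self m_def)
      also have "C * m \<le> \<bar>C\<bar> * m" using m by (intro mult_right_mono) auto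
      finally show ?thesis .
    qed
    have "0 \<le> form 0 1 (u + (-1) *\<^sub>R w') (u + (-1) *\<^sub>R w')"
      using l2_normsq_nonneg by (simp add: form_def l2_inner_self)
    then have "2 * mass_form u w' \<le> m + mass_form w' w'"
      using form_expand[OF u w'(1), of 0 1 "-1"] by (simp add: form_def m_def l2_inner_self)
    then have uw: "2 * mass_form u w' \<le> C1 * m" using mw by (simp add: C1_def algebra_simps)
    \<comment> \<open>the linear gain \<open>2 s m\<close> beats the quadratic term, which is at most \<open>s m / 2\<close> for this \<open>s\<close>\<close>
    define s where "s = 1 / C1"
    have "0 \<le> form 1 (- \<Lambda>) (u + (- s) *\<^sub>R w') (u + (- s) *\<^sub>R w')"
      using u w'(1) subspace_add[OF subspace_H] subspace_scale[OF subspace_H] by (intro nonneg) blast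
    also have "\<dots> = form 1 (- \<Lambda>) u u + 2 * (- s) * form 1 (- \<Lambda>) u w' + (- s)\<^sup>2 * form 1 (- \<Lambda>) w' w'"
      by (rule form_expand[OF u w'(1)])
    also have "form 1 (- \<Lambda>) u w' = m"
      using key[OF u] form_sym[OF u w'(1)] by (simp add: m_def l2_inner_self)
    also have "form 1 (- \<Lambda>) w' w' = mass_form u w'" by (rule key[OF w'(1)])
    also have "form 1 (- \<Lambda>) u u = mag_normsq G A V u - \<Lambda> * m"
      by (simp add: form_def m_def l2_inner_self mag_form_self)
    finally have 1: "0 \<le> mag_normsq G A V u - \<Lambda> * m + 2 * (- s) * m + (- s)\<^sup>2 * mass_form u w'" .
    have "s\<^sup>2 * (2 * mass_form u w') \<le> s\<^sup>2 * (C1 * m)" using uw by (intro mult_left_mono) auto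
    also have "\<dots> = s * m" using C1 by (simp add: s_def power2_eq_square)
    finally have 2: "s\<^sup>2 * mass_form u w' \<le> s * m / 2" by simp
    have "s * m \<ge> 0" using C1 m by (simp add: s_def)
    then have "\<Lambda> * m + s * m \<le> mag_normsq G A V u" using 1 2 by simp
    then show ?thesis by (simp add: s_def m_def algebra_simps)
  qed
  have "\<Lambda> + 1 / C1 \<le> lambda1 G A V"
    unfolding lambda1_def
  proof (rule cInf_greatest)
    fix x assume "x \<in> {mag_normsq G A V u / l2_normsq G u |u. u \<in> H \<and> \<not> zero_on G (edges G) u}"
    then obtain u where u: "x = mag_normsq G A V u / l2_normsq G u" "u \<in> H" "\<not> zero_on G (edges G) u" by blast
    then show "\<Lambda> + 1 / C1 \<le> x" using main[OF u(2)] l2_normsq_pos[OF u(2,3)] by (simp add: pos_le_divide_eq)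
  qed (use u0 in blast)
  then show False using C1 by (simp add: \<Lambda>_def)
qed

text \<open>An eigenvalue is a Rayleigh quotient, hence at least \<open>\<lambda>\<^sub>1\<close>. So \<open>\<lambda>\<^sub>1\<close> lies below the essential spectrum,
  and being in the spectrum it is an eigenvalue.\<close>

lemma hyp_Gm_lambda1_attained:
  assumes m: "m \<ge> 1" and Gm: "hyp_Gm G A V m"
  obtains \<phi> where "\<phi> \<in> H" "\<not> zero_on G (edges G) \<phi>"
    "\<And>v. v \<in> H \<Longrightarrow> mag_form G A V \<phi> v = of_real (lambda1 G A V) * l2_inner G \<phi> v"
proof -
  obtain T and ev :: "nat \<Rightarrow> real" where T: "is_mag_schroedinger G A V T"
    and "\<forall>j. 1 \<le> j \<and> enat j \<le> m \<longrightarrow> eigenvalue G T (of_real (ev j)) \<and> ereal (ev j) < inf_ess G T"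
    using Gm unfolding hyp_Gm_def by blast
  then have ev: "eigenvalue G T (of_real (ev 1))" "ereal (ev 1) < inf_ess G T"
    using m by (simp_all add: one_enat_def)
  obtain u where u: "u \<in> H" "\<not> zero_on G (edges G) u"
    "\<And>v. v \<in> H \<Longrightarrow> mag_form G A V u v = of_real (ev 1) * l2_inner G u v"
    using eigenvalue_form[OF T ev(1)] by blast
  have "mag_normsq G A V u = ev 1 * l2_normsq G u"
    using u(3)[OF u(1)] unfolding mag_form_self l2_inner_self by (simp flip: of_real_mult)
  then have "lambda1 G A V \<le> ev 1" using lambda1_le[OF u(1)] l2_normsq_pos[OF u(1,2)] by simp
  then have "ereal (lambda1 G A V) < inf_ess G T" using ev(2) by (meson ereal_less_eq(3) le_less_trans)
  then have "of_real (lambda1 G A V) \<notin> essential_spectrum G T"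
    unfolding inf_ess_def by (metis INF_lower Re_complex_of_real not_le)
  then have "of_real (lambda1 G A V) \<in> discrete_spectrum G T"
    using lambda1_in_spectrum[OF T u(1,2)] by (simp add: essential_spectrum_def)
  then have "eigenvalue G T (of_real (lambda1 G A V))" by (simp add: discrete_spectrum_def)
  then show thesis using eigenvalue_form[OF T] that by blast
qed

end

section \<open>Critical points of prescribed mass\<close>

context magnetic_graph_power
begin

lemma critical_point_iff:
  "constrained_critical_point G A V p \<nu> u lam \<longleftrightarrow>
    u \<in> H \<and> l2_normsq G u = \<nu> \<and> (\<forall>v\<in>H. energy_form u v - core_pairing u v = lam * mass_form u v)"
  by (auto simp: constrained_critical_point_def mass_constraint_def core_pairing_def)

lemma critical_points_if_hyp_G:
  assumes G: "hyp_G G A V" and \<mu>: "\<mu> > 0" and lam: "lam < lambda1 G A V"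
  shows "(\<exists>u lam'. constrained_critical_point G A V p \<mu> u lam' \<and> lam' < lambda1 G A V) \<or>
    (\<exists>\<nu> u. 0 < \<nu> \<and> \<nu> < \<mu> \<and> constrained_critical_point G A V p \<nu> u lam)"
proof -
  obtain \<phi> where \<phi>: "\<phi> \<in> H" "\<not> zero_on G (edges G) \<phi>"
    "mag_normsq G A V \<phi> / l2_normsq G \<phi> = lambda1 G A V" "\<not> zero_on G (bounded_edges G) \<phi>"
    using G unfolding hyp_G_def by blast
  have pos: "l2_normsq G \<phi> > 0" using l2_normsq_pos \<phi> by blast
  have eq: "mag_normsq G A V \<phi> = lambda1 G A V * l2_normsq G \<phi>" using \<phi>(3) pos by (simp add: field_simps)
  have "lambda1 G A V > 0"
  proof -
    have "0 < mag_normsq G A V \<phi>" using pos l2_le_mag[OF \<phi>(1)] by linarith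
    then show ?thesis unfolding \<phi>(3)[symmetric] using pos by simp
  qed
  then have "(\<exists>u\<in>H. mass_form u u = \<mu> \<and> (\<exists>lam'<lambda1 G A V. \<forall>h\<in>H. energy_form u h - core_pairing u h = lam' * mass_form u h)) \<or>
    (\<exists>u\<in>H. 0 < mass_form u u \<and> mass_form u u < \<mu> \<and> (\<forall>h\<in>H. energy_form u h - core_pairing u h = lam * mass_form u h))"
    using \<mu> lam \<phi>(1) lambda1_le eq core_power_pos[OF \<phi>(1,4)]
    by (intro normalized_or_prescribed_multiplier) (auto simp: mag_form_self l2_inner_self)
  then show ?thesis unfolding critical_point_iff by (auto simp: l2_inner_self)
qed

text \<open>The nonlinear term vanishes identically along \<open>\<phi>\<close>.\<close>

lemma eigenfunction_critical_point:
  assumes \<phi>: "\<phi> \<in> H" "\<not> zero_on G (edges G) \<phi>" "zero_on G (bounded_edges G) \<phi>"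
    "\<And>v. v \<in> H \<Longrightarrow> mag_form G A V \<phi> v = of_real lam * l2_inner G \<phi> v" and \<mu>: "\<mu> > 0"
  shows "\<exists>u. constrained_critical_point G A V p \<mu> u lam"
proof -
  have pos: "l2_normsq G \<phi> > 0" using l2_normsq_pos \<phi> by blast
  define c where "c = sqrt (\<mu> / l2_normsq G \<phi>)"
  define u where "u = c *\<^sub>R \<phi>"
  have u: "u \<in> H" unfolding u_def using \<phi>(1) subspace_scale[OF subspace_H] by blast
  have "mass_form u u = c\<^sup>2 * mass_form \<phi> \<phi>"
    using form_scale2[OF \<phi>(1), of 0 1 c] by (simp add: form_def u_def)
  then have mass: "l2_normsq G u = \<mu>" using pos \<mu> by (simp add: l2_inner_self c_def)
  have "energy_form u v - core_pairing u v = lam * mass_form u v" if v: "v \<in> H" for v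
  proof -
    have "graph_integral G (bounded_edges G) (\<lambda>e x. of_real (cmod (u e x) powr (p - 2)) * u e x * cnj (v e x))
        = (\<Sum>e\<in>bounded_edges G. \<integral>x. 0 \<partial>leb e)"
      unfolding graph_integral_eq[OF bounded_edges_sub]
      using \<phi>(3) bounded_edges_sub
      by (intro sum.cong refl Bochner_Integration.integral_cong) (auto simp: u_def zero_on_def)
    then have "core_pairing u v = 0" by (simp add: core_pairing_def)
    moreover have "energy_form u v = lam * mass_form u v"
      using form_scale[OF \<phi>(1) v, of 1 0 c] form_scale[OF \<phi>(1) v, of 0 1 c] \<phi>(4)[OF v]
      by (simp add: form_def u_def)
    ultimately show ?thesis by simp
  qed
  then show ?thesis unfolding critical_point_iff using u mass by blast
qed

end

theorem theorem1p3:
  fixes G :: "('v, 'e) metric_graph"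
    and A V :: "'e \<Rightarrow> real \<Rightarrow> real"
    and p \<mu> :: real
  assumes "finite_metric_graph G"
    and "connected_graph G"
    and "compact_graph G \<or> (\<not> compact_graph G \<and> bounded_edges G \<noteq> {})"
    and "p > 2"
    and "\<forall>e\<in>edges G. \<forall>x\<in>edge_dom G e. V e x \<ge> 1"
    and "L2_loc G A"
    and "L1_loc G V"
    and "hyp_G G A V \<or> (\<exists>m::enat. m \<ge> 1 \<and> hyp_Gm G A V m)"
    and "\<mu> > 0"
  shows
    "(\<exists>u lam. constrained_critical_point G A V p \<mu> u lam \<and>
        lam \<le> lambda1 G A V \<and> (hyp_G G A V \<longrightarrow> lam < lambda1 G A V)) \<or>
     (\<forall>lam < lambda1 G A V. \<exists>\<nu> u. 0 < \<nu> \<and> \<nu> < \<mu> \<and>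
        constrained_critical_point G A V p \<nu> u lam)"
proof -
  interpret magnetic_graph_power G A V p
    using assms(1,4-7) by unfold_locales
  show ?thesis
  proof (cases "hyp_G G A V")
    case True
    then show ?thesis using critical_points_if_hyp_G[OF True \<open>\<mu> > 0\<close>] by (meson less_imp_le)
  next
    case False
    then obtain m where "m \<ge> 1" "hyp_Gm G A V m" using assms(8) by blast
    then obtain \<phi> where \<phi>: "\<phi> \<in> H1A G A V" "\<not> zero_on G (edges G) \<phi>"
      "\<And>v. v \<in> H1A G A V \<Longrightarrow> mag_form G A V \<phi> v = of_real (lambda1 G A V) * l2_inner G \<phi> v"
      using hyp_Gm_lambda1_attained by blast
    have "mag_normsq G A V \<phi> = lambda1 G A V * l2_normsq G \<phi>"
      using \<phi>(3)[OF \<phi>(1)] unfolding mag_form_self l2_inner_self by (simp flip: of_real_mult)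
    then have "mag_normsq G A V \<phi> / l2_normsq G \<phi> = lambda1 G A V"
      using l2_normsq_pos[OF \<phi>(1,2)] by simp
    then have "zero_on G (bounded_edges G) \<phi>" using False \<phi>(1,2) unfolding hyp_G_def by blast
    then obtain u where "constrained_critical_point G A V p \<mu> u (lambda1 G A V)"
      using eigenfunction_critical_point[OF \<phi>(1,2) _ \<phi>(3) \<open>\<mu> > 0\<close>] by blast
    then show ?thesis using False by blast
  qed
qed

end
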